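(* For Lebesgue-almost every triangle $\Delta$ (in the space of triangles up to similarity, parametrized by two of its angles $(\alpha,\beta)$ ranging over $\{\alpha>0,\beta>0,\alpha+\beta<\pi\}$ with Lebesgue measure) the following holds: for every $\epsilon>0$ there is a constant $C>0$ such that for all $n\ge 1$, $$P_n(\Delta)<C\,e^{n^{\sqrt{3}-1+\epsilon}}.$$
   Context: Consider the billiard in a triangle $\Delta$. A generalized diagonal is a billiard orbit segment that starts at a vertex of $\Delta$ and ends at a vertex of $\Delta$ (reflecting elastically off the sides in between). Its length is the number of reflections it makes. $P_n(\Delta)$ denotes the total number of generalized diagonals of $\Delta$ of length at most $n$. This number depends only on the similarity class of $\Delta$. *)

theory Defs
  imports "HOL-Analysis.Analysis"
begin

text \<open>Normalized triangle (up to similarity) with angles alpha at vertex 0, beta at vertex 1,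
  and gamma = pi - alpha - beta at the third vertex, in the complex plane.\<close>

definition tri_apex :: "real \<Rightarrow> real \<Rightarrow> complex" where
  "tri_apex \<alpha> \<beta> = complex_of_real (sin \<beta> / sin (\<alpha> + \<beta>)) * cis \<alpha>"

definition tri_vertices :: "real \<Rightarrow> real \<Rightarrow> complex set" where
  "tri_vertices \<alpha> \<beta> = {0, 1, tri_apex \<alpha> \<beta>}"

definition tri_sides :: "real \<Rightarrow> real \<Rightarrow> (complex \<times> complex) set" where
  "tri_sides \<alpha> \<beta> = {(0, 1), (1, tri_apex \<alpha> \<beta>), (tri_apex \<alpha> \<beta>, 0)}"

definition tri_region :: "real \<Rightarrow> real \<Rightarrow> complex set" where
  "tri_region \<alpha> \<beta> = convex hull (tri_vertices \<alpha> \<beta>)"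

definition reflect_dir :: "complex \<Rightarrow> complex \<Rightarrow> complex" where
  "reflect_dir d v = (d / cnj d) * cnj v"

text \<open>A generalized diagonal, given as the list of its break points
  p_0, p_1, ..., p_{k+1}: p_0 and p_{k+1} are vertices, p_1..p_k are reflection points
  in the relative interior of sides, consecutive points are distinct, each open segment
  lies in the interior of the triangle, and the elastic reflection law holds at each
  reflection point.  Its length (number of reflections) is k = length ps - 2.\<close>

definition gen_diag :: "real \<Rightarrow> real \<Rightarrow> complex list \<Rightarrow> bool" where
  "gen_diag \<alpha> \<beta> ps \<longleftrightarrow>
     length ps \<ge> 2 \<and>
     hd ps \<in> tri_vertices \<alpha> \<beta> \<and> last ps \<in> tri_vertices \<alpha> \<beta> \<and>
     (\<forall>i. i + 1 < length ps \<longrightarrow>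
        ps ! i \<noteq> ps ! (i + 1) \<and>
        open_segment (ps ! i) (ps ! (i + 1)) \<subseteq> interior (tri_region \<alpha> \<beta>)) \<and>
     (\<forall>i. 0 < i \<and> i + 1 < length ps \<longrightarrow>
        (\<exists>(a, b) \<in> tri_sides \<alpha> \<beta>. ps ! i \<in> open_segment a b \<and>
           (\<exists>t>0. ps ! (i + 1) - ps ! i
                    = complex_of_real t * reflect_dir (b - a) (ps ! i - ps ! (i - 1)))))"

definition gen_diags_upto :: "real \<Rightarrow> real \<Rightarrow> nat \<Rightarrow> complex list set" where
  "gen_diags_upto \<alpha> \<beta> n = {ps. gen_diag \<alpha> \<beta> ps \<and> length ps - 2 \<le> n}"

definition P_count :: "real \<Rightarrow> real \<Rightarrow> nat \<Rightarrow> nat" where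
  "P_count \<alpha> \<beta> n = card (gen_diags_upto \<alpha> \<beta> n)"

definition triangle_angles :: "(real \<times> real) set" where
  "triangle_angles = {(\<alpha>, \<beta>). 0 < \<alpha> \<and> 0 < \<beta> \<and> \<alpha> + \<beta> < pi}"

end

theory Submission
  imports Defs "HOL-Library.Sublist" "HOL-Real_Asymp.Real_Asymp"
    "HOL-Computational_Algebra.Fundamental_Theorem_Algebra"
begin

text \<open>
  Unfold the billiard from a vertex.  The generalized diagonals that start there and whose
  directions lie in a sector of width \<open>\<delta>\<close> form a binary tree: each unfolded vertex hit by the beam
  splits it into a left and a right part.  If a path of the tree goes left at \<open>A\<close> and right at the
  next split \<open>B\<close> (or vice versa) and then reaches \<open>C\<close>, the point \<open>C\<close> lies strictly beyond the line
  \<open>AB\<close>, so the cross product of \<open>B - A\<close> and \<open>C - A\<close> is nonzero, while it is \<open>O(n\<^sup>2 \<delta>)\<close> because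
  all three points lie in the beam.  Up to scaling this cross product is a trigonometric polynomial
  in \<open>(\<alpha>, \<beta>)\<close> with integer coefficients and degree \<open>O(m)\<close>, where \<open>m\<close> bounds the number of
  reflections between \<open>A\<close> and \<open>C\<close>.  There are \<open>O(4\<^sup>m)\<close> such polynomials, and the set where a given one
  is nonzero but smaller than \<open>r\<close> to the power \<open>O(m)\<close> has measure \<open>O(m r)\<close>.  With \<open>r\<close> the \<open>m\<close>-th
  power of 1/8, Borel-Cantelli bounds all of them below by \<open>exp (- O(m\<^sup>2))\<close> for almost every
  triangle and all large \<open>m\<close>.  Hence in a sector of width \<open>\<delta> = exp (- O(m\<^sup>2))\<close> every change of
  direction costs more than \<open>m\<close> reflections, and the tree has only \<open>exp (O((n / m) ln n))\<close> nodes.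
  Taking \<open>m\<close> to be the cube root of \<open>n\<close>, both factors are \<open>exp (O(n powr (2/3) * ln n))\<close>, which
  suffices since \<open>2/3 < sqrt 3 - 1\<close>.
\<close>

section \<open>Binary trees with long zigzags\<close>

text \<open>No Diophantine condition on the angles is imposed: the arithmetic input is only that a
  nonzero integer leading coefficient has modulus at least 1. Two features shape the proof. The
  determinant is evaluated after moving the triangle entered beyond \<open>A\<close> back to its
  original position by a similarity, so the polynomials depend only on the part of the word after
  \<open>A\<close>; their number is governed by \<open>m\<close>, not by \<open>n\<close>, and
  \<open>m\<close> may be much smaller than \<open>n\<close>. And noncollinearity is available only
  where the path changes direction: repeated turns in one direction carry no cost in letters. They
  are harmless because words obtained by always turning the same way are comparable, so there are at
  most \<open>n + 1\<close> of them; all further branching is charged to changes of direction. The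
  cube root comes from equating the two exponents, \<open>m ^ 2\<close> for the number of sectors
  and \<open>n / m\<close> for a single tree, up to logarithms.\<close>

definition meet_closed :: "bool list set \<Rightarrow> bool" where
  "meet_closed W \<longleftrightarrow> (\<forall>u p q. u @ True # p \<in> W \<longrightarrow> u @ False # q \<in> W \<longrightarrow> u \<in> W)"

lemma meet_closed_split:
  assumes "meet_closed W" "p \<in> W" "q \<in> W" "\<not> prefix p q" "\<not> prefix q p"
  obtains u a where "u \<in> W" "prefix (u @ [a]) p" "prefix (u @ [\<not> a]) q"
proof -
  from assms(4,5) have "p \<parallel> q" by auto
  from parallel_decomp[OF this] obtain u b bs c cs
    where u: "b \<noteq> c" "p = u @ b # bs" "q = u @ c # cs" by blast
  then have c: "c = (\<not> b)" by auto
  have "u \<in> W"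
    using assms(1-3) u c unfolding meet_closed_def by (cases b) auto
  then show thesis using that[of u b] u c by auto
qed

text \<open>Take a shortest word \<open>c\<close> of \<open>W\<close> above \<open>y\<close>.
  Another word above \<open>y\<close> that does not extend \<open>c\<close> branches off at some
  \<open>u\<close> in \<open>W\<close>; both words extend \<open>y\<close>, so \<open>u\<close> does
  too, and it is shorter than \<open>c\<close>.\<close>

lemma meet_closed_least:
  assumes W: "meet_closed W" and ne: "\<exists>w\<in>W. prefix y w"
  obtains c where "c \<in> W" "prefix y c" "\<And>w. w \<in> W \<Longrightarrow> prefix y w \<Longrightarrow> prefix c w"
proof -
  obtain c where c: "c \<in> W \<and> prefix y c"
    and min: "\<And>w. w \<in> W \<and> prefix y w \<Longrightarrow> length c \<le> length w"
    using ne ex_has_least_nat[of "\<lambda>w. w \<in> W \<and> prefix y w" _ length] by blast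
  have "prefix c w" if w: "w \<in> W" "prefix y w" for w
  proof (rule ccontr)
    assume n: "\<not> prefix c w"
    have "\<not> prefix w c"
      using n min[of w] w by (metis c dual_order.antisym prefix_length_le
          prefix_order.dual_order.refl prefix_same_cases not_equal_is_parallel parallelE)
    then obtain u a where u: "u \<in> W" "prefix (u @ [a]) c" "prefix (u @ [\<not> a]) w"
      using meet_closed_split[OF W _ w(1) n] c by metis
    have "prefix y u"
    proof (rule ccontr)
      assume "\<not> prefix y u"
      moreover have "prefix u c" using u(2) by (metis append_prefixD)
      ultimately have "strict_prefix u y"
        using c prefix_same_cases by (metis strict_prefixI prefix_order.order_refl)
      then obtain b where "prefix (u @ [b]) y"
        by (metis strict_prefixE' append_Cons append_Nil append_assoc prefixI)
      then have "prefix (u @ [b]) c" "prefix (u @ [b]) w" using c w by auto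
      then show False using u(2,3)
        by (auto simp: prefix_def)
    qed
    then have "length c \<le> length u" using min u(1) by blast
    moreover have "length u < length c" using u(2) by (auto simp: prefix_def)
    ultimately show False by simp
  qed
  then show thesis using that c by blast
qed

text \<open>
  With \<open>x\<close>, \<open>x @ a # p\<close> and \<open>x @ a # p @ (\<not> a) # q\<close> consecutive nodes of a path in the tree \<open>W\<close>
  that turns at the middle one, the last node is more than \<open>m\<close> letters longer than the first.
\<close>

definition zigzag_gap :: "nat \<Rightarrow> bool list set \<Rightarrow> bool" where
  "zigzag_gap m W \<longleftrightarrow> (\<forall>x a p q. x \<in> W \<longrightarrow> x @ a # p \<in> W \<longrightarrow> x @ a # p @ (\<not> a) # q \<in> W \<longrightarrow>
     (\<forall>u\<in>W. strict_prefix x u \<longrightarrow> strict_prefix u (x @ a # p @ (\<not> a) # q) \<longrightarrow> u = x @ a # p) \<longrightarrow>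
     m \<le> length p + length q + 1)"

text \<open>The nodes reached from \<open>x\<close> by turning in direction \<open>a\<close> at
  every node passed on the way; how the path continues at \<open>b\<close> itself is left
  open.\<close>

definition spine :: "bool list set \<Rightarrow> bool list \<Rightarrow> bool \<Rightarrow> bool list set" where
  "spine W x a = {b \<in> W. prefix x b \<and>
     (\<forall>u\<in>W. prefix x u \<longrightarrow> strict_prefix u b \<longrightarrow> prefix (u @ [a]) b)}"

text \<open>Two different spine words of equal length would branch at a node of \<open>W\<close>
  where both have to turn in direction \<open>a\<close>. So length is injective on a spine.\<close>

lemma card_spine_le:
  assumes W: "meet_closed W" and len: "\<And>w. w \<in> W \<Longrightarrow> length w \<le> n"
  shows "finite (spine W x a)" "card (spine W x a) \<le> n + 1"
proof -
  have inj: "inj_on length (spine W x a)"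
  proof (rule inj_onI, rule ccontr)
    fix p q assume p: "p \<in> spine W x a" and q: "q \<in> spine W x a"
      and l: "length p = length q" and ne: "p \<noteq> q"
    have "\<not> prefix p q" "\<not> prefix q p" using l ne by (auto simp: prefix_def)
    then obtain u b where u: "u \<in> W" "prefix (u @ [b]) p" "prefix (u @ [\<not> b]) q"
      using meet_closed_split[OF W] p q unfolding spine_def by blast
    have "prefix x u"
    proof (rule ccontr)
      assume "\<not> prefix x u"
      moreover have "prefix u p" using u(2) by (metis append_prefixD)
      moreover have xp: "prefix x p" "prefix x q" using p q by (auto simp: spine_def)
      ultimately have "strict_prefix u x"
        using prefix_same_cases by (metis strict_prefixI prefix_order.order_refl)
      then obtain c where "prefix (u @ [c]) x"
        by (metis strict_prefixE' append_Cons append_Nil append_assoc prefixI)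
      then have "prefix (u @ [c]) p" "prefix (u @ [c]) q" using xp by auto
      then show False using u(2,3) by (auto simp: prefix_def)
    qed
    moreover have "strict_prefix u p" "strict_prefix u q"
      using u(2,3) by (auto simp: prefix_def strict_prefix_def)
    ultimately have "prefix (u @ [a]) p" "prefix (u @ [a]) q"
      using p q u(1) by (auto simp: spine_def)
    then show False using u(2,3) by (auto simp: prefix_def)
  qed
  have sub: "length ` spine W x a \<subseteq> {..n}" using len by (auto simp: spine_def)
  show "finite (spine W x a)"
    using inj sub by (meson finite_atMost finite_imageD finite_subset)
  show "card (spine W x a) \<le> n + 1"
    using card_inj_on_le[OF inj sub] by simp
qed

text \<open>A word above \<open>x\<close> stays on the spine given by its first turn
  \<open>a\<close>, or leaves it at some \<open>b\<close>. All nodes beyond that exit extend one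
  least node \<open>c\<close>, and the zigzag formed by the node before \<open>b\<close>,
  \<open>b\<close> and \<open>c\<close> consumes \<open>m + 1\<close> letters, which pays for one
  induction step. Two directions, at most \<open>n + 1\<close> exits and \<open>1 + ?K\<close> words
  per exit give the factor \<open>4 * (n + 1)\<close>.\<close>

lemma card_above_le:
  assumes W: "meet_closed W" and len: "\<And>w. w \<in> W \<Longrightarrow> length w \<le> n"
    and zig: "zigzag_gap m W"
    and "x \<in> W" "n < length x + j * (m + 1)"
  shows "card {w \<in> W. prefix x w} \<le> (4 * (n + 1)) ^ j"
  using assms(4,5)
proof (induction j arbitrary: x)
  case 0
  then show ?case using len[of x] by simp
next
  case (Suc j)
  let ?K = "(4 * (n + 1)) ^ j"
  \<comment> \<open>An exit at \<open>x\<close> itself is dropped: such a word belongs to the spine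
    of the other direction, and no earlier node is at hand to form a zigzag.\<close>
  define E where "E a b = (if b = x then {} else {w \<in> W. prefix (b @ [\<not> a]) w})" for a b
  have "finite {w :: bool list. set w \<subseteq> UNIV \<and> length w \<le> n}"
    by (rule finite_lists_length_le) simp
  then have finW: "finite W" by (rule rev_finite_subset) (use len in auto)
  have cardE: "card (E a b) \<le> ?K" if b: "b \<in> spine W x a" for a b
  proof (cases "b = x \<or> \<not> (\<exists>w\<in>W. prefix (b @ [\<not> a]) w)")
    case True
    then have "E a b = {}" by (auto simp: E_def)
    then show ?thesis by simp
  next
    case False
    then have bx: "b \<noteq> x" and ne: "\<exists>w\<in>W. prefix (b @ [\<not> a]) w" by auto
    obtain c where c: "c \<in> W" "prefix (b @ [\<not> a]) c"
      and cl: "\<And>w. w \<in> W \<Longrightarrow> prefix (b @ [\<not> a]) w \<Longrightarrow> prefix c w"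
      using meet_closed_least[OF W ne] by blast
    have Ec: "E a b = {w \<in> W. prefix c w}"
      using bx cl c(2) by (auto simp: E_def dest: prefix_order.trans)
    have bW: "b \<in> W" and xb: "prefix x b" using b by (auto simp: spine_def)
    let ?P = "\<lambda>u. u \<in> W \<and> prefix x u \<and> strict_prefix u b"
    have "?P x" using Suc.prems bx xb by auto
    moreover have "\<forall>u. ?P u \<longrightarrow> length u < length b + 1"
      by (auto dest: prefix_length_less)
    \<comment> \<open>\<open>y\<close> is the last node before \<open>b\<close>, so that
      \<open>y\<close>, \<open>b\<close>, \<open>c\<close> are consecutive nodes.\<close>
    ultimately obtain y where y: "?P y" and ymax: "\<And>u. ?P u \<Longrightarrow> length u \<le> length y"
      using ex_has_greatest_nat[of ?P x length "length b + 1"] by auto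
    have "prefix (y @ [a]) b" using b y by (auto simp: spine_def)
    then obtain p where p: "b = y @ a # p" by (auto simp: prefix_def)
    obtain q where q: "c = y @ a # p @ (\<not> a) # q" using c(2) p by (auto simp: prefix_def)
    have "m \<le> length p + length q + 1"
    proof (rule zig[unfolded zigzag_gap_def, rule_format])
      show "y \<in> W" "y @ a # p \<in> W" using y bW p by auto
      show "y @ a # p @ (\<not> a) # q \<in> W" using c q by simp
      fix u assume u: "u \<in> W" "strict_prefix y u" "strict_prefix u (y @ a # p @ (\<not> a) # q)"
      have uc: "strict_prefix u c" using u(3) q by simp
      have bc: "prefix b c" using c(2) by (metis append_prefixD)
      have "u = b"
      proof (rule ccontr)
        assume "u \<noteq> b"
        consider "strict_prefix u b" | "strict_prefix b u"
          using uc bc \<open>u \<noteq> b\<close> prefix_same_cases by (metis strict_prefixE strict_prefixI)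
        then show False
        proof cases
          case 1
          then have "length u \<le> length y" using u(1,2) y by (intro ymax) auto
          then show False using u(2) by (auto dest: prefix_length_less)
        next
          case 2
          then obtain z zs where z: "u = b @ z # zs" by (metis strict_prefixE')
          then have "z = (\<not> a)" using uc c(2) by (auto simp: prefix_def strict_prefix_def)
          then have "prefix c u" using u(1) z by (intro cl) auto
          then show False using uc by auto
        qed
      qed
      then show "u = y @ a # p" using p by simp
    qed
    moreover have "length x \<le> length y" using y prefix_length_le by blast
    ultimately have "n < length c + j * (m + 1)" using Suc.prems(2) q by simp
    then show ?thesis using Suc.IH[OF c(1)] Ec by simp
  qed
  have sub: "{w \<in> W. prefix x w} \<subseteq> (\<Union>a. \<Union>b\<in>spine W x a. insert b (E a b))"
  proof
    fix w assume w: "w \<in> {w \<in> W. prefix x w}"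
    show "w \<in> (\<Union>a. \<Union>b\<in>spine W x a. insert b (E a b))"
    proof (cases "\<exists>a. w \<in> spine W x a")
      case True then show ?thesis by auto
    next
      case False
      have "w \<noteq> x"
        using False w by (auto simp: spine_def)
      then have "strict_prefix x w" using w by auto
      then obtain a zs where "w = x @ a # zs" by (rule strict_prefixE')
      then have a: "prefix (x @ [a]) w" by simp
      let ?P = "\<lambda>u. u \<in> W \<and> prefix x u \<and> strict_prefix u w \<and> \<not> prefix (u @ [a]) w"
      have "\<exists>u. ?P u" using False w by (auto simp: spine_def)
      \<comment> \<open>The first node at which \<open>w\<close> fails to turn in direction
        \<open>a\<close>.\<close>
      then obtain b where b: "?P b" and bmin: "\<And>u. ?P u \<Longrightarrow> length b \<le> length u"
        using ex_has_least_nat[of ?P _ length] by blast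
      have na: "prefix (b @ [\<not> a]) w"
      proof -
        from b obtain z zs where z: "w = b @ z # zs" by (metis strict_prefixE')
        then have "z = (\<not> a)" using b by auto
        then show ?thesis using z by auto
      qed
      have "b \<in> spine W x a"
        unfolding spine_def
      proof (intro CollectI conjI ballI impI)
        show "b \<in> W" "prefix x b" using b by auto
        fix u assume u: "u \<in> W" "prefix x u" "strict_prefix u b"
        then have "strict_prefix u w" using b by (meson prefix_order.less_trans)
        then have "prefix (u @ [a]) w"
          using bmin[of u] u prefix_length_less[OF u(3)] by auto
        then show "prefix (u @ [a]) b"
          using u(3) b by (metis length_append_singleton prefix_length_less prefix_length_prefix
              strict_prefix_def Suc_leI)
      qed
      moreover have "b \<noteq> x" using a b by auto
      ultimately show ?thesis using na w by (auto simp: E_def)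
    qed
  qed
  have cardU: "card (\<Union>b\<in>spine W x a. insert b (E a b)) \<le> (n + 1) * (1 + ?K)" for a
  proof -
    have "card (\<Union>b\<in>spine W x a. insert b (E a b)) \<le> (\<Sum>b\<in>spine W x a. card (insert b (E a b)))"
      using card_spine_le(1)[OF W len] by (rule card_UN_le)
    also have "\<dots> \<le> (\<Sum>b\<in>spine W x a. 1 + ?K)"
    proof (rule sum_mono)
      fix b assume "b \<in> spine W x a"
      from cardE[OF this] show "card (insert b (E a b)) \<le> 1 + ?K"
        using card_insert_le_m1[of "1 + ?K" "E a b" b] by simp
    qed
    also have "\<dots> = card (spine W x a) * (1 + ?K)" by simp
    also have "\<dots> \<le> (n + 1) * (1 + ?K)"
      using card_spine_le(2)[OF W len] by (intro mult_right_mono) auto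
    finally show ?thesis .
  qed
  have fin: "finite (\<Union>a. \<Union>b\<in>spine W x a. insert b (E a b))"
  proof -
    have "finite (E a b)" for a b using finW by (auto simp: E_def)
    then show ?thesis using card_spine_le(1)[OF W len] by auto
  qed
  have "card {w \<in> W. prefix x w} \<le> card (\<Union>a. \<Union>b\<in>spine W x a. insert b (E a b))"
    by (rule card_mono[OF fin sub])
  also have "\<dots> \<le> (\<Sum>a\<in>UNIV. card (\<Union>b\<in>spine W x a. insert b (E a b)))"
    by (rule card_UN_le) simp
  also have "\<dots> \<le> (\<Sum>a\<in>(UNIV :: bool set). (n + 1) * (1 + ?K))"
    by (rule sum_mono) (rule cardU)
  also have "\<dots> = 2 * (n + 1) * (1 + ?K)" by simp
  also have "\<dots> \<le> 2 * (n + 1) * (?K + ?K)"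
    by (intro mult_left_mono add_right_mono) auto
  also have "\<dots> = (4 * (n + 1)) ^ Suc j"
  proof -
    have "2 * N * (k + k) = 4 * N * k" for N k :: nat by simp
    then show ?thesis unfolding power_Suc .
  qed
  finally show ?case .
qed

lemma card_zigzag_tree_le:
  assumes W: "meet_closed W" and len: "\<And>w. w \<in> W \<Longrightarrow> length w \<le> n"
    and zig: "zigzag_gap m W"
  shows "card W \<le> (4 * (n + 1)) ^ (n div (m + 1) + 1)"
proof (cases "W = {}")
  case True then show ?thesis by simp
next
  case False
  then have "\<exists>w\<in>W. prefix [] w" by auto
  then obtain c where c: "c \<in> W" "\<And>w. w \<in> W \<Longrightarrow> prefix [] w \<Longrightarrow> prefix c w"
    using meet_closed_least[OF W, of "[]"] by metis
  have "n < length c + (n div (m + 1) + 1) * (m + 1)"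
    using dividend_less_times_div[of "m + 1" n] by (simp add: algebra_simps)
  from card_above_le[OF W len zig c(1) this]
  have "card {w \<in> W. prefix c w} \<le> (4 * (n + 1)) ^ (n div (m + 1) + 1)" .
  moreover have "{w \<in> W. prefix c w} = W" using c by auto
  ultimately show ?thesis by simp
qed

section \<open>Unfolding a beam of directions\<close>

definition cross :: "complex \<Rightarrow> complex \<Rightarrow> real" where
  "cross p q = Re p * Im q - Im p * Re q"

definition cross_on :: "bool \<Rightarrow> complex \<Rightarrow> complex \<Rightarrow> real" where
  "cross_on a p q = (if a then cross p q else cross q p)"

definition refl_line :: "complex \<Rightarrow> complex \<Rightarrow> complex \<Rightarrow> complex" where
  "refl_line a b p = a + reflect_dir (b - a) (p - a)"

text \<open>
  The beam starts at the origin.  A state \<open>(r, l, t)\<close> is an unfolded triangle that the beam has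
  entered through the side with right end \<open>r\<close> and left end \<open>l\<close>; the third vertex is \<open>t\<close>.  In a
  word, \<open>True\<close> means that the beam passes to the left of \<open>t\<close>, which then replaces \<open>r\<close>.
\<close>

type_synonym tri = "complex \<times> complex \<times> complex"

fun side_end :: "bool \<Rightarrow> tri \<Rightarrow> complex" where
  "side_end a (r, l, t) = (if a then r else l)"

fun tip :: "tri \<Rightarrow> complex" where
  "tip (r, l, t) = t"

fun step :: "bool \<Rightarrow> tri \<Rightarrow> tri" where
  "step a (r, l, t) = (if a then (t, l, refl_line t l r) else (r, t, refl_line r t l))"

definition run :: "bool list \<Rightarrow> tri \<Rightarrow> tri" where
  "run w S = fold step w S"

lemma run_simps [simp]: "run [] S = S" "run (a # w) S = run w (step a S)"
  "run (u @ v) S = run v (run u S)"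
  by (auto simp: run_def)

text \<open>Sign convention: \<open>cross p q > 0\<close> means that \<open>q\<close> is seen from
  the origin to the left of \<open>p\<close>. The origin is then on the positive side of the line
  from \<open>r\<close> to \<open>l\<close>, so the second inequality puts \<open>t\<close> strictly
  beyond that line.\<close>

fun pos_oriented :: "tri \<Rightarrow> bool" where
  "pos_oriented (r, l, t) \<longleftrightarrow> cross r l > 0 \<and> cross (l - r) (t - r) < 0"

definition crosses :: "complex \<Rightarrow> tri \<Rightarrow> bool" where
  "crosses z S \<longleftrightarrow> (\<forall>a. cross_on a (side_end a S) z > 0)"

text \<open>The inequalities in \<open>crosses\<close> are strict, so a ray that runs into the tip
  of a triangle follows no word leading past that triangle.\<close>

definition follows :: "complex \<Rightarrow> bool list \<Rightarrow> tri \<Rightarrow> bool" where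
  "follows z w S \<longleftrightarrow> (\<forall>u. prefix u w \<longrightarrow> crosses z (run u S))"

lemma crosses_simps: "crosses z (r, l, t) \<longleftrightarrow> cross r z > 0 \<and> cross z l > 0"
  by (simp add: crosses_def cross_on_def all_bool_eq)

lemma follows_prefix: "follows z w S \<Longrightarrow> prefix u w \<Longrightarrow> follows z u S"
  unfolding follows_def by (meson prefix_order.trans)

lemma follows_last: "follows z w S \<Longrightarrow> crosses z (run w S)"
  unfolding follows_def by blast

lemma side_end_step [simp]: "side_end a (step a S) = tip S"
  "side_end a (step (\<not> a) S) = side_end a S"
  by (cases S; cases a; simp; fail)+

lemma cross_refl_line:
  assumes "a \<noteq> b"
  shows "cross (b - a) (refl_line a b p - a) = - cross (b - a) (p - a)"
proof -
  define d e where "d = b - a" and "e = p - a"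
  have "cnj d \<noteq> 0" using assms by (simp add: d_def)
  then have "cnj d * reflect_dir d e = d * cnj e" by (simp add: reflect_dir_def)
  then have "Im (cnj d * reflect_dir d e) = Im (d * cnj e)" by simp
  then have "cross d (reflect_dir d e) = - cross d e" by (simp add: cross_def algebra_simps)
  then show ?thesis by (simp add: refl_line_def d_def e_def)
qed

text \<open>The tip may lie outside the cone from \<open>r\<close> to \<open>l\<close>. Being beyond
  their line it satisfies \<open>cross r t + cross t l > cross r l\<close>, so it cannot be outside
  on both sides; the position of \<open>z\<close> relative to \<open>t\<close> then excludes one of
  them.\<close>

lemma tip_beyond:
  assumes "cross r l > 0" "cross (l - r) (t - r) < 0" "cross r z > 0" "cross z l > 0"
  shows "cross t z > 0 \<Longrightarrow> cross t l > 0" "cross z t > 0 \<Longrightarrow> cross r t > 0"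
proof -
  have b: "cross r t + cross t l > cross r l"
    using assms(2) unfolding cross_def by (simp add: algebra_simps)
  have e: "cross r l * cross z t = cross r t * cross z l - cross t l * cross r z"
    unfolding cross_def by (simp add: algebra_simps)
  show "cross t l > 0" if h: "cross t z > 0"
  proof (rule ccontr)
    assume n: "\<not> cross t l > 0"
    then have "cross r t > 0" using b assms(1) by linarith
    then have "cross r t * cross z l > 0" "cross t l * cross r z \<le> 0"
      using assms(3,4) n by (auto simp: mult_le_0_iff)
    then have "cross r l * cross z t > 0" using e by linarith
    then have "cross z t > 0" using assms(1) by (simp add: zero_less_mult_iff)
    then show False using h unfolding cross_def by (simp add: algebra_simps)
  qed
  show "cross r t > 0" if h: "cross z t > 0"
  proof (rule ccontr)
    assume n: "\<not> cross r t > 0"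
    then have "cross t l > 0" using b assms(1) by linarith
    then have "cross t l * cross r z > 0" "cross r t * cross z l \<le> 0"
      using assms(3,4) n by (auto simp: mult_le_0_iff)
    then have "cross r l * cross z t < 0" using e by linarith
    then have "cross z t < 0" using assms(1) by (simp add: mult_less_0_iff)
    then show False using h by simp
  qed
qed

lemma pos_oriented_step:
  assumes "pos_oriented S" "crosses z S" "crosses z (step a S)"
  shows "pos_oriented (step a S)"
proof (cases S)
  case (fields r l t)
  have 1: "cross r l > 0" "cross (l - r) (t - r) < 0" "cross r z > 0" "cross z l > 0"
    using assms(1,2) fields by (auto simp: crosses_simps)
  note tb = tip_beyond[OF 1]
  show ?thesis
  proof (cases a)
    case True
    then have "cross t l > 0" using tb(1) assms(3) fields by (simp add: crosses_simps)
    moreover from this have "t \<noteq> l" by (auto simp: cross_def)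
    moreover have "cross (l - t) (r - t) = - cross (l - r) (t - r)"
      by (simp add: cross_def algebra_simps)
    ultimately show ?thesis
      using True fields 1 cross_refl_line[of t l r] by simp
  next
    case False
    then have "cross r t > 0" using tb(2) assms(3) fields by (simp add: crosses_simps)
    moreover from this have "r \<noteq> t" by (auto simp: cross_def)
    moreover have "cross (t - r) (l - r) = - cross (l - r) (t - r)"
      by (simp add: cross_def algebra_simps)
    ultimately show ?thesis
      using False fields 1 cross_refl_line[of r t l] by simp
  qed
qed

lemma pos_oriented_run:
  assumes "pos_oriented S" "follows z w S"
  shows "pos_oriented (run w S)"
  using assms(2)
proof (induction w rule: rev_induct)
  case Nil then show ?case using assms(1) by simp
next
  case (snoc a w)
  have "pos_oriented (run w S)"
    using snoc follows_prefix[of z "w @ [a]" S w] by simp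
  moreover have "crosses z (run w S)" "crosses z (step a (run w S))"
    using snoc.prems follows_prefix[of z "w @ [a]" S w] follows_last by fastforce+
  ultimately show ?case using pos_oriented_step by simp
qed

lemma cross_linear:
  "cross e (of_real x * p + of_real y * q) = x * cross e p + y * cross e q"
  "cross (of_real x * p + of_real y * q) e = x * cross p e + y * cross q e"
  by (simp_all add: cross_def algebra_simps)

lemma crosses_cone:
  assumes "crosses p S" "crosses q S" "x > 0" "y > 0"
  shows "crosses (of_real x * p + of_real y * q) S"
  using assms by (cases S) (simp add: crosses_simps cross_linear add_pos_pos)

lemma between_cone:
  assumes "cross p t > 0" "cross t q > 0" "cross p q > 0"
  obtains x y where "x > 0" "y > 0" "t = of_real x * p + of_real y * q"
proof -
  have "of_real (cross p q) * t = of_real (cross t q) * p + of_real (cross p t) * q"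
    by (simp add: complex_eq_iff cross_def algebra_simps)
  then have "t = of_real (cross t q / cross p q) * p + of_real (cross p t / cross p q) * q"
    using assms(3) by (simp add: field_simps)
  moreover have "cross t q / cross p q > 0" "cross p t / cross p q > 0" using assms by simp_all
  ultimately show thesis using that by blast
qed

section \<open>Visible unfolded vertices and their words\<close>

definition cone_closed :: "complex set \<Rightarrow> bool" where
  "cone_closed I \<longleftrightarrow> (\<forall>p\<in>I. \<forall>q\<in>I. \<forall>x>0. \<forall>y>0. of_real x * p + of_real y * q \<in> I)"

text \<open>The ray is aimed at the very tip that the word produces. So a word stands for one vertex
  visible from the origin through the unfolded sides.\<close>

definition hits :: "tri \<Rightarrow> complex set \<Rightarrow> nat \<Rightarrow> bool list set" where
  "hits S I n = {w. length w \<le> n \<and> follows (tip (run w S)) w S \<and> tip (run w S) \<in> I}"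

lemma hits_length: "w \<in> hits S I n \<Longrightarrow> length w \<le> n"
  by (simp add: hits_def)

lemma follows_append:
  "follows z (u @ v) S \<longleftrightarrow> follows z u S \<and> follows z v (run u S)"
proof
  assume h: "follows z (u @ v) S"
  show "follows z u S \<and> follows z v (run u S)"
    unfolding follows_def
  proof (intro conjI allI impI)
    fix p assume "prefix p u"
    then show "crosses z (run p S)" using h by (auto simp: follows_def)
  next
    fix p assume "prefix p v"
    then have "crosses z (run (u @ p) S)" using h unfolding follows_def by (metis same_prefix_prefix)
    then show "crosses z (run p (run u S))" by simp
  qed
next
  assume h: "follows z u S \<and> follows z v (run u S)"
  show "follows z (u @ v) S"
    unfolding follows_def
  proof (intro allI impI)
    fix p assume "prefix p (u @ v)"
    then consider "prefix p u" | q where "p = u @ q" "prefix q v"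
      by (auto simp: prefix_append)
    then show "crosses z (run p S)" using h by cases (auto simp: follows_def)
  qed
qed

lemma follows_Cons: "follows z (a # w) S \<longleftrightarrow> crosses z S \<and> follows z w (step a S)"
  using follows_append[of z "[a]" w S]
  by (auto simp: follows_def prefix_Cons)

lemma follows_Nil: "follows z [] S \<longleftrightarrow> crosses z S"
  by (simp add: follows_def)

lemma follows_first: "follows z w S \<Longrightarrow> crosses z S"
  using follows_prefix[of z w S "[]"] by (simp add: follows_Nil)

text \<open>At the branching state \<open>P\<close> is seen to the left of the tip \<open>t\<close>
  and \<open>Q\<close> to its right, so \<open>t\<close> is a positive combination of the two. The
  directions crossing a given side form a cone, and so does \<open>I\<close>; hence \<open>t\<close>
  is itself hit.\<close>

lemma meet_closed_hits:
  assumes "pos_oriented S" "cone_closed I"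
  shows "meet_closed (hits S I n)"
  unfolding meet_closed_def
proof (intro allI impI)
  fix u v w assume v: "u @ True # v \<in> hits S I n" and w: "u @ False # w \<in> hits S I n"
  define P Q where "P = tip (run (u @ True # v) S)" and "Q = tip (run (u @ False # w) S)"
  have P: "follows P (u @ True # v) S" "P \<in> I" and Q: "follows Q (u @ False # w) S" "Q \<in> I"
    using v w by (auto simp: hits_def P_def Q_def)
  obtain r l t where s: "run u S = (r, l, t)" by (metis prod_cases3)
  have Pu: "follows P u S" "crosses P (r, l, t)" "crosses P (t, l, refl_line t l r)"
    using P(1) s by (auto simp: follows_append follows_Cons dest: follows_first)
  have Qu: "follows Q u S" "crosses Q (r, l, t)" "crosses Q (r, t, refl_line r t l)"
    using Q(1) s by (auto simp: follows_append follows_Cons dest: follows_first)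
  have "pos_oriented (r, l, t)" using pos_oriented_run[OF assms(1) Pu(1)] s by simp
  then have rt: "cross r t > 0"
    using tip_beyond(2)[of r l t Q] Qu by (auto simp: crosses_simps)
  have "cross Q P * cross r t = cross Q t * cross r P + cross r Q * cross t P"
    by (simp add: cross_def algebra_simps)
  also have "\<dots> > 0"
    using Pu Qu by (intro add_pos_pos mult_pos_pos) (auto simp: crosses_simps)
  finally have "cross Q P > 0" using rt by (simp add: zero_less_mult_iff)
  then obtain x y where xy: "x > 0" "y > 0" "t = of_real x * Q + of_real y * P"
    using between_cone[of Q t P] Pu Qu by (auto simp: crosses_simps)
  have "follows t u S"
    unfolding follows_def xy(3)
    using Pu(1) Qu(1) xy by (auto simp: follows_def intro: crosses_cone)
  moreover have "t \<in> I" using assms(2) P(2) Q(2) xy unfolding cone_closed_def by blast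
  ultimately show "u \<in> hits S I n" using s v by (simp add: hits_def)
qed

text \<open>\<open>p\<close> is on the origin's side of the line through \<open>r\<close> and \<open>l\<close>.\<close>

fun near :: "complex \<Rightarrow> tri \<Rightarrow> bool" where
  "near p (r, l, t) \<longleftrightarrow> cross (l - r) (p - r) \<ge> 0"

text \<open>The old and the new line share the end that is kept, and on the relevant side of the ray
  through it the new line runs farther out because \<open>t\<close> is beyond the old one.
  Multiplication by \<open>cross r l\<close> turns this into a comparison in the coordinates
  \<open>cross r p\<close> and \<open>cross p l\<close>.\<close>

lemma near_replace:
  assumes D: "cross r l > 0" and beyond: "cross (l - r) (t - r) < 0"
    and near: "cross (l - r) (p - r) \<ge> 0"
  shows "cross p l \<ge> 0 \<Longrightarrow> cross t l > 0 \<Longrightarrow> cross (l - t) (p - t) \<ge> 0"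
    and "cross r p \<ge> 0 \<Longrightarrow> cross r t > 0 \<Longrightarrow> cross (t - r) (p - r) \<ge> 0"
proof -
  let ?D = "cross r l"
  have b: "?D - cross r t < cross t l" "?D - cross t l < cross r t"
    using beyond by (auto simp: cross_def algebra_simps)
  have n: "cross p l \<le> ?D - cross r p" "cross r p \<le> ?D - cross p l"
    using near by (auto simp: cross_def algebra_simps)
  show "cross (l - t) (p - t) \<ge> 0" if h: "cross p l \<ge> 0" "cross t l > 0"
  proof -
    have "?D * cross (l - t) (p - t) =
        cross t l * (?D - cross r p) - cross p l * (?D - cross r t)"
      by (simp add: cross_def algebra_simps)
    moreover have "cross t l * (?D - cross r p) \<ge> cross t l * cross p l"
      using n(1) h by (intro mult_left_mono) auto
    moreover have "cross p l * (?D - cross r t) \<le> cross p l * cross t l"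
      using b(1) h by (intro mult_left_mono) auto
    ultimately have "?D * cross (l - t) (p - t) \<ge> 0" by (simp add: mult.commute)
    then show ?thesis using D by (simp add: zero_le_mult_iff)
  qed
  show "cross (t - r) (p - r) \<ge> 0" if h: "cross r p \<ge> 0" "cross r t > 0"
  proof -
    have "?D * cross (t - r) (p - r) =
        cross r t * (?D - cross p l) - cross r p * (?D - cross t l)"
      by (simp add: cross_def algebra_simps)
    moreover have "cross r t * (?D - cross p l) \<ge> cross r t * cross r p"
      using n(2) h by (intro mult_left_mono) auto
    moreover have "cross r p * (?D - cross t l) \<le> cross r p * cross r t"
      using b(2) h by (intro mult_left_mono) auto
    ultimately have "?D * cross (t - r) (p - r) \<ge> 0" by (simp add: mult.commute)
    then show ?thesis using D by (simp add: zero_le_mult_iff)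
  qed
qed

text \<open>The right ends never swing past \<open>A\<close> towards \<open>C\<close>: a tip doing
  so would lie strictly between them and be visible, against \<open>none\<close>. The invariant
  therefore also records that every ray strictly between \<open>A\<close> and \<open>C\<close>
  follows the word so far; this is what makes such a tip visible. Then \<open>near_replace\<close>
  keeps \<open>A\<close> on the near side.\<close>

lemma near_right:
  assumes S: "pos_oriented S" and A: "side_end True S = A"
    and C: "follows C w S"
    and none: "\<And>u. prefix (u @ [True]) w \<Longrightarrow> cross A (tip (run u S)) > 0 \<Longrightarrow>
      \<exists>x>0. \<exists>y>0. tip (run u S) = of_real x * A + of_real y * C \<Longrightarrow> \<not> follows (tip (run u S)) u S"
  shows "near A (run w S)"
proof -
  have AC: "cross A C > 0"
    using follows_prefix[OF C Nil_prefix] A by (cases S) (auto simp: follows_Nil crosses_simps)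
  have "near A (run v S) \<and> cross (side_end True (run v S)) A \<ge> 0 \<and>
      (\<forall>x>0. \<forall>y>0. follows (of_real x * A + of_real y * C) v S)" if "prefix v w" for v
    using that
  proof (induction v rule: rev_induct)
    case Nil
    obtain l t where s: "S = (A, l, t)" using A by (cases S) auto
    have "cross A l > 0" "cross C l > 0"
      using S s follows_prefix[OF C Nil_prefix] by (auto simp: follows_Nil crosses_simps)
    then show ?case
      using s AC by (auto simp: follows_Nil crosses_simps cross_linear add_pos_pos)
        (auto simp: cross_def)
  next
    case (snoc b v)
    have vw: "prefix v w" using snoc.prems by (metis append_prefixD)
    obtain r l t where s: "run v S = (r, l, t)" by (metis prod_cases3)
    have Cv: "follows C v S" using follows_prefix[OF C vw] .
    have Cb: "follows C (v @ [b]) S" using follows_prefix[OF C snoc.prems] .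
    have pos: "cross r l > 0" "cross (l - r) (t - r) < 0"
      using pos_oriented_run[OF S Cv] s by auto
    have cr: "cross r C > 0" "cross C l > 0"
      using follows_last[OF Cv] s by (auto simp: crosses_simps)
    have pb: "pos_oriented (run (v @ [b]) S)" by (rule pos_oriented_run[OF S Cb])
    have IH: "cross (l - r) (A - r) \<ge> 0" "cross r A \<ge> 0"
      and IHf: "\<And>x y. x > 0 \<Longrightarrow> y > 0 \<Longrightarrow> follows (of_real x * A + of_real y * C) v S"
      using snoc.IH[OF vw] s by auto
    have Al: "cross A l > 0" if h: "cross r A \<ge> 0" "cross r l > 0" "cross r C > 0" "cross C l > 0"
      for r l
    proof -
      have "cross A l * cross r C = cross A C * cross r l + cross r A * cross C l"
        by (simp add: cross_def algebra_simps)
      also have "\<dots> > 0" using h AC by (simp add: add_pos_nonneg)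
      finally show ?thesis using h by (simp add: zero_less_mult_iff)
    qed
    have Al0: "cross A l > 0" using Al IH pos cr by blast
    have key: "near A (run (v @ [b]) S) \<and> cross (side_end True (run (v @ [b]) S)) A \<ge> 0"
    proof (cases b)
      case True
      have tC: "cross t C > 0"
        using follows_last[OF Cb] s True by (auto simp: crosses_simps)
      have "cross t A \<ge> 0"
      proof (rule ccontr)
        assume "\<not> cross t A \<ge> 0"
        then have At: "cross A t > 0" by (simp add: cross_def algebra_simps)
        then obtain x y where xy: "x > 0" "y > 0" "t = of_real x * A + of_real y * C"
          using between_cone[OF At tC AC] by blast
        have "follows t v S" using IHf xy by simp
        then show False using none[of v] snoc.prems True At s xy by auto
      qed
      moreover have "cross t l > 0"
        using tip_beyond(1)[OF pos cr tC] .
      ultimately show ?thesis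
        using near_replace(1)[OF pos IH(1)] Al0 s True by simp
    next
      case False
      have Ct: "cross C t > 0"
        using follows_last[OF Cb] s False by (auto simp: crosses_simps)
      have "cross r t > 0"
        using tip_beyond(2)[OF pos cr Ct] .
      then show ?thesis
        using near_replace(2)[OF pos IH(1)] IH(2) s False by simp
    qed
    obtain r' l' t' where s': "run (v @ [b]) S = (r', l', t')" by (metis prod_cases3)
    have p': "cross r' l' > 0" "cross r' C > 0" "cross C l' > 0" "cross r' A \<ge> 0"
      using pb follows_last[OF Cb] key s' by (auto simp: crosses_simps simp del: run_simps)
    have "cross A l' > 0" using Al p' by blast
    then have "follows (of_real x * A + of_real y * C) (v @ [b]) S" if "x > 0" "y > 0" for x y
      using IHf[OF that] that p' s'
      by (simp add: follows_append follows_Cons follows_Nil crosses_simps cross_linear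
          add_nonneg_pos add_pos_pos follows_last)
    then show ?case using key by blast
  qed
  then show ?thesis by blast
qed

text \<open>Mirror image of \<open>near_right\<close>.\<close>

lemma near_left:
  assumes S: "pos_oriented S" and A: "side_end False S = A"
    and C: "follows C w S"
    and none: "\<And>u. prefix (u @ [False]) w \<Longrightarrow> cross (tip (run u S)) A > 0 \<Longrightarrow>
      \<exists>x>0. \<exists>y>0. tip (run u S) = of_real x * A + of_real y * C \<Longrightarrow> \<not> follows (tip (run u S)) u S"
  shows "near A (run w S)"
proof -
  have AC: "cross C A > 0"
    using follows_prefix[OF C Nil_prefix] A by (cases S) (auto simp: follows_Nil crosses_simps)
  have "near A (run v S) \<and> cross A (side_end False (run v S)) \<ge> 0 \<and>
      (\<forall>x>0. \<forall>y>0. follows (of_real x * A + of_real y * C) v S)" if "prefix v w" for v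
    using that
  proof (induction v rule: rev_induct)
    case Nil
    obtain r t where s: "S = (r, A, t)" using A by (cases S) auto
    have "cross r A > 0" "cross r C > 0"
      using S s follows_prefix[OF C Nil_prefix] by (auto simp: follows_Nil crosses_simps)
    then show ?case
      using s AC by (auto simp: follows_Nil crosses_simps cross_linear add_pos_pos)
        (auto simp: cross_def)
  next
    case (snoc b v)
    have vw: "prefix v w" using snoc.prems by (metis append_prefixD)
    obtain r l t where s: "run v S = (r, l, t)" by (metis prod_cases3)
    have Cv: "follows C v S" using follows_prefix[OF C vw] .
    have Cb: "follows C (v @ [b]) S" using follows_prefix[OF C snoc.prems] .
    have pos: "cross r l > 0" "cross (l - r) (t - r) < 0"
      using pos_oriented_run[OF S Cv] s by auto
    have cr: "cross r C > 0" "cross C l > 0"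
      using follows_last[OF Cv] s by (auto simp: crosses_simps)
    have pb: "pos_oriented (run (v @ [b]) S)" by (rule pos_oriented_run[OF S Cb])
    have IH: "cross (l - r) (A - r) \<ge> 0" "cross A l \<ge> 0"
      and IHf: "\<And>x y. x > 0 \<Longrightarrow> y > 0 \<Longrightarrow> follows (of_real x * A + of_real y * C) v S"
      using snoc.IH[OF vw] s by auto
    have Ar: "cross r A > 0" if h: "cross A l \<ge> 0" "cross r l > 0" "cross r C > 0" "cross C l > 0"
      for r l
    proof -
      have "cross r A * cross C l = cross C A * cross r l + cross A l * cross r C"
        by (simp add: cross_def algebra_simps)
      also have "\<dots> > 0" using h AC by (simp add: add_pos_nonneg)
      finally show ?thesis using h by (simp add: zero_less_mult_iff)
    qed
    have Ar0: "cross r A > 0" using Ar IH pos cr by blast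
    have key: "near A (run (v @ [b]) S) \<and> cross A (side_end False (run (v @ [b]) S)) \<ge> 0"
    proof (cases b)
      case False
      have tC: "cross C t > 0"
        using follows_last[OF Cb] s False by (auto simp: crosses_simps)
      have "cross A t \<ge> 0"
      proof (rule ccontr)
        assume "\<not> cross A t \<ge> 0"
        then have At: "cross t A > 0" by (simp add: cross_def algebra_simps)
        then obtain x y where xy: "x > 0" "y > 0" "t = of_real x * C + of_real y * A"
          using between_cone[OF tC At AC] by blast
        then have yx: "t = of_real y * A + of_real x * C" by simp
        have "follows t v S" using IHf xy yx by simp
        then show False using none[of v] snoc.prems False At s xy(1,2) yx by fastforce
      qed
      moreover have "cross r t > 0"
        using tip_beyond(2)[OF pos cr tC] .
      ultimately show ?thesis
        using near_replace(2)[OF pos IH(1)] Ar0 s False by simp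
    next
      case True
      have Ct: "cross t C > 0"
        using follows_last[OF Cb] s True by (auto simp: crosses_simps)
      have "cross t l > 0"
        using tip_beyond(1)[OF pos cr Ct] .
      then show ?thesis
        using near_replace(1)[OF pos IH(1)] IH(2) s True by simp
    qed
    obtain r' l' t' where s': "run (v @ [b]) S = (r', l', t')" by (metis prod_cases3)
    have p': "cross r' l' > 0" "cross r' C > 0" "cross C l' > 0" "cross A l' \<ge> 0"
      using pb follows_last[OF Cb] key s' by (auto simp: crosses_simps simp del: run_simps)
    have "cross r' A > 0" using Ar p' by blast
    then have "follows (of_real x * A + of_real y * C) (v @ [b]) S" if "x > 0" "y > 0" for x y
      using IHf[OF that] that p' s'
      by (simp add: follows_append follows_Cons follows_Nil crosses_simps cross_linear
          add_nonneg_pos add_pos_pos follows_last)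
    then show ?case using key by blast
  qed
  then show ?thesis by blast
qed

text \<open>Only the part of the word after \<open>x\<close> has to be checked for the new tip: the
  sides crossed earlier are crossed by the rays to both old tips, hence by every positive
  combination of them.\<close>

lemma hits_between:
  assumes I: "cone_closed I" and x: "x \<in> hits S I n" and w: "x @ a # w \<in> hits S I n"
    and u: "prefix u w"
    and c: "\<exists>y>0. \<exists>z>0. tip (run (x @ a # u) S) =
      of_real y * tip (run x S) + of_real z * tip (run (x @ a # w) S)"
    and f: "follows (tip (run (x @ a # u) S)) u (step a (run x S))"
  shows "x @ a # u \<in> hits S I n"
proof -
  let ?A = "tip (run x S)" and ?C = "tip (run (x @ a # w) S)" and ?t = "tip (run (x @ a # u) S)"
  obtain y z where yz: "y > 0" "z > 0" "?t = of_real y * ?A + of_real z * ?C" using c by blast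
  have "follows ?A x S" "follows ?C x S"
    using x w by (auto simp: hits_def follows_append)
  then have "follows ?t x S"
    unfolding follows_def yz(3) using yz(1,2) by (auto intro: crosses_cone)
  moreover have "crosses ?t (run x S)" by (rule follows_last) fact
  ultimately have "follows ?t (x @ a # u) S"
    using f by (simp add: follows_append follows_Cons)
  moreover have "?t \<in> I"
    using I x w yz unfolding cone_closed_def hits_def by auto
  moreover have "length (x @ a # u) \<le> n"
    using w prefix_length_le[OF u] by (simp add: hits_def)
  ultimately show ?thesis by (simp add: hits_def)
qed

text \<open>If the points were collinear, the positive cross products would make \<open>C\<close> a
  convex combination of \<open>A\<close> and \<open>B\<close>, and such a point cannot be strictly
  beyond a line that has both on its near side.\<close>

lemma not_collinear_beyond:
  assumes "cross (l - r) (A - r) \<ge> 0" "cross (l - r) (B - r) \<ge> 0" "cross (l - r) (C - r) < 0"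
    and "cross A C > 0" "cross C B > 0" "cross A B > 0"
  shows "cross (B - A) (C - A) \<noteq> 0"
proof
  assume 0: "cross (B - A) (C - A) = 0"
  then have s: "cross A B = cross A C + cross C B"
    by (simp add: cross_def algebra_simps)
  define e where "e = cross (l - r) r"
  have d: "cross (l - r) (p - r) = cross (l - r) p - e" for p
    by (simp add: e_def cross_def algebra_simps)
  have "cross A B * cross (l - r) C = cross C B * cross (l - r) A + cross A C * cross (l - r) B"
    by (simp add: cross_def algebra_simps)
  moreover have "cross A B * e = cross A C * e + cross C B * e"
    by (simp add: s distrib_right)
  ultimately have "cross A B * cross (l - r) (C - r) =
      cross C B * cross (l - r) (A - r) + cross A C * cross (l - r) (B - r)"
    unfolding d right_diff_distrib by linarith
  moreover have "\<dots> \<ge> 0" using assms by simp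
  moreover have "cross A B * cross (l - r) (C - r) < 0"
    using assms(3,6) by (rule mult_pos_neg[rotated])
  ultimately show False by simp
qed

text \<open>Right after their turns \<open>A\<close> and \<open>B\<close> become ends of entered
  sides, on opposite sides of the beam. Since no other hit intervenes before \<open>C\<close>,
  \<open>near_right\<close> and \<open>near_left\<close> keep both on the near side of the last
  entered side, and \<open>C\<close> is the tip beyond it.\<close>

lemma zigzag_not_collinear:
  assumes S: "pos_oriented S" and I: "cone_closed I"
    and x: "x \<in> hits S I n" and b: "x @ a # p \<in> hits S I n"
    and c: "x @ a # p @ (\<not> a) # q \<in> hits S I n"
    and none: "\<And>u. u \<in> hits S I n \<Longrightarrow> strict_prefix x u \<Longrightarrow>
      strict_prefix u (x @ a # p @ (\<not> a) # q) \<Longrightarrow> u = x @ a # p"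
  shows "cross (tip (run (x @ a # p) S) - tip (run x S))
      (tip (run (x @ a # p @ (\<not> a) # q) S) - tip (run x S)) \<noteq> 0"
proof -
  define A B C where "A = tip (run x S)" and "B = tip (run (x @ a # p) S)"
    and "C = tip (run (x @ a # p @ (\<not> a) # q) S)"
  define S1 S2 where "S1 = step a (run x S)" and "S2 = step (\<not> a) (run (x @ a # p) S)"
  define T where "T = run (x @ a # p @ (\<not> a) # q) S"
  have Cf: "follows C (x @ a # p @ (\<not> a) # q) S"
    using c by (simp add: hits_def C_def)
  have C1: "follows C (x @ [a]) S" "follows C (p @ (\<not> a) # q) S1"
    and C2: "follows C (x @ a # p @ [\<not> a]) S" "follows C q S2"
    using Cf by (auto simp: follows_append follows_Cons follows_Nil S1_def S2_def dest: follows_first)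
  have P1: "pos_oriented S1" using pos_oriented_run[OF S C1(1)] by (simp add: S1_def)
  have P2: "pos_oriented S2" using pos_oriented_run[OF S C2(1)] by (simp add: S2_def)
  have T1: "T = run (p @ (\<not> a) # q) S1" "T = run q S2" by (simp_all add: T_def S1_def S2_def)
  have e1: "side_end a S1 = A" by (simp add: S1_def A_def)
  have e2: "side_end (\<not> a) S2 = B" by (simp add: S2_def B_def)
  have "follows B (x @ a # p) S" using b by (simp add: hits_def B_def)
  then have B1: "crosses B S1" by (auto simp: follows_append follows_Cons S1_def dest: follows_first)
  have CC: "crosses C S1" "crosses C S2" using C1(2) C2(2) by (auto dest: follows_first)
  have ord: "cross_on a A C > 0" "cross_on (\<not> a) B C > 0" "cross_on a A B > 0"
    using CC B1 e1 e2 unfolding crosses_def by metis+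
  have none1: "\<not> follows (tip (run u S1)) u S1"
    if "prefix (u @ [a]) (p @ (\<not> a) # q)"
      "\<exists>y>0. \<exists>z>0. tip (run u S1) = of_real y * A + of_real z * C" for u
  proof
    assume f: "follows (tip (run u S1)) u S1"
    have "prefix u (p @ (\<not> a) # q)" using that(1) by (metis append_prefixD)
    then have h: "x @ a # u \<in> hits S I n"
      by (rule hits_between[OF I x c]) (use that(2) f in \<open>simp_all add: A_def C_def S1_def\<close>)
    have "strict_prefix (x @ a # u) (x @ a # p @ (\<not> a) # q)"
      using that(1) by (auto simp: prefix_def strict_prefix_def)
    moreover have "strict_prefix x (x @ a # u)" by (rule strict_prefixI') simp
    \<comment> \<open>The only hit allowed in between is \<open>B\<close>, where the word continues
      with \<open>\<not> a\<close>, whereas it continues with \<open>a\<close> after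
      \<open>u\<close>.\<close>
    ultimately have "u = p" using none[OF h] by simp
    then show False using that(1) by auto
  qed
  have none2: "\<not> follows (tip (run u S2)) u S2"
    if "prefix (u @ [\<not> a]) q"
      "\<exists>y>0. \<exists>z>0. tip (run u S2) = of_real y * B + of_real z * C" for u
  proof
    assume f: "follows (tip (run u S2)) u S2"
    have u: "prefix u q" using that(1) by (metis append_prefixD)
    have c': "(x @ a # p) @ (\<not> a) # q \<in> hits S I n" using c by simp
    have h: "(x @ a # p) @ (\<not> a) # u \<in> hits S I n"
      by (rule hits_between[OF I b c' u]) (use that(2) f in \<open>simp_all add: B_def C_def S2_def\<close>)
    then have "x @ a # p @ (\<not> a) # u \<in> hits S I n" by simp
    moreover have "strict_prefix (x @ a # p @ (\<not> a) # u) (x @ a # p @ (\<not> a) # q)"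
      using that(1) by (auto simp: prefix_def strict_prefix_def)
    moreover have "strict_prefix x (x @ a # p @ (\<not> a) # u)" by (rule strict_prefixI') simp
    ultimately have "x @ a # p @ (\<not> a) # u = x @ a # p" by (intro none) auto
    then show False by simp
  qed
  have Tp: "pos_oriented T" unfolding T_def by (rule pos_oriented_run[OF S Cf])
  obtain r l where T: "T = (r, l, C)" unfolding T_def C_def by (cases "run (x @ a # p @ (\<not> a) # q) S") simp
  have Cb: "cross (l - r) (C - r) < 0" using Tp T by simp
  have "cross (B - A) (C - A) \<noteq> 0"
  proof (cases a)
    case True
    have "near A T" unfolding T1(1)
      by (rule near_right[OF P1 _ C1(2)]) (use e1 none1 True in auto)
    moreover have "near B T" unfolding T1(2)
      by (rule near_left[OF P2 _ C2(2)]) (use e2 none2 True in auto)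
    ultimately show ?thesis
      using ord True Cb T by (intro not_collinear_beyond[of l r]) (auto simp: cross_on_def)
  next
    case False
    have "near A T" unfolding T1(1)
      by (rule near_left[OF P1 _ C1(2)]) (use e1 none1 False in auto)
    moreover have "near B T" unfolding T1(2)
      by (rule near_right[OF P2 _ C2(2)]) (use e2 none2 False in auto)
    ultimately have "cross (A - B) (C - B) \<noteq> 0"
      using ord False Cb T by (intro not_collinear_beyond[of l r]) (auto simp: cross_on_def)
    then show ?thesis by (simp add: cross_def algebra_simps)
  qed
  then show ?thesis by (simp add: A_def B_def C_def)
qed

section \<open>Similarities acting on unfolded triangles\<close>

definition similarity :: "real \<Rightarrow> (complex \<Rightarrow> complex) \<Rightarrow> bool" where
  "similarity \<rho> g \<longleftrightarrow> (\<exists>u t. cmod u = \<rho> \<and> (g = (\<lambda>p. u * p + t) \<or> g = (\<lambda>p. u * cnj p + t)))"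

fun map_tri :: "(complex \<Rightarrow> complex) \<Rightarrow> tri \<Rightarrow> tri" where
  "map_tri g (r, l, t) = (g r, g l, g t)"

lemma similarity_comp:
  assumes "similarity \<rho> g" "similarity \<sigma> h"
  shows "similarity (\<rho> * \<sigma>) (\<lambda>p. g (h p))"
proof -
  obtain u t v s where u: "cmod u = \<rho>" and g: "g = (\<lambda>p. u * p + t) \<or> g = (\<lambda>p. u * cnj p + t)"
    and v: "cmod v = \<sigma>" and h: "h = (\<lambda>p. v * p + s) \<or> h = (\<lambda>p. v * cnj p + s)"
    using assms unfolding similarity_def by auto
  have "(\<lambda>p. g (h p)) = (\<lambda>p. (u * v) * p + (u * s + t)) \<or>
        (\<lambda>p. g (h p)) = (\<lambda>p. (u * v) * cnj p + (u * s + t)) \<or>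
        (\<lambda>p. g (h p)) = (\<lambda>p. (u * cnj v) * p + (u * cnj s + t)) \<or>
        (\<lambda>p. g (h p)) = (\<lambda>p. (u * cnj v) * cnj p + (u * cnj s + t))"
    using g h by (auto simp: algebra_simps)
  moreover have "cmod (u * v) = \<rho> * \<sigma>" "cmod (u * cnj v) = \<rho> * \<sigma>"
    using u v by (simp_all add: norm_mult)
  ultimately show ?thesis unfolding similarity_def by blast
qed

lemma similarity_refl_line:
  assumes "a \<noteq> b"
  shows "similarity 1 (refl_line a b)"
proof -
  define u where "u = (b - a) / cnj (b - a)"
  have "refl_line a b p = a + u * (cnj p - cnj a)" for p
    by (simp add: refl_line_def reflect_dir_def u_def)
  then have r: "refl_line a b = (\<lambda>p. u * cnj p + (a - u * cnj a))"
    by (simp add: fun_eq_iff algebra_simps)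
  have "cmod u = 1" using assms by (simp add: u_def norm_divide del: complex_cnj_diff)
  then show ?thesis unfolding similarity_def r by (intro exI[of _ u] exI conjI disjI2) auto
qed

lemma similarity_refl_line_commute:
  assumes "similarity \<rho> g" "\<rho> > 0"
  shows "refl_line (g a) (g b) (g p) = g (refl_line a b p)"
proof -
  obtain u t where u: "cmod u = \<rho>" and g: "g = (\<lambda>p. u * p + t) \<or> g = (\<lambda>p. u * cnj p + t)"
    using assms unfolding similarity_def by auto
  have u0: "u \<noteq> 0" using u assms(2) by auto
  have 1: "u * b - u * a = u * (b - a)" "u * p - u * a = u * (p - a)" for b a p
    by (simp_all add: algebra_simps)
  from g show ?thesis
  proof
    assume "g = (\<lambda>p. u * p + t)"
    then show ?thesis using u0
      by (simp add: refl_line_def reflect_dir_def 1 del: complex_cnj_diff) (simp add: algebra_simps)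
  next
    assume "g = (\<lambda>p. u * cnj p + t)"
    then show ?thesis using u0
      by (simp add: refl_line_def reflect_dir_def 1 complex_cnj_diff [symmetric] del: complex_cnj_diff)
        (simp add: algebra_simps)
  qed
qed

lemma run_map_tri:
  assumes "similarity \<rho> g" "\<rho> > 0"
  shows "run w (map_tri g S) = map_tri g (run w S)"
proof (induction w arbitrary: S)
  case Nil then show ?case by simp
next
  case (Cons a w)
  have "step a (map_tri g S) = map_tri g (step a S)"
    using similarity_refl_line_commute[OF assms] by (cases S) auto
  then show ?case using Cons by simp
qed

lemma cross_similarity:
  assumes "similarity \<rho> g"
  shows "\<bar>cross (g b - g a) (g c - g a)\<bar> = \<rho>\<^sup>2 * \<bar>cross (b - a) (c - a)\<bar>"
proof -
  obtain u t where u: "cmod u = \<rho>" and g: "g = (\<lambda>p. u * p + t) \<or> g = (\<lambda>p. u * cnj p + t)"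
    using assms unfolding similarity_def by auto
  have r: "\<rho>\<^sup>2 = Re u * Re u + Im u * Im u"
    using u cmod_power2[of u] by (simp add: power2_eq_square)
  have m: "cross (u * p) (u * q) = \<rho>\<^sup>2 * cross p q" for p q
    unfolding r by (simp add: cross_def algebra_simps)
  have c: "cross (cnj p) (cnj q) = - cross p q" for p q by (simp add: cross_def)
  from g show ?thesis
  proof
    assume "g = (\<lambda>p. u * p + t)"
    then have d: "g p - g q = u * (p - q)" for p q by (simp add: right_diff_distrib)
    show ?thesis unfolding d m abs_mult by simp
  next
    assume "g = (\<lambda>p. u * cnj p + t)"
    then have d: "g p - g q = u * cnj (p - q)" for p q by (simp add: right_diff_distrib)
    show ?thesis unfolding d m c abs_mult by simp
  qed
qed

section \<open>Sublevel sets of integer trigonometric polynomials\<close>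

text \<open>On \<open>[0, pi / 4]\<close> the cosine is at least \<open>sqrt 2 / 2\<close>, so the
  mean value theorem bounds the sine there; the double angle formula extends the bound.\<close>

lemma sin_ge_half:
  fixes z :: real
  assumes "0 \<le> z" "z \<le> pi / 2"
  shows "sin z \<ge> z / 2"
proof -
  define w where "w = z / 2"
  have w: "0 \<le> w" "w \<le> pi / 4" using assms by (auto simp: w_def)
  have c: "cos v \<ge> sqrt 2 / 2" if "0 \<le> v" "v \<le> pi / 4" for v
    using cos_monotone_0_pi_le[of v "pi / 4"] that by (simp add: cos_45)
  have "sin w \<ge> w * (sqrt 2 / 2)"
  proof (cases "w = 0")
    case False
    then obtain v where v: "0 < v" "v < w" "sin w - sin 0 = (w - 0) * cos v"
      using MVT2[of 0 w sin cos] w by (auto intro: DERIV_sin)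
    then show ?thesis using c[of v] w by (auto intro: mult_left_mono)
  qed simp
  then have "sin w * cos w \<ge> w * (sqrt 2 / 2) * (sqrt 2 / 2)"
    using c[OF w] w sin_ge_zero[of w] by (intro mult_mono) auto
  moreover have "sin z = 2 * (sin w * cos w)" using sin_double[of w] by (simp add: w_def)
  ultimately show ?thesis by (simp add: w_def field_simps)
qed

text \<open>The chord is \<open>2 * sin (\<bar>x - y\<bar> / 2)\<close>, and on a half circle this
  half-angle is at most \<open>pi / 2\<close>.\<close>

lemma dist_cis_ge:
  assumes "x \<in> {0..pi}" "y \<in> {0..pi}"
  shows "cmod (cis x - cis y) \<ge> \<bar>x - y\<bar> / 2"
proof -
  let ?z = "\<bar>x - y\<bar> / 2"
  have "(cmod (cis x - cis y))\<^sup>2 = (cos x - cos y)\<^sup>2 + (sin x - sin y)\<^sup>2"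
    by (simp add: cmod_power2)
  also have "\<dots> = 2 - 2 * cos (x - y)"
    using sin_cos_squared_add[of x] sin_cos_squared_add[of y]
    by (simp add: cos_diff power2_diff algebra_simps)
  also have "cos (x - y) = cos (2 * ?z)" by (simp add: abs_if) (metis cos_minus minus_diff_eq)
  also have "2 - 2 * cos (2 * ?z) = (2 * sin ?z)\<^sup>2"
    by (subst cos_double_sin) (simp add: power2_eq_square)
  finally have "(cmod (cis x - cis y))\<^sup>2 = (2 * sin ?z)\<^sup>2" .
  moreover have "2 * sin ?z \<ge> ?z"
    using sin_ge_half[of ?z] assms by (auto simp: abs_if)
  ultimately show ?thesis
    by (smt (verit) norm_ge_zero power2_eq_iff_nonneg zero_le_divide_iff)
qed

lemma emeasure_near_root_le:
  assumes "r \<ge> 0"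
  shows "emeasure lborel {x \<in> {0..pi}. cmod (cis x - z) < r} \<le> ennreal (8 * r)"
proof (cases "\<exists>y\<in>{0..pi}. cmod (cis y - z) < r")
  case False
  then have "{x \<in> {0..pi}. cmod (cis x - z) < r} = {}" by auto
  then show ?thesis by (simp only: emeasure_empty zero_le)
next
  case True
  then obtain y where y: "y \<in> {0..pi}" "cmod (cis y - z) < r" by blast
  have "{x \<in> {0..pi}. cmod (cis x - z) < r} \<subseteq> {y - 4 * r..y + 4 * r}"
  proof
    fix x assume x: "x \<in> {x \<in> {0..pi}. cmod (cis x - z) < r}"
    have "cmod (cis x - cis y) \<le> cmod (cis x - z) + cmod (cis y - z)"
      using norm_triangle_ineq4[of "cis x - z" "cis y - z"] by simp
    then have "\<bar>x - y\<bar> / 2 < 2 * r" using dist_cis_ge[of x y] x y by auto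
    then show "x \<in> {y - 4 * r..y + 4 * r}" by auto
  qed
  then have "emeasure lborel {x \<in> {0..pi}. cmod (cis x - z) < r} \<le>
      emeasure lborel {y - 4 * r..y + 4 * r}"
    by (rule emeasure_mono) simp
  then show ?thesis using assms by (simp add: algebra_simps)
qed

text \<open>Where \<open>cis x\<close> keeps distance \<open>r\<close> from all roots, each linear
  factor is at least \<open>r\<close>. A small value thus forces \<open>cis x\<close> into one of at
  most \<open>N\<close> discs, each accounting for measure at most \<open>8 * r\<close>.\<close>

lemma emeasure_poly_sublevel_le:
  fixes p :: "complex poly"
  assumes p: "degree p \<le> N" "cmod (lead_coeff p) \<ge> \<eta>" and "\<eta> > 0" and r: "0 < r" "r \<le> 1"
  shows "emeasure lborel {x \<in> {0..pi}. cmod (poly p (cis x)) < \<eta> * r ^ N} \<le> ennreal (8 * real N * r)"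
proof -
  have p0: "p \<noteq> 0" using p(2) \<open>\<eta> > 0\<close> by auto
  obtain A where A: "size A = degree p" "p = smult (lead_coeff p) (\<Prod>x\<in>#A. [:-x, 1:])"
    using alg_closed_imp_factorization[OF p0] by blast
  have pv: "cmod (poly p w) = cmod (lead_coeff p) * (\<Prod>x\<in>#A. cmod (w - x))" for w
  proof -
    have "poly p w = lead_coeff p * (\<Prod>x\<in>#A. w - x)"
      by (subst A(2)) (simp add: poly_prod_mset image_mset.compositionality o_def)
    moreover have "cmod (\<Prod>x\<in>#B. w - x) = (\<Prod>x\<in>#B. cmod (w - x))" for B
      by (induction B) (auto simp: norm_mult)
    ultimately show ?thesis by (simp add: norm_mult)
  qed
  have big: "(\<Prod>x\<in>#B. cmod (w - x)) \<ge> r ^ size B" if "\<And>x. x \<in># B \<Longrightarrow> cmod (w - x) \<ge> r" for w B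
    using that
  proof (induction B)
    case (add x B)
    then show ?case using r by (auto intro!: mult_mono)
  qed simp
  have "{x \<in> {0..pi}. cmod (poly p (cis x)) < \<eta> * r ^ N} \<subseteq>
      (\<Union>z\<in>set_mset A. {x \<in> {0..pi}. cmod (cis x - z) < r})"
  proof
    fix x assume x: "x \<in> {x \<in> {0..pi}. cmod (poly p (cis x)) < \<eta> * r ^ N}"
    show "x \<in> (\<Union>z\<in>set_mset A. {x \<in> {0..pi}. cmod (cis x - z) < r})"
    proof (rule ccontr)
      assume "\<not> ?thesis"
      then have "\<And>z. z \<in># A \<Longrightarrow> cmod (cis x - z) \<ge> r" using x by force
      then have "(\<Prod>z\<in>#A. cmod (cis x - z)) \<ge> r ^ size A" by (rule big)
      moreover have "r ^ size A \<ge> r ^ N" using A(1) p(1) r by (simp add: power_decreasing)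
      ultimately have "cmod (poly p (cis x)) \<ge> \<eta> * r ^ N"
        unfolding pv using p(2) \<open>\<eta> > 0\<close> r by (intro mult_mono) auto
      then show False using x by simp
    qed
  qed
  moreover have meas: "{x \<in> {0..pi}. cmod (cis x - z) < r} \<in> sets lborel" for z
  proof -
    have "{x. cmod (cis x - z) < r} \<in> sets borel"
      by (intro borel_open open_Collect_less continuous_intros)
    moreover have "{x \<in> {0..pi}. cmod (cis x - z) < r} = {0..pi} \<inter> {x. cmod (cis x - z) < r}" by auto
    ultimately show ?thesis by simp
  qed
  ultimately have "emeasure lborel {x \<in> {0..pi}. cmod (poly p (cis x)) < \<eta> * r ^ N} \<le>
      emeasure lborel (\<Union>z\<in>set_mset A. {x \<in> {0..pi}. cmod (cis x - z) < r})"
    by (intro emeasure_mono sets.finite_UN) auto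
  also have "\<dots> \<le> (\<Sum>z\<in>set_mset A. emeasure lborel {x \<in> {0..pi}. cmod (cis x - z) < r})"
    using meas by (intro emeasure_subadditive_finite) auto
  also have "\<dots> \<le> (\<Sum>z\<in>set_mset A. ennreal (8 * r))"
    using r by (intro sum_mono emeasure_near_root_le) auto
  also have "\<dots> = ennreal (8 * real (card (set_mset A)) * r)"
    using r by (simp add: ennreal_of_nat_eq_real_of_nat ennreal_mult' [symmetric] algebra_simps)
  also have "\<dots> \<le> ennreal (8 * real N * r)"
  proof -
    have "card (set_mset A) \<le> size A"
      by (metis card_length set_mset_mset size_mset ex_mset)
    then show ?thesis using A(1) p(1) r by (intro ennreal_leI mult_right_mono) auto
  qed
  finally show ?thesis .
qed

section \<open>Trigonometric polynomials in two angles with integer coefficients\<close>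

inductive trig_poly :: "nat \<Rightarrow> (real \<Rightarrow> real \<Rightarrow> complex) \<Rightarrow> bool" for D where
  trig_poly_0: "trig_poly D (\<lambda>a b. 0)"
| trig_poly_add_monom: "\<bar>k\<bar> \<le> int D \<Longrightarrow> \<bar>l\<bar> \<le> int D \<Longrightarrow> trig_poly D f \<Longrightarrow>
    trig_poly D (\<lambda>a b. of_int c * cis (of_int k * a + of_int l * b) + f a b)"

lemma trig_poly_monom:
  assumes "\<bar>k\<bar> \<le> int D" "\<bar>l\<bar> \<le> int D"
  shows "trig_poly D (\<lambda>a b. of_int c * cis (of_int k * a + of_int l * b))"
  using trig_poly_add_monom[OF assms trig_poly_0] by simp

lemma trig_poly_mono: "trig_poly D f \<Longrightarrow> D \<le> E \<Longrightarrow> trig_poly E f"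
  by (induction rule: trig_poly.induct) (auto intro: trig_poly.intros)

lemma trig_poly_add:
  assumes "trig_poly D f" "trig_poly D g"
  shows "trig_poly D (\<lambda>a b. f a b + g a b)"
  using assms(1)
proof induction
  case trig_poly_0
  then show ?case using assms(2) by simp
next
  case (trig_poly_add_monom k l f c)
  then show ?case
    using trig_poly.trig_poly_add_monom[OF trig_poly_add_monom(1,2,4)] by (simp add: add.assoc)
qed

lemma trig_poly_monom_mult:
  assumes "trig_poly D f" "\<bar>k\<bar> \<le> int E" "\<bar>l\<bar> \<le> int E"
  shows "trig_poly (D + E) (\<lambda>a b. of_int c * cis (of_int k * a + of_int l * b) * f a b)"
  using assms(1)
proof induction
  case trig_poly_0
  then show ?case using trig_poly.trig_poly_0 by simp
next
  case (trig_poly_add_monom k' l' f c')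
  have "trig_poly (D + E) (\<lambda>a b. of_int (c * c') * cis (of_int (k + k') * a + of_int (l + l') * b)
      + of_int c * cis (of_int k * a + of_int l * b) * f a b)"
    using assms trig_poly_add_monom by (intro trig_poly.trig_poly_add_monom) auto
  then show ?case by (simp add: algebra_simps flip: cis_mult)
qed

lemma trig_poly_mult:
  assumes "trig_poly E f" "trig_poly D g"
  shows "trig_poly (D + E) (\<lambda>a b. f a b * g a b)"
  using assms(1)
proof induction
  case trig_poly_0
  then show ?case using trig_poly.trig_poly_0 by simp
next
  case (trig_poly_add_monom k l f c)
  then show ?case
    using trig_poly_add[OF trig_poly_monom_mult[OF assms(2) trig_poly_add_monom(1,2), of c]
        trig_poly_add_monom(4)]
    by (simp add: distrib_right)
qed

lemma trig_poly_cnj: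
  assumes "trig_poly D f"
  shows "trig_poly D (\<lambda>a b. cnj (f a b))"
  using assms
proof induction
  case trig_poly_0
  then show ?case using trig_poly.trig_poly_0 by simp
next
  case (trig_poly_add_monom k l f c)
  have "trig_poly D (\<lambda>a b. of_int c * cis (of_int (- k) * a + of_int (- l) * b) + cnj (f a b))"
    using trig_poly_add_monom by (intro trig_poly.trig_poly_add_monom) auto
  then show ?case by (simp add: cis_cnj)
qed

lemma trig_poly_uminus: "trig_poly D f \<Longrightarrow> trig_poly D (\<lambda>a b. - f a b)"
  using trig_poly_monom_mult[of D f 0 0 0 "-1"] by simp

lemma trig_poly_diff: "trig_poly D f \<Longrightarrow> trig_poly D g \<Longrightarrow> trig_poly D (\<lambda>a b. f a b - g a b)"
  using trig_poly_add[OF _ trig_poly_uminus, of D f g] by simp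

lemma trig_poly_continuous:
  assumes "trig_poly D f"
  shows "continuous_on UNIV (\<lambda>x. f (fst x) (snd x))"
  using assms by induction (auto intro!: continuous_intros)

text \<open>The unimodular factor \<open>cis (real D * (a + b))\<close> shifts all frequencies into
  the range from 0 to \<open>2 * D\<close> without changing the modulus. What remains is an ordinary
  polynomial, sorted by powers of \<open>cis b\<close>.\<close>

lemma trig_poly_coeffs:
  assumes "trig_poly D f"
  obtains p :: "nat \<Rightarrow> complex poly" where "\<And>i. degree (p i) \<le> 2 * D"
    "\<And>i j. coeff (p i) j \<in> \<int>"
    "\<And>a b. f a b * cis (real D * (a + b)) = (\<Sum>i\<le>2 * D. poly (p i) (cis a) * cis b ^ i)"
proof -
  have "\<exists>p :: nat \<Rightarrow> complex poly. (\<forall>i. degree (p i) \<le> 2 * D) \<and> (\<forall>i j. coeff (p i) j \<in> \<int>) \<and>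
      (\<forall>a b. f a b * cis (real D * (a + b)) = (\<Sum>i\<le>2 * D. poly (p i) (cis a) * cis b ^ i))"
    using assms
  proof induction
    case trig_poly_0
    show ?case by (rule exI[of _ "\<lambda>_. 0"]) simp
  next
    case (trig_poly_add_monom k l f c)
    then obtain p :: "nat \<Rightarrow> complex poly" where p: "\<And>i. degree (p i) \<le> 2 * D"
      "\<And>i j. coeff (p i) j \<in> \<int>"
      "\<And>a b. f a b * cis (real D * (a + b)) = (\<Sum>i\<le>2 * D. poly (p i) (cis a) * cis b ^ i)"
      by blast
    define i0 j0 where "i0 = nat (l + int D)" and "j0 = nat (k + int D)"
    have ij: "int i0 = l + int D" "int j0 = k + int D" "i0 \<le> 2 * D" "j0 \<le> 2 * D"
      using trig_poly_add_monom(1,2) by (auto simp: i0_def j0_def)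
    define q where "q = (\<lambda>i. p i + (if i = i0 then monom (of_int c) j0 else 0))"
    have "degree (q i) \<le> 2 * D" for i
      unfolding q_def using p(1)[of i] ij(4) degree_monom_le[of "of_int c :: complex" j0]
      by (intro degree_add_le) auto
    moreover have "coeff (q i) j \<in> \<int>" for i j
      using p(2) by (auto simp: q_def)
    moreover have "(of_int c * cis (of_int k * a + of_int l * b) + f a b) * cis (real D * (a + b)) =
        (\<Sum>i\<le>2 * D. poly (q i) (cis a) * cis b ^ i)" for a b
    proof -
      have r: "real i0 = of_int l + real D" "real j0 = of_int k + real D"
        using ij(1,2) by (metis of_int_add of_int_of_nat_eq)+
      have "(\<Sum>i\<le>2 * D. poly (q i) (cis a) * cis b ^ i) =
          (\<Sum>i\<le>2 * D. poly (p i) (cis a) * cis b ^ i) +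
          (\<Sum>i\<le>2 * D. if i = i0 then of_int c * cis a ^ j0 * cis b ^ i else 0)"
        unfolding sum.distrib [symmetric] q_def
        by (intro sum.cong) (auto simp: poly_monom algebra_simps)
      also have "(\<Sum>i\<le>2 * D. if i = i0 then of_int c * cis a ^ j0 * cis b ^ i else 0) =
          of_int c * (cis a ^ j0 * cis b ^ i0)" using ij(3) by simp
      also have "cis a ^ j0 * cis b ^ i0 = cis (of_int k * a + of_int l * b) * cis (real D * (a + b))"
      proof -
        have "real j0 * a + real i0 * b = (of_int k * a + of_int l * b) + real D * (a + b)"
          by (simp add: r algebra_simps)
        then show ?thesis by (simp only: Complex.DeMoivre cis_mult)
      qed
      finally show ?thesis using p(3)[of a b] by (simp add: algebra_simps)
    qed
    ultimately show ?case by blast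
  qed
  then show thesis using that by blast
qed

definition small_set :: "(real \<Rightarrow> real \<Rightarrow> complex) \<Rightarrow> real \<Rightarrow> (real \<times> real) set" where
  "small_set f s = {x \<in> {0..pi} \<times> {0..pi}. cmod (f (fst x) (snd x)) < s}"

lemma small_set_sets:
  assumes "trig_poly D f"
  shows "small_set f s \<in> sets borel"
proof -
  have "{x. cmod (f (fst x) (snd x)) < s} \<in> sets borel"
    using trig_poly_continuous[OF assms] by (intro borel_open open_Collect_less continuous_intros)
  moreover have "{0..pi} \<times> {0..pi} \<in> sets (borel :: (real \<times> real) measure)"
    by (intro borel_closed closed_Times) auto
  moreover have "small_set f s = ({0..pi} \<times> {0..pi}) \<inter> {x. cmod (f (fst x) (snd x)) < s}"
    by (auto simp: small_set_def)
  ultimately show ?thesis by simp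
qed

text \<open>One variable at a time. The top coefficient \<open>p j\<close> has a nonzero integer as
  its own leading coefficient, so its modulus is at least \<open>r ^ (2 * D)\<close> off a set
  \<open>E\<close> of measure at most \<open>16 * D * r\<close>. For \<open>a\<close> outside
  \<open>E\<close> the slice in \<open>b\<close> has a leading coefficient of that size, and the
  one-variable bound applies again. Both contributions are multiplied by 4, a bound for the side
  length \<open>pi\<close>.\<close>

lemma emeasure_small_set_le:
  assumes f: "trig_poly D f" and nz: "f a0 b0 \<noteq> 0" and r: "0 < r" "r \<le> 1"
  shows "emeasure lborel (small_set f (r ^ (4 * D))) \<le> ennreal (128 * real D * r)"
proof -
  obtain p :: "nat \<Rightarrow> complex poly" where p: "\<And>i. degree (p i) \<le> 2 * D"
      "\<And>i j. coeff (p i) j \<in> \<int>"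
      "\<And>a b. f a b * cis (real D * (a + b)) = (\<Sum>i\<le>2 * D. poly (p i) (cis a) * cis b ^ i)"
    using trig_poly_coeffs[OF f] by blast
  have "\<exists>i\<le>2 * D. p i \<noteq> 0"
  proof (rule ccontr)
    assume "\<not> ?thesis"
    then have "f a0 b0 * cis (real D * (a0 + b0)) = 0" unfolding p(3) by simp
    then show False using nz by simp
  qed
  then have ne: "{i. i \<le> 2 * D \<and> p i \<noteq> 0} \<noteq> {}" by blast
  define j where "j = Max {i. i \<le> 2 * D \<and> p i \<noteq> 0}"
  have j: "j \<le> 2 * D" "p j \<noteq> 0" using Max_in[OF _ ne] by (simp_all add: j_def)
  have jmax: "i \<le> j" if "i \<le> 2 * D" "p i \<noteq> 0" for i
    using that Max_ge[of "{i. i \<le> 2 * D \<and> p i \<noteq> 0}" i] by (simp add: j_def)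
  define E where "E = {a \<in> {0..pi}. cmod (poly (p j) (cis a)) < 1 * r ^ (2 * D)}"
  have lc: "cmod (lead_coeff (p j)) \<ge> 1"
  proof -
    obtain z where z: "lead_coeff (p j) = of_int z" using p(2) Ints_cases by blast
    then have "z \<noteq> 0" using j(2) by auto
    then show ?thesis using z by simp
  qed
  have E: "emeasure lborel E \<le> ennreal (16 * real D * r)"
    using emeasure_poly_sublevel_le[of "p j" "2 * D" 1 r] p(1) lc r by (simp add: E_def algebra_simps)
  have Es: "E \<in> sets lborel"
  proof -
    have "{a. cmod (poly (p j) (cis a)) < 1 * r ^ (2 * D)} \<in> sets borel"
      by (intro borel_open open_Collect_less continuous_intros)
    moreover have "E = {0..pi} \<inter> {a. cmod (poly (p j) (cis a)) < 1 * r ^ (2 * D)}"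
      by (auto simp: E_def)
    ultimately show ?thesis by simp
  qed
  let ?s = "small_set f (r ^ (4 * D))"
  have slice: "emeasure lborel (Pair a -` ?s) \<le>
      ennreal 4 * indicator E a + ennreal (16 * real D * r) * indicator {0..pi} a" for a
  proof (cases "a \<in> {0..pi}")
    case False
    then have "Pair a -` ?s = {}" by (auto simp: small_set_def)
    then show ?thesis by simp
  next
    case a: True
    show ?thesis
    proof (cases "a \<in> E")
      case True
      have "Pair a -` ?s \<subseteq> {0..pi}" by (auto simp: small_set_def)
      then have "emeasure lborel (Pair a -` ?s) \<le> emeasure lborel {0..pi}"
        by (rule emeasure_mono) simp
      also have "\<dots> = ennreal pi" by simp
      also have "\<dots> \<le> ennreal 4" using pi_less_4 by (intro ennreal_leI) simp
      also have "\<dots> \<le> ennreal 4 * indicator E a + ennreal (16 * real D * r) * indicator {0..pi} a"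
        using True by simp
      finally show ?thesis .
    next
      case False
      then have big: "cmod (poly (p j) (cis a)) \<ge> r ^ (2 * D)" using a by (auto simp: E_def)
      define q where "q = (\<Sum>i\<le>j. monom (poly (p i) (cis a)) i)"
      have cq: "coeff q i = (if i \<le> j then poly (p i) (cis a) else 0)" for i
        by (auto simp: q_def coeff_sum if_distrib cong: if_cong)
      have rj: "r ^ (2 * D) > 0" using r by simp
      have dq: "degree q = j"
      proof (rule antisym)
        show "degree q \<le> j" by (rule degree_le) (simp add: cq)
        have "coeff q j \<noteq> 0" using big rj by (auto simp: cq)
        then show "j \<le> degree q" by (rule le_degree)
      qed
      have fq: "cmod (f a b) = cmod (poly q (cis b))" for b
      proof -
        have "poly q (cis b) = (\<Sum>i\<le>j. poly (p i) (cis a) * cis b ^ i)"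
          by (simp add: q_def poly_sum poly_monom)
        also have "\<dots> = (\<Sum>i\<le>2 * D. poly (p i) (cis a) * cis b ^ i)"
          using j(1) jmax by (intro sum.mono_neutral_left) force+
        also have "\<dots> = f a b * cis (real D * (a + b))" by (simp add: p(3))
        finally show ?thesis by (simp add: norm_mult)
      qed
      have rr: "r ^ (4 * D) = r ^ (2 * D) * r ^ (2 * D)" by (simp add: power_add [symmetric])
      have "Pair a -` ?s = {b \<in> {0..pi}. cmod (poly q (cis b)) < r ^ (2 * D) * r ^ (2 * D)}"
        using a by (auto simp: small_set_def fq rr)
      also have "emeasure lborel \<dots> \<le> ennreal (8 * real (2 * D) * r)"
        using dq j(1) big rj r by (intro emeasure_poly_sublevel_le) (auto simp: cq)
      finally show ?thesis using a False by (simp add: algebra_simps)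
    qed
  qed
  have "emeasure lborel ?s = emeasure (lborel \<Otimes>\<^sub>M lborel) ?s" by (simp add: lborel_prod)
  also have "\<dots> = (\<integral>\<^sup>+ a. emeasure lborel (Pair a -` ?s) \<partial>lborel)"
    using small_set_sets[OF f] by (intro lborel.emeasure_pair_measure_alt) (simp only: lborel_prod sets_lborel)
  also have "\<dots> \<le> (\<integral>\<^sup>+ a. ennreal 4 * indicator E a +
      ennreal (16 * real D * r) * indicator {0..pi} a \<partial>lborel)"
    by (intro nn_integral_mono slice)
  also have "\<dots> = ennreal 4 * emeasure lborel E + ennreal (16 * real D * r) * emeasure lborel {0..pi}"
    using Es by (subst nn_integral_add) (simp_all add: nn_integral_cmult_indicator)
  also have "\<dots> \<le> ennreal 4 * ennreal (16 * real D * r) + ennreal (16 * real D * r) * ennreal 4"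
  proof -
    have "emeasure lborel {0..pi} = ennreal pi" by simp
    also have "\<dots> \<le> ennreal 4" using pi_less_4 by (intro ennreal_leI) simp
    finally show ?thesis using E by (intro add_mono mult_left_mono) auto
  qed
  also have "\<dots> = ennreal (128 * real D * r)"
    using r by (simp add: ennreal_mult' [symmetric] ennreal_plus [symmetric] del: ennreal_plus ennreal_numeral)
  finally show ?thesis .
qed

text \<open>Borel-Cantelli applied to the exceptional sets. Functions that vanish identically are
  removed beforehand; they satisfy the first alternative everywhere.\<close>

lemma AE_trig_poly_lower_bound:
  fixes F :: "nat \<Rightarrow> (real \<Rightarrow> real \<Rightarrow> complex) set"
  assumes fin: "\<And>m. finite (F m)" and tp: "\<And>m f. f \<in> F m \<Longrightarrow> trig_poly (D m) f"
    and r: "\<And>m. 0 < r m" "\<And>m. r m \<le> 1"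
    and sum: "summable (\<lambda>m. real (card (F m)) * real (D m) * r m)"
  shows "AE x in (lborel :: (real \<times> real) measure). x \<in> {0..pi} \<times> {0..pi} \<longrightarrow>
    (\<forall>\<^sub>F m in sequentially. \<forall>f\<in>F m. f (fst x) (snd x) = 0 \<or>
      r m ^ (4 * D m) \<le> cmod (f (fst x) (snd x)))"
proof -
  define G where "G m = {f \<in> F m. \<exists>a b. f a b \<noteq> 0}" for m
  define A where "A m = (\<Union>f\<in>G m. small_set f (r m ^ (4 * D m)))" for m
  have As: "A m \<in> sets lborel" for m
    unfolding A_def G_def using fin tp by (intro sets.finite_UN) (auto intro: small_set_sets)
  have Ab: "emeasure lborel (A m) \<le> ennreal (128 * (real (card (F m)) * real (D m) * r m))" for m
  proof -
    have "emeasure lborel (A m) \<le> (\<Sum>f\<in>G m. emeasure lborel (small_set f (r m ^ (4 * D m))))"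
      unfolding A_def using fin tp
      by (intro emeasure_subadditive_finite) (auto simp: G_def intro: small_set_sets)
    also have "\<dots> \<le> (\<Sum>f\<in>G m. ennreal (128 * real (D m) * r m))"
      using tp r by (intro sum_mono) (auto simp: G_def intro!: emeasure_small_set_le)
    also have "\<dots> = ennreal (real (card (G m)) * (128 * real (D m) * r m))"
      using less_imp_le[OF r(1)] by (simp add: ennreal_of_nat_eq_real_of_nat ennreal_mult' [symmetric])
    also have "\<dots> \<le> ennreal (real (card (F m)) * (128 * real (D m) * r m))"
      using fin card_mono[of "F m" "G m"] less_imp_le[OF r(1)]
      by (intro ennreal_leI mult_right_mono) (auto simp: G_def)
    finally show ?thesis by (simp add: algebra_simps)
  qed
  have Af: "emeasure lborel (A m) < \<infinity>" for m
    using Ab[of m] by (rule le_less_trans) simp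
  have "summable (\<lambda>m. measure lborel (A m))"
  proof (rule summable_comparison_test'[OF summable_mult[OF sum, of 128]])
    fix m
    show "norm (measure lborel (A m)) \<le> 128 * (real (card (F m)) * real (D m) * r m)"
      using Ab[of m] less_imp_le[OF r(1)] by (simp add: measure_def enn2real_leI)
  qed
  from borel_cantelli_AE1[OF As Af this]
  have "AE x in lborel. \<forall>\<^sub>F m in sequentially. x \<notin> A m" by simp
  then show ?thesis
  proof (rule AE_mp, intro AE_I2 impI)
    fix x :: "real \<times> real"
    assume ev: "\<forall>\<^sub>F m in sequentially. x \<notin> A m" and x: "x \<in> {0..pi} \<times> {0..pi}"
    show "\<forall>\<^sub>F m in sequentially. \<forall>f\<in>F m. f (fst x) (snd x) = 0 \<or>
      r m ^ (4 * D m) \<le> cmod (f (fst x) (snd x))"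
      using ev
    proof eventually_elim
      case (elim m)
      then show ?case using x by (auto simp: A_def G_def small_set_def not_less)
    qed
  qed
qed

section \<open>Unfolded vertices as trigonometric polynomials of the angles\<close>

text \<open>
  The vertices of the normalized triangle multiplied by \<open>2 * \<i> * sin (a + b)\<close>, which turns their
  coordinates into trigonometric polynomials with integer coefficients.
\<close>

definition scaled_vert :: "nat \<Rightarrow> real \<Rightarrow> real \<Rightarrow> complex" where
  "scaled_vert k a b = (if k = 0 then 0 else if k = 1 then cis (a + b) - cis (- a - b)
     else cis (a + b) - cis (a - b))"

text \<open>The quotient \<open>d / cnj d\<close> for the side \<open>d\<close> joining the vertices \<open>i\<close> and \<open>j\<close>.\<close>

definition side_mult :: "nat \<Rightarrow> nat \<Rightarrow> real \<Rightarrow> real \<Rightarrow> complex" where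
  "side_mult i j a b = (if i + j = 1 then - 1 else if i + j = 2 then - cis (2 * a) else - cis (- 2 * b))"

text \<open>The first letter is peeled off: the remaining unfolding of the mirrored triangle is the
  mirror image of an unfolding of the base triangle with renamed vertices. So only the three sides
  of the base triangle serve as mirrors, and no direction quotient other than
  \<open>side_mult\<close> arises.\<close>

fun scaled_tip :: "nat \<Rightarrow> nat \<Rightarrow> nat \<Rightarrow> bool list \<Rightarrow> real \<Rightarrow> real \<Rightarrow> complex" where
  "scaled_tip r l t [] a b = scaled_vert t a b"
| "scaled_tip r l t (True # w) a b =
    scaled_vert t a b + side_mult t l a b * cnj (scaled_tip t l r w a b - scaled_vert t a b)"
| "scaled_tip r l t (False # w) a b =
    scaled_vert r a b + side_mult r t a b * cnj (scaled_tip r t l w a b - scaled_vert r a b)"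

lemma trig_poly_scaled_vert: "trig_poly 1 (scaled_vert k)"
proof -
  have "trig_poly 1 (\<lambda>a b. of_int 1 * cis (of_int 1 * a + of_int 1 * b))"
    "trig_poly 1 (\<lambda>a b. of_int 1 * cis (of_int (-1) * a + of_int (-1) * b))"
    "trig_poly 1 (\<lambda>a b. of_int 1 * cis (of_int 1 * a + of_int (-1) * b))"
    by (rule trig_poly_monom; simp)+
  then have "trig_poly 1 (\<lambda>a b. cis (a + b))" "trig_poly 1 (\<lambda>a b. cis (- a - b))"
    "trig_poly 1 (\<lambda>a b. cis (a - b))"
    by simp_all
  note h = this
  consider "k = 0" | "k = 1" | "k \<noteq> 0" "k \<noteq> 1" by blast
  then show ?thesis
  proof cases
    case 1
    then have "scaled_vert k = (\<lambda>a b. 0)" by (simp add: fun_eq_iff scaled_vert_def)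
    then show ?thesis using trig_poly_0 by simp
  next
    case 2
    then have "scaled_vert k = (\<lambda>a b. cis (a + b) - cis (- a - b))" by (simp add: fun_eq_iff scaled_vert_def)
    then show ?thesis using trig_poly_diff[OF h(1,2)] by simp
  next
    case 3
    then have "scaled_vert k = (\<lambda>a b. cis (a + b) - cis (a - b))" by (simp add: fun_eq_iff scaled_vert_def)
    then show ?thesis using trig_poly_diff[OF h(1,3)] by simp
  qed
qed

lemma trig_poly_side_mult: "trig_poly 2 (side_mult i j)"
proof -
  have "trig_poly 2 (\<lambda>a b. of_int (-1) * cis (of_int 0 * a + of_int 0 * b))"
    "trig_poly 2 (\<lambda>a b. of_int (-1) * cis (of_int 2 * a + of_int 0 * b))"
    "trig_poly 2 (\<lambda>a b. of_int (-1) * cis (of_int 0 * a + of_int (-2) * b))"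
    by (rule trig_poly_monom; simp)+
  then have h: "trig_poly 2 (\<lambda>a b. - 1)" "trig_poly 2 (\<lambda>a b. - cis (2 * a))"
    "trig_poly 2 (\<lambda>a b. - cis (- 2 * b))"
    by simp_all
  consider "i + j = 1" | "i + j = 2" | "i + j \<noteq> 1" "i + j \<noteq> 2" by blast
  then show ?thesis
  proof cases
    case 1
    then have "side_mult i j = (\<lambda>a b. - 1)" by (simp add: fun_eq_iff side_mult_def)
    then show ?thesis using h by simp
  next
    case 2
    then have "side_mult i j = (\<lambda>a b. - cis (2 * a))" by (simp add: fun_eq_iff side_mult_def)
    then show ?thesis using h by simp
  next
    case 3
    then have "side_mult i j = (\<lambda>a b. - cis (- 2 * b))" by (simp add: fun_eq_iff side_mult_def)
    then show ?thesis using h by simp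
  qed
qed

text \<open>Each letter costs one multiplication by \<open>side_mult\<close>, which adds 2 to the
  degree bound; conjugation adds nothing.\<close>

lemma trig_poly_scaled_tip: "trig_poly (2 * length w + 1) (scaled_tip r l t w)"
proof -
  have refl: "trig_poly (2 * n + 3) (\<lambda>a b. scaled_vert i a b + side_mult i j a b * cnj (f a b - scaled_vert i a b))"
    if "trig_poly (2 * n + 1) f" for n i j f
  proof -
    have t: "trig_poly (2 * n + 1) (scaled_vert i)" by (rule trig_poly_mono[OF trig_poly_scaled_vert]) simp
    have "trig_poly (2 * n + 1 + 2) (\<lambda>a b. side_mult i j a b * cnj (f a b - scaled_vert i a b))"
      by (rule trig_poly_mult[OF trig_poly_side_mult trig_poly_cnj[OF trig_poly_diff[OF that t]]])
    then have "trig_poly (2 * n + 3) (\<lambda>a b. side_mult i j a b * cnj (f a b - scaled_vert i a b))"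
      by (rule trig_poly_mono) simp
    then show ?thesis
      by (intro trig_poly_add trig_poly_mono[OF trig_poly_scaled_vert]) simp_all
  qed
  show ?thesis
  proof (induction w arbitrary: r l t)
    case Nil
    have "scaled_tip r l t [] = scaled_vert t" by (simp add: fun_eq_iff)
    then show ?case using trig_poly_scaled_vert by simp
  next
    case (Cons c w)
    have e: "2 * length (c # w) + 1 = 2 * length w + 3" by simp
    show ?case
    proof (cases c)
      case True
      then have eq: "scaled_tip r l t (c # w) = (\<lambda>a b. scaled_vert t a b + side_mult t l a b * cnj (scaled_tip t l r w a b - scaled_vert t a b))"
        by (simp add: fun_eq_iff)
      show ?thesis unfolding eq e by (rule refl[OF Cons.IH])
    next
      case False
      then have eq: "scaled_tip r l t (c # w) = (\<lambda>a b. scaled_vert r a b + side_mult r t a b * cnj (scaled_tip r t l w a b - scaled_vert r a b))"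
        by (simp add: fun_eq_iff)
      show ?thesis unfolding eq e by (rule refl[OF Cons.IH])
    qed
  qed
qed

definition labelling :: "nat \<Rightarrow> nat \<Rightarrow> nat \<Rightarrow> bool" where
  "labelling r l t \<longleftrightarrow> distinct [r, l, t] \<and> {r, l, t} \<subseteq> {..<3}"

lemma scaled_vert_diff:
  "scaled_vert 1 a b - scaled_vert 0 a b = of_real (2 * sin (a + b)) * \<i> * cis 0"
  "scaled_vert 2 a b - scaled_vert 0 a b = of_real (2 * sin b) * \<i> * cis a"
  "scaled_vert 2 a b - scaled_vert 1 a b = of_real (- 2 * sin a) * \<i> * cis (- b)"
  by (simp_all add: scaled_vert_def complex_eq_iff sin_add cos_add sin_diff cos_diff algebra_simps)

lemma triangle_angles_sin:
  assumes "(a, b) \<in> triangle_angles"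
  shows "sin (a + b) > 0" "sin a > 0" "sin b > 0"
  using assms by (auto simp: triangle_angles_def intro!: sin_gt_zero)

lemma div_cnj_imag_cis:
  assumes "s \<noteq> 0"
  shows "(of_real s * \<i> * cis \<theta>) / cnj (of_real s * \<i> * cis \<theta>) = - cis (2 * \<theta>)"
proof -
  have "cis (2 * \<theta>) * cis (- \<theta>) = cis \<theta>" by (simp add: cis_mult)
  moreover have "cis (- \<theta>) \<noteq> 0" by simp
  ultimately show ?thesis using assms by (simp add: cis_cnj field_simps)
qed

lemma labels_cases:
  assumes "i < 3" "j < 3" "i \<noteq> (j :: nat)"
  shows "(i, j) \<in> {(0, 1), (1, 0), (0, 2), (2, 0), (1, 2), (2, 1)}"
proof -
  have "i = 0 \<or> i = 1 \<or> i = 2" "j = 0 \<or> j = 1 \<or> j = 2" using assms by linarith+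
  then show ?thesis using assms(3) by auto
qed

lemma refl_line_scaled_vert:
  assumes "(a, b) \<in> triangle_angles" "i < 3" "j < 3" "i \<noteq> j"
  shows "scaled_vert i a b \<noteq> scaled_vert j a b"
    "refl_line (scaled_vert i a b) (scaled_vert j a b) p = scaled_vert i a b + side_mult i j a b * cnj (p - scaled_vert i a b)"
proof -
  note s = triangle_angles_sin[OF assms(1)]
  have flip: "(scaled_vert i a b - scaled_vert j a b) / cnj (scaled_vert i a b - scaled_vert j a b) =
     (scaled_vert j a b - scaled_vert i a b) / cnj (scaled_vert j a b - scaled_vert i a b)" for i j
    by (metis complex_cnj_minus minus_diff_eq minus_divide_divide)
  have d: "(scaled_vert 1 a b - scaled_vert 0 a b) / cnj (scaled_vert 1 a b - scaled_vert 0 a b) = - 1"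
    "(scaled_vert 2 a b - scaled_vert 0 a b) / cnj (scaled_vert 2 a b - scaled_vert 0 a b) = - cis (2 * a)"
    "(scaled_vert 2 a b - scaled_vert 1 a b) / cnj (scaled_vert 2 a b - scaled_vert 1 a b) = - cis (- 2 * b)"
    unfolding scaled_vert_diff using s by (subst div_cnj_imag_cis; simp)+
  have n: "scaled_vert 1 a b - scaled_vert 0 a b \<noteq> 0" "scaled_vert 2 a b - scaled_vert 0 a b \<noteq> 0"
    "scaled_vert 2 a b - scaled_vert 1 a b \<noteq> 0"
    unfolding scaled_vert_diff using s by simp_all
  have "(scaled_vert j a b - scaled_vert i a b) / cnj (scaled_vert j a b - scaled_vert i a b) = side_mult i j a b"
    using labels_cases[OF assms(2-4)] d
    by (auto simp: side_mult_def flip[of 0 1] flip[of 0 2] flip[of 1 2] simp del: complex_cnj_diff One_nat_def)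
  then show "refl_line (scaled_vert i a b) (scaled_vert j a b) p =
      scaled_vert i a b + side_mult i j a b * cnj (p - scaled_vert i a b)"
    by (simp add: refl_line_def reflect_dir_def del: complex_cnj_diff)
  show "scaled_vert i a b \<noteq> scaled_vert j a b"
    using labels_cases[OF assms(2-4)] n by auto
qed

abbreviation base_tri :: "nat \<Rightarrow> nat \<Rightarrow> nat \<Rightarrow> real \<Rightarrow> real \<Rightarrow> tri" where
  "base_tri r l t a b \<equiv> (scaled_vert r a b, scaled_vert l a b, scaled_vert t a b)"

lemma refl_line_ends:
  assumes "a \<noteq> b"
  shows "refl_line a b a = a" "refl_line a b b = b"
  using assms by (simp_all add: refl_line_def reflect_dir_def del: complex_cnj_diff)

lemma step_base_tri:
  assumes "(a, b) \<in> triangle_angles" "labelling r l t"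
  shows "step True (base_tri r l t a b) =
      map_tri (refl_line (scaled_vert t a b) (scaled_vert l a b)) (base_tri t l r a b)"
    "step False (base_tri r l t a b) =
      map_tri (refl_line (scaled_vert r a b) (scaled_vert t a b)) (base_tri r t l a b)"
    "labelling t l r" "labelling r t l"
    "similarity 1 (refl_line (scaled_vert t a b) (scaled_vert l a b))"
    "similarity 1 (refl_line (scaled_vert r a b) (scaled_vert t a b))"
proof -
  have d: "scaled_vert t a b \<noteq> scaled_vert l a b" "scaled_vert r a b \<noteq> scaled_vert t a b"
    by (rule refl_line_scaled_vert(1)[OF assms(1)]; use assms(2) in \<open>simp add: labelling_def\<close>)+
  show "step True (base_tri r l t a b) =
      map_tri (refl_line (scaled_vert t a b) (scaled_vert l a b)) (base_tri t l r a b)"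
    "step False (base_tri r l t a b) =
      map_tri (refl_line (scaled_vert r a b) (scaled_vert t a b)) (base_tri r t l a b)"
    using refl_line_ends[OF d(1)] refl_line_ends[OF d(2)] by simp_all
  show "labelling t l r" "labelling r t l" using assms(2) by (auto simp: labelling_def)
  show "similarity 1 (refl_line (scaled_vert t a b) (scaled_vert l a b))"
    "similarity 1 (refl_line (scaled_vert r a b) (scaled_vert t a b))"
    using d by (auto intro: similarity_refl_line)
qed

lemma tip_map_tri [simp]: "tip (map_tri g S) = g (tip S)"
  by (cases S) simp

lemma side_end_map_tri [simp]: "side_end a (map_tri g S) = g (side_end a S)"
  by (cases S) simp

lemma tip_run_base_tri:
  assumes "(a, b) \<in> triangle_angles" "labelling r l t"
  shows "tip (run w (base_tri r l t a b)) = scaled_tip r l t w a b"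
  using assms(2)
proof (induction w arbitrary: r l t)
  case Nil then show ?case by simp
next
  case (Cons c w)
  note st = step_base_tri[OF assms(1) Cons.prems]
  have lt: "r < 3" "l < 3" "t < 3" "r \<noteq> l" "l \<noteq> t" "r \<noteq> t"
    using Cons.prems by (auto simp: labelling_def)
  show ?case
  proof (cases c)
    case True
    then show ?thesis
      using run_map_tri[OF st(5), of w "base_tri t l r a b"] Cons.IH[OF st(3)] st(1)
        refl_line_scaled_vert(2)[OF assms(1) lt(3,2)] lt
      by (simp del: map_tri.simps step.simps)
  next
    case False
    then show ?thesis
      using run_map_tri[OF st(6), of w "base_tri r t l a b"] Cons.IH[OF st(4)] st(2)
        refl_line_scaled_vert(2)[OF assms(1) lt(1,3)] lt
      by (simp del: map_tri.simps step.simps)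
  qed
qed

text \<open>Every unfolded triangle is a copy of the base triangle at the scale of the first one.
  This allows a piece of an unfolding to be moved back to the base triangle.\<close>

lemma run_labelled:
  assumes "(a, b) \<in> triangle_angles" "labelling r l t" "similarity \<rho> g" "\<rho> > 0"
  shows "\<exists>g' r' l' t'. similarity \<rho> g' \<and> labelling r' l' t' \<and>
    run w (map_tri g (base_tri r l t a b)) = map_tri g' (base_tri r' l' t' a b)"
  using assms(2,3)
proof (induction w arbitrary: r l t g)
  case Nil then show ?case by auto
next
  case (Cons c w)
  note st = step_base_tri[OF assms(1) Cons.prems(1)]
  have e: "step c (map_tri g S) = map_tri g (step c S)" for S
    using run_map_tri[OF Cons.prems(2) assms(4), of "[c]" S] by simp
  have mm: "map_tri g (map_tri h S) = map_tri (\<lambda>p. g (h p)) S" for h S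
    by (cases S) simp
  show ?case
  proof (cases c)
    case True
    then have "step c (map_tri g (base_tri r l t a b)) =
        map_tri (\<lambda>p. g (refl_line (scaled_vert t a b) (scaled_vert l a b) p)) (base_tri t l r a b)"
      unfolding e using st(1) mm by metis
    then show ?thesis
      using Cons.IH[OF st(3), of "\<lambda>p. g (refl_line (scaled_vert t a b) (scaled_vert l a b) p)"]
        similarity_comp[OF Cons.prems(2) st(5)]
      by (simp del: map_tri.simps step.simps)
  next
    case False
    then have "step c (map_tri g (base_tri r l t a b)) =
        map_tri (\<lambda>p. g (refl_line (scaled_vert r a b) (scaled_vert t a b) p)) (base_tri r t l a b)"
      unfolding e using st(2) mm by metis
    then show ?thesis
      using Cons.IH[OF st(4), of "\<lambda>p. g (refl_line (scaled_vert r a b) (scaled_vert t a b) p)"]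
        similarity_comp[OF Cons.prems(2) st(6)]
      by (simp del: map_tri.simps step.simps)
  qed
qed

section \<open>Lower bounds for cross products in almost every triangle\<close>

definition nondegenerate :: "nat \<Rightarrow> real \<Rightarrow> real \<Rightarrow> real \<Rightarrow> bool" where
  "nondegenerate m \<theta> a b \<longleftrightarrow> (\<forall>k<3. \<forall>r<3. \<forall>l<3. \<forall>t<3. \<forall>u v. length u \<le> m \<longrightarrow> length v \<le> m \<longrightarrow>
     (let d = cross (scaled_tip r l t u a b - scaled_vert k a b) (scaled_tip r l t v a b - scaled_vert k a b)
      in d = 0 \<or> \<theta> \<le> \<bar>d\<bar>))"

text \<open>There are at most \<open>324 * 4 ^ m\<close> functions with degree bound
  \<open>4 * m + 2\<close>, so the radius \<open>(1 / 8) ^ m\<close> leaves a series dominated by a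
  constant times \<open>m / 2 ^ m\<close>. The exponent \<open>m * (16 * m + 8)\<close> is
  \<open>m\<close> times \<open>4 * (4 * m + 2)\<close>.\<close>

lemma AE_nondegenerate:
  "AE x in (lborel :: (real \<times> real) measure). x \<in> triangle_angles \<longrightarrow>
    (\<forall>\<^sub>F m in sequentially. nondegenerate m ((1 / 8) ^ (m * (16 * m + 8)) / 2) (fst x) (snd x))"
proof -
  define W :: "nat \<Rightarrow> bool list set" where "W m = {w. set w \<subseteq> UNIV \<and> length w \<le> m}" for m
  \<comment> \<open>This is \<open>2 * \<i>\<close> times the cross product, which keeps the
    coefficients integral and causes the final division by 2.\<close>
  define G where "G = (\<lambda>(k, r, l, t, u, v) a b.
      cnj (scaled_tip r l t u a b - scaled_vert k a b) * (scaled_tip r l t v a b - scaled_vert k a b) -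
      (scaled_tip r l t u a b - scaled_vert k a b) * cnj (scaled_tip r l t v a b - scaled_vert k a b))"
  define P where "P m = {..<3::nat} \<times> {..<3::nat} \<times> {..<3::nat} \<times> {..<3::nat} \<times> W m \<times> W m" for m
  have finW: "finite (W m)" for m unfolding W_def by (rule finite_lists_length_le) simp
  have cardW: "card (W m) \<le> 2 ^ (m + 1)" for m
  proof -
    have "(\<Sum>i\<le>m. 2 ^ i) \<le> (2 :: nat) ^ (m + 1)" by (induction m) auto
    then show ?thesis unfolding W_def using card_lists_length_le[of "UNIV :: bool set" m] by simp
  qed
  have G_eq: "cmod (G (k, r, l, t, u, v) a b) =
      2 * \<bar>cross (scaled_tip r l t u a b - scaled_vert k a b) (scaled_tip r l t v a b - scaled_vert k a b)\<bar>"
    for k r l t u v a b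
  proof -
    have "cnj p * q - p * cnj q = of_real (2 * cross p q) * \<i>" for p q
      by (simp add: complex_eq_iff cross_def algebra_simps)
    then show ?thesis by (simp add: G_def norm_mult abs_mult del: complex_cnj_diff)
  qed
  have fin: "finite (G ` P m)" for m using finW by (simp add: P_def)
  have tp: "trig_poly (4 * m + 2) f" if "f \<in> G ` P m" for m f
  proof -
    from that obtain z where z: "f = G z" "z \<in> P m" by blast
    obtain k r l t u v where "z = (k, r, l, t, u, v)" by (metis prod_cases6)
    then have f: "f = G (k, r, l, t, u, v)" and uv: "length u \<le> m" "length v \<le> m"
      using z by (simp_all add: P_def W_def)
    have h: "trig_poly (2 * m + 1) (\<lambda>a b. scaled_tip r l t w a b - scaled_vert k a b)" if "length w \<le> m" for w
      using that by (intro trig_poly_diff trig_poly_mono[OF trig_poly_scaled_tip]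
          trig_poly_mono[OF trig_poly_scaled_vert]) auto
    have "trig_poly (2 * m + 1 + (2 * m + 1)) f"
      unfolding f G_def case_prod_conv
      by (intro trig_poly_diff trig_poly_mult trig_poly_cnj h uv)
    then show ?thesis by (simp add: algebra_simps)
  qed
  have "summable (\<lambda>m. real (card (G ` P m)) * real (4 * m + 2) * (1 / 8) ^ m)"
  proof (rule summable_comparison_test'[where N = 0])
    show "summable (\<lambda>m. 324 * (real (4 * m + 2) * (1 / 2) ^ m) :: real)"
    proof (rule summable_mult, rule summable_ratio_test[of "3 / 4" 2])
      fix n :: nat assume "2 \<le> n"
      then have "real (4 * Suc n + 2) * (1 / 2) \<le> 3 / 4 * real (4 * n + 2)" by simp
      then have "real (4 * Suc n + 2) * (1 / 2) * (1 / 2) ^ n \<le> 3 / 4 * real (4 * n + 2) * (1 / 2) ^ n"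
        by (rule mult_right_mono) simp
      then show "norm (real (4 * Suc n + 2) * (1 / 2) ^ Suc n) \<le>
          3 / 4 * norm (real (4 * n + 2) * (1 / 2) ^ n)"
        by (simp add: abs_mult)
    qed simp
    fix m :: nat
    have "card (G ` P m) \<le> card (P m)" using finW by (intro card_image_le) (simp add: P_def)
    also have "\<dots> = 81 * (card (W m) * card (W m))" by (simp add: P_def card_cartesian_product)
    also have "\<dots> \<le> 81 * (2 ^ (m + 1) * 2 ^ (m + 1))"
      using cardW by (intro mult_left_mono mult_mono) auto
    also have "\<dots> = 324 * 4 ^ m"
    proof -
      have "(4 :: nat) ^ m = 2 ^ m * 2 ^ m"
        using power_mult_distrib[of "2 :: nat" 2 m] by simp
      then show ?thesis by simp
    qed
    finally have "real (card (G ` P m)) \<le> 324 * 4 ^ m"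
      using of_nat_le_iff[of "card (G ` P m)" "324 * 4 ^ m", where ?'a = real] by simp
    then have "real (card (G ` P m)) * real (4 * m + 2) * (1 / 8) ^ m \<le>
        324 * 4 ^ m * real (4 * m + 2) * (1 / 8) ^ m"
      by (intro mult_right_mono) auto
    also have "\<dots> = 324 * (real (4 * m + 2) * (4 * (1 / 8)) ^ m)"
      unfolding power_mult_distrib by (simp only: ac_simps)
    finally show "norm (real (card (G ` P m)) * real (4 * m + 2) * (1 / 8) ^ m) \<le>
        324 * (real (4 * m + 2) * (1 / 2) ^ m)"
      by simp
  qed
  from AE_trig_poly_lower_bound[where r = "\<lambda>m. (1 / 8) ^ m", OF fin tp _ _ this]
  have "AE x in (lborel :: (real \<times> real) measure). x \<in> {0..pi} \<times> {0..pi} \<longrightarrow>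
    (\<forall>\<^sub>F m in sequentially. \<forall>f\<in>G ` P m. f (fst x) (snd x) = 0 \<or>
      ((1 / 8) ^ m) ^ (4 * (4 * m + 2)) \<le> cmod (f (fst x) (snd x)))"
    by (simp add: power_le_one)
  then show ?thesis
  proof (rule AE_mp, intro AE_I2 impI)
    fix x :: "real \<times> real"
    assume h: "x \<in> {0..pi} \<times> {0..pi} \<longrightarrow>
    (\<forall>\<^sub>F m in sequentially. \<forall>f\<in>G ` P m. f (fst x) (snd x) = 0 \<or>
      ((1 / 8) ^ m) ^ (4 * (4 * m + 2)) \<le> cmod (f (fst x) (snd x)))"
      and x: "x \<in> triangle_angles"
    have "x \<in> {0..pi} \<times> {0..pi}" using x by (auto simp: triangle_angles_def)
    with h have "\<forall>\<^sub>F m in sequentially. \<forall>f\<in>G ` P m. f (fst x) (snd x) = 0 \<or>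
      ((1 / 8) ^ m) ^ (4 * (4 * m + 2)) \<le> cmod (f (fst x) (snd x))" by blast
    then show "\<forall>\<^sub>F m in sequentially.
        nondegenerate m ((1 / 8) ^ (m * (16 * m + 8)) / 2) (fst x) (snd x)"
    proof eventually_elim
      case (elim m)
      show ?case
        unfolding nondegenerate_def Let_def
      proof (intro allI impI)
        fix k r l t :: nat and u v :: "bool list"
        assume "k < 3" "r < 3" "l < 3" "t < 3" "length u \<le> m" "length v \<le> m"
        then have "(k, r, l, t, u, v) \<in> P m" by (simp add: P_def W_def)
        then have "G (k, r, l, t, u, v) (fst x) (snd x) = 0 \<or>
            ((1 / 8) ^ m) ^ (4 * (4 * m + 2)) \<le> cmod (G (k, r, l, t, u, v) (fst x) (snd x))"
          using elim by blast
        moreover have "((1 / 8 :: real) ^ m) ^ (4 * (4 * m + 2)) = (1 / 8) ^ (m * (16 * m + 8))"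
          by (simp only: power_mult [symmetric]) (simp add: algebra_simps)
        ultimately have "cmod (G (k, r, l, t, u, v) (fst x) (snd x)) = 0 \<or>
            (1 / 8) ^ (m * (16 * m + 8)) \<le> cmod (G (k, r, l, t, u, v) (fst x) (snd x))"
          by auto
        then show "cross (scaled_tip r l t u (fst x) (snd x) - scaled_vert k (fst x) (snd x))
          (scaled_tip r l t v (fst x) (snd x) - scaled_vert k (fst x) (snd x)) = 0 \<or>
         (1 / 8) ^ (m * (16 * m + 8)) / 2 \<le>
         \<bar>cross (scaled_tip r l t u (fst x) (snd x) - scaled_vert k (fst x) (snd x))
           (scaled_tip r l t v (fst x) (snd x) - scaled_vert k (fst x) (snd x))\<bar>"
          unfolding G_eq by (simp add: field_simps)
      qed
    qed
  qed
qed

text \<open>In a short zigzag, undoing the similarity of the triangle entered after \<open>x\<close>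
  makes \<open>A\<close> a base vertex and \<open>B\<close>, \<open>C\<close> tips of words of
  length at most \<open>m\<close>. Then \<open>nondegenerate\<close> bounds the nonzero cross
  product from below. But it is a signed sum of three cross products of hit vertices, each less than
  a third of that bound by \<open>thin\<close>.\<close>

lemma zigzag_gap_hits:
  assumes ab: "(a, b) \<in> triangle_angles" and lab: "labelling r l t"
    and g: "similarity \<rho> g" "\<rho> > 0"
    and S: "S = map_tri g (base_tri r l t a b)" "pos_oriented S" and I: "cone_closed I"
    and nd: "nondegenerate m \<theta> a b"
    and thin: "\<And>u v. u \<in> hits S I n \<Longrightarrow> v \<in> hits S I n \<Longrightarrow>
      3 * \<bar>cross (tip (run u S)) (tip (run v S))\<bar> < \<rho>\<^sup>2 * \<theta>"
  shows "zigzag_gap m (hits S I n)"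
  unfolding zigzag_gap_def
proof (intro allI impI, rule ccontr)
  fix x c p q
  let ?v = "p @ (\<not> c) # q"
  assume x: "x \<in> hits S I n" and w: "x @ c # p \<in> hits S I n" "x @ c # ?v \<in> hits S I n"
    and none: "\<forall>u\<in>hits S I n. strict_prefix x u \<longrightarrow> strict_prefix u (x @ c # ?v) \<longrightarrow> u = x @ c # p"
    and short: "\<not> m \<le> length p + length q + 1"
  define A B C where "A = tip (run x S)" and "B = tip (run (x @ c # p) S)"
    and "C = tip (run (x @ c # ?v) S)"
  have nz: "cross (B - A) (C - A) \<noteq> 0"
    using zigzag_not_collinear[OF S(2) I x w] none unfolding A_def B_def C_def by blast
  obtain g' r' l' t' where g': "similarity \<rho> g'" and lab': "labelling r' l' t'"
    and run: "run (x @ [c]) S = map_tri g' (base_tri r' l' t' a b)"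
    using run_labelled[OF ab lab g] S(1) by blast
  have tips: "tip (run (x @ c # y) S) = g' (scaled_tip r' l' t' y a b)" for y
  proof -
    have "run (x @ c # y) S = run y (run (x @ [c]) S)" by simp
    then show ?thesis
      using run run_map_tri[OF g' g(2), of y "base_tri r' l' t' a b"] tip_run_base_tri[OF ab lab']
      by simp
  qed
  define k where "k = (if c then r' else l')"
  have "A = side_end c (run (x @ [c]) S)" by (simp add: A_def)
  also have "\<dots> = g' (scaled_vert k a b)" unfolding run k_def by simp
  finally have A: "A = g' (scaled_vert k a b)" .
  have e: "\<bar>cross (B - A) (C - A)\<bar> = \<rho>\<^sup>2 *
      \<bar>cross (scaled_tip r' l' t' p a b - scaled_vert k a b) (scaled_tip r' l' t' ?v a b - scaled_vert k a b)\<bar>"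
    unfolding A B_def C_def tips by (rule cross_similarity[OF g'])
  have lt: "k < 3" "r' < 3" "l' < 3" "t' < 3" using lab' by (auto simp: labelling_def k_def)
  have "cross (scaled_tip r' l' t' p a b - scaled_vert k a b) (scaled_tip r' l' t' ?v a b - scaled_vert k a b) \<noteq> 0"
    using e nz by auto
  moreover have "length p \<le> m" "length ?v \<le> m" using short by auto
  ultimately have "\<theta> \<le> \<bar>cross (scaled_tip r' l' t' p a b - scaled_vert k a b) (scaled_tip r' l' t' ?v a b - scaled_vert k a b)\<bar>"
    using nd lt unfolding nondegenerate_def Let_def by blast
  then have "\<rho>\<^sup>2 * \<theta> \<le> \<bar>cross (B - A) (C - A)\<bar>" unfolding e by (intro mult_left_mono) auto
  moreover have "cross (B - A) (C - A) = cross B C - cross B A - cross A C"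
    by (simp add: cross_def algebra_simps)
  moreover have "3 * \<bar>cross B C\<bar> < \<rho>\<^sup>2 * \<theta>" "3 * \<bar>cross B A\<bar> < \<rho>\<^sup>2 * \<theta>" "3 * \<bar>cross A C\<bar> < \<rho>\<^sup>2 * \<theta>"
    using thin x w unfolding A_def B_def C_def by blast+
  ultimately show False by linarith
qed

section \<open>Coding generalized diagonals by words\<close>

lemma refl_line_add:
  assumes "cross (b - a) (p - a) = 0" "a \<noteq> b"
  shows "refl_line a b q = p + reflect_dir (b - a) (q - p)"
proof -
  have c: "cnj (b - a) \<noteq> 0" using assms(2) by simp
  have "cnj (b - a) * (p - a) = (b - a) * cnj (p - a)"
    using assms(1) by (simp add: complex_eq_iff cross_def algebra_simps)
  then have "p - a = (b - a) / cnj (b - a) * cnj (p - a)"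
    using c by (simp add: field_simps del: complex_cnj_diff)
  then have "p = a + (b - a) / cnj (b - a) * cnj (p - a)" by (simp add: algebra_simps)
  then have "p + reflect_dir (b - a) (q - p) =
      a + ((b - a) / cnj (b - a) * cnj (p - a) + (b - a) / cnj (b - a) * cnj (q - p))"
    by (simp add: reflect_dir_def add.assoc)
  also have "\<dots> = a + (b - a) / cnj (b - a) * cnj (q - a)"
    unfolding distrib_left [symmetric] complex_cnj_add [symmetric] by simp
  finally show ?thesis by (simp add: refl_line_def reflect_dir_def)
qed

lemma reflect_dir_involution:
  assumes "d \<noteq> 0"
  shows "reflect_dir d (of_real t * reflect_dir d v) = of_real t * v"
    "reflect_dir (- d) v = reflect_dir d v"
  using assms by (simp_all add: reflect_dir_def)

lemma similarity_affine:
  assumes "similarity \<rho> g"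
  shows "g (p + of_real t * (q - p)) = g p + of_real t * (g q - g p)"
proof -
  obtain u s where "g = (\<lambda>p. u * p + s) \<or> g = (\<lambda>p. u * cnj p + s)"
    using assms unfolding similarity_def by auto
  then show ?thesis by (auto simp: algebra_simps)
qed

lemma cross_scale_self: "cross d (of_real t * d) = 0"
  by (simp add: cross_def algebra_simps)

lemma follows_scale:
  assumes "follows d w S" "x > 0"
  shows "follows (of_real x * d) w S"
proof -
  have "cross (of_real x * d) p = x * cross d p" "cross p (of_real x * d) = x * cross p d" for p
    by (simp_all add: cross_def algebra_simps)
  then have "crosses (of_real x * d) T" if "crosses d T" for T
    using that assms(2) by (cases T) (simp add: crosses_simps)
  then show ?thesis using assms(1) unfolding follows_def by blast
qed

fun label_step :: "bool \<Rightarrow> nat \<times> nat \<times> nat \<Rightarrow> nat \<times> nat \<times> nat" where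
  "label_step a (r, l, t) = (if a then (t, l, r) else (r, t, l))"

section \<open>The normalized triangle and its chords\<close>

locale triangle =
  fixes a b :: real
  assumes angles: "(a, b) \<in> triangle_angles"
begin

definition vert :: "nat \<Rightarrow> complex" where
  "vert k = scaled_vert k a b / (of_real (2 * sin (a + b)) * \<i>)"

lemma vert_simps: "vert 0 = 0" "vert 1 = 1" "vert 2 = tri_apex a b"
proof -
  have s: "sin (a + b) \<noteq> 0" using triangle_angles_sin[OF angles] by simp
  show "vert 0 = 0" by (simp add: vert_def scaled_vert_def)
  have "scaled_vert 1 a b = of_real (2 * sin (a + b)) * \<i>"
    using scaled_vert_diff(1)[of a b] by (simp add: scaled_vert_def)
  then show "vert 1 = 1" using s by (simp add: vert_def)
  have "scaled_vert 2 a b = of_real (2 * sin b) * \<i> * cis a"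
    using scaled_vert_diff(2)[of a b] by (simp add: scaled_vert_def)
  then show "vert 2 = tri_apex a b" using s by (simp add: vert_def tri_apex_def)
qed

lemma tri_vertices_eq: "tri_vertices a b = vert ` {..<3}"
proof -
  have "{..<3 :: nat} = {0, 1, 2}" unfolding set_eq_iff by (simp, arith)
  then show ?thesis by (simp add: tri_vertices_def vert_simps del: One_nat_def)
qed

lemma tri_sidesE:
  assumes "(x, y) \<in> tri_sides a b"
  obtains i j k where "labelling i j k" "x = vert i" "y = vert j"
proof -
  have "(x, y) = (vert 0, vert 1) \<or> (x, y) = (vert 1, vert 2) \<or> (x, y) = (vert 2, vert 0)"
    using assms by (auto simp: tri_sides_def vert_simps simp del: One_nat_def)
  then show thesis
    using that[of 0 1 2] that[of 1 2 0] that[of 2 0 1] by (auto simp: labelling_def simp del: One_nat_def)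
qed

lemma cross_vert_pos:
  assumes "s < 3"
  shows "cross (vert ((s + 1) mod 3) - vert s) (vert ((s + 2) mod 3) - vert s) > 0"
proof -
  have "cross (vert 1 - vert 0) (vert 2 - vert 0) > 0"
    using triangle_angles_sin[OF angles]
    by (simp add: vert_simps cross_def tri_apex_def del: One_nat_def)
  moreover have "s = 0 \<or> s = 1 \<or> s = 2" using assms by linarith
  ultimately show ?thesis by (elim disjE) (simp_all add: cross_def algebra_simps flip: numeral_2_eq_2)
qed

lemma cross_vert_nonzero:
  assumes "labelling i j k"
  shows "cross (vert j - vert i) (vert k - vert i) \<noteq> 0"
proof -
  have "i < 3" and "(j = (i + 1) mod 3 \<and> k = (i + 2) mod 3) \<or> (k = (i + 1) mod 3 \<and> j = (i + 2) mod 3)"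
  proof -
    have "i < 3" "j < 3" "k < 3" "i \<noteq> j" "j \<noteq> k" "i \<noteq> k" using assms by (auto simp: labelling_def)
    then have "i = 0 \<or> i = 1 \<or> i = 2" "j = 0 \<or> j = 1 \<or> j = 2" "k = 0 \<or> k = 1 \<or> k = 2"
      by linarith+
    then show "(j = (i + 1) mod 3 \<and> k = (i + 2) mod 3) \<or> (k = (i + 1) mod 3 \<and> j = (i + 2) mod 3)"
      using \<open>i \<noteq> j\<close> \<open>j \<noteq> k\<close> \<open>i \<noteq> k\<close> by auto
    show "i < 3" by fact
  qed
  then show ?thesis
    using cross_vert_pos[of i] by (auto simp: cross_def algebra_simps)
qed

lemma vert_neq:
  assumes "labelling i j k"
  shows "vert i \<noteq> vert j" "vert i \<noteq> vert k" "vert j \<noteq> vert k"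
  using cross_vert_nonzero[OF assms] by (auto simp: cross_def)

lemma labelling_swap:
  assumes "labelling i j k"
  shows "labelling j i k" "labelling k j i" "labelling i k j" "labelling j k i" "labelling k i j"
  using assms by (auto simp: labelling_def)

lemma labelling_total:
  assumes "labelling i j k" "m < 3"
  shows "m = i \<or> m = j \<or> m = k"
  using assms by (auto simp: labelling_def)

text \<open>The triangle lies in the closed half-plane of a side that contains the opposite vertex,
  so its interior lies in the open one. The factor \<open>c\<close> in the normal makes the argument
  independent of orientation.\<close>

lemma interior_off_side:
  assumes lab: "labelling i j k" and q: "q \<in> interior (tri_region a b)"
  shows "cross (vert j - vert i) (q - vert i) \<noteq> 0"
proof -
  define c where "c = cross (vert j - vert i) (vert k - vert i)"
  have c: "c \<noteq> 0" unfolding c_def by (rule cross_vert_nonzero[OF lab])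
  define n where "n = of_real c * \<i> * (vert j - vert i)"
  have n: "n \<noteq> 0" using c vert_neq(1)[OF lab] by (simp add: n_def)
  have inner: "n \<bullet> p = c * cross (vert j - vert i) p" for p
    by (simp add: n_def inner_complex_def cross_def algebra_simps)
  have ge: "n \<bullet> p \<ge> n \<bullet> vert i \<longleftrightarrow> c * cross (vert j - vert i) (p - vert i) \<ge> 0" for p
    unfolding inner by (simp add: cross_def algebra_simps)
  have "tri_vertices a b \<subseteq> {p. n \<bullet> p \<ge> n \<bullet> vert i}"
  proof
    fix p assume "p \<in> tri_vertices a b"
    then obtain m where "m < 3" "p = vert m" by (auto simp: tri_vertices_eq)
    then have "p = vert i \<or> p = vert j \<or> p = vert k" using labelling_total[OF lab] by blast
    then show "p \<in> {p. n \<bullet> p \<ge> n \<bullet> vert i}"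
      unfolding mem_Collect_eq ge by (auto simp: c_def) (simp_all add: cross_def)
  qed
  then have "tri_region a b \<subseteq> {p. n \<bullet> p \<ge> n \<bullet> vert i}"
    unfolding tri_region_def by (intro hull_minimal convex_halfspace_ge)
  then have "q \<in> interior {p. n \<bullet> p \<ge> n \<bullet> vert i}" using q interior_mono by blast
  then have "n \<bullet> q > n \<bullet> vert i" using interior_halfspace_ge[OF n] by auto
  moreover have "n \<bullet> q - n \<bullet> vert i = c * cross (vert j - vert i) (q - vert i)"
    unfolding inner by (simp add: cross_def algebra_simps)
  ultimately show ?thesis by auto
qed

lemma chord_off_side:
  assumes lab: "labelling i j k" and pq: "p \<noteq> q" "open_segment p q \<subseteq> interior (tri_region a b)"
    and p: "cross (vert j - vert i) (p - vert i) = 0"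
  shows "cross (vert j - vert i) (q - vert i) \<noteq> 0"
proof
  assume q: "cross (vert j - vert i) (q - vert i) = 0"
  have "midpoint p q \<in> interior (tri_region a b)" using pq by auto
  moreover have "cross e (midpoint p q - x) = (cross e (p - x) + cross e (q - x)) / 2" for e x
    by (simp add: midpoint_def cross_def scaleR_conv_of_real field_simps)
  ultimately show False using interior_off_side[OF lab, of "midpoint p q"] p q by (metis add_0 div_0)
qed

text \<open>Vertex \<open>s\<close> is moved to the origin, and the reflection in the opposite side
  has already been carried out. So a word of length \<open>k\<close> describes an orbit with
  \<open>k + 1\<close> reflections.\<close>

definition start :: "nat \<Rightarrow> tri" where
  "start s = (let r = vert ((s + 1) mod 3); l = vert ((s + 2) mod 3); t = vert s
     in (r - t, l - t, refl_line r l t - t))"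

definition labels :: "nat \<Rightarrow> bool list \<Rightarrow> nat \<times> nat \<times> nat" where
  "labels s w = fold label_step w ((s + 1) mod 3, (s + 2) mod 3, s)"

text \<open>The fraction is the parameter at which the ray in direction \<open>d\<close> meets the
  unfolded side; the same parameter on the original side gives the reflection point.\<close>

definition side_point :: "complex \<Rightarrow> nat \<Rightarrow> bool list \<Rightarrow> complex" where
  "side_point d s w = (case (labels s w, run w (start s)) of ((i, j, k), (r, l, t)) \<Rightarrow>
     vert i + of_real (cross d r / (cross d r - cross d l)) * (vert j - vert i))"

text \<open>The direction of the ray is recovered from the word as its tip, so a starting vertex and
  a word determine all break points. This is why counting words bounds the number of
  diagonals.\<close>

definition decode :: "nat \<Rightarrow> bool list \<Rightarrow> complex list" where
  "decode s w = vert s # map (\<lambda>i. side_point (tip (run w (start s))) s (take i w)) [0..<Suc (length w)]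
     @ [vert (snd (snd (labels s w)))]"

lemma labels_Nil: "labels s [] = ((s + 1) mod 3, (s + 2) mod 3, s)"
  by (simp add: labels_def)

lemma labels_snoc: "labels s (w @ [c]) = label_step c (labels s w)"
  by (simp add: labels_def)

lemma labelling_start:
  assumes "s < 3"
  shows "labelling ((s + 1) mod 3) ((s + 2) mod 3) s"
proof -
  have "s = 0 \<or> s = 1 \<or> s = 2" using assms by linarith
  then show ?thesis by (auto simp: labelling_def)
qed

lemma pos_oriented_start:
  assumes "s < 3"
  shows "pos_oriented (start s)"
proof -
  let ?r = "vert ((s + 1) mod 3)" and ?l = "vert ((s + 2) mod 3)" and ?t = "vert s"
  have "cross (?l - ?r) (refl_line ?r ?l ?t - ?r) = - cross (?l - ?r) (?t - ?r)"
    using vert_neq(1)[OF labelling_start[OF assms]] by (rule cross_refl_line)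
  also have "cross (?l - ?r) (?t - ?r) = cross (?r - ?t) (?l - ?t)"
    by (simp add: cross_def algebra_simps)
  finally show ?thesis using cross_vert_pos[OF assms] by (simp add: start_def Let_def)
qed

lemma side_point_scale:
  assumes "x > 0"
  shows "side_point (of_real x * d) s w = side_point d s w"
proof -
  have "cross (of_real x * d) p = x * cross d p" for p by (simp add: cross_def algebra_simps)
  then show ?thesis using assms
    by (simp add: side_point_def right_diff_distrib [symmetric] split: prod.splits)
qed

lemma open_side_point:
  assumes "p \<in> open_segment x y"
  obtains u where "0 < u" "u < 1" "p = x + of_real u * (y - x)"
  using assms by (auto simp: in_segment scaleR_conv_of_real algebra_simps)

lemma side_point_eq:
  assumes l: "labels s w = (i, j, k)" and run: "run w (start s) = (g (vert i), g (vert j), t)"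
    and g: "similarity 1 g" and p: "p = vert i + of_real u * (vert j - vert i)"
    and gp: "g p = of_real \<tau> * d" and c: "crosses d (run w (start s))"
  shows "side_point d s w = p"
proof -
  have "cross d (g p) = 0" unfolding gp by (simp add: cross_def algebra_simps)
  moreover have "g p = g (vert i) + of_real u * (g (vert j) - g (vert i))"
    unfolding p by (rule similarity_affine[OF g])
  ultimately have "cross d (g (vert i)) + u * (cross d (g (vert j)) - cross d (g (vert i))) = 0"
    by (simp add: cross_def algebra_simps)
  then have "u * (cross d (g (vert i)) - cross d (g (vert j))) = cross d (g (vert i))"
    by (simp add: algebra_simps)
  moreover have "cross d (g (vert i)) - cross d (g (vert j)) \<noteq> 0"
    using c run by (simp add: crosses_simps cross_def algebra_simps)
  ultimately have "u = cross d (g (vert i)) / (cross d (g (vert i)) - cross d (g (vert j)))"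
    by (simp add: field_simps)
  then show ?thesis using l run p by (simp add: side_point_def)
qed

text \<open>
  The word \<open>w\<close> codes the orbit up to its reflection point \<open>ps ! Suc i\<close>, after unfolding it to
  the ray in direction \<open>d\<close> from the origin.
\<close>

definition unfolded :: "complex list \<Rightarrow> complex \<Rightarrow> nat \<Rightarrow> nat \<Rightarrow> bool list \<Rightarrow> bool" where
  "unfolded ps d s i w \<longleftrightarrow> length w = i \<and> follows d w (start s) \<and>
     (\<forall>j\<le>i. side_point d s (take j w) = ps ! Suc j) \<and>
     (\<exists>g r l t \<tau> \<tau>'. similarity 1 g \<and> labelling r l t \<and> labels s w = (r, l, t) \<and>
        run w (start s) = (g (vert r), g (vert l), g (vert t)) \<and>
        ps ! Suc i \<in> open_segment (vert r) (vert l) \<and>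
        g (ps ! Suc i) = of_real \<tau> * d \<and> g (ps ! Suc (Suc i)) = of_real \<tau>' * d \<and>
        0 < \<tau> \<and> \<tau> < \<tau>')"

section \<open>Following a generalized diagonal through its unfolding\<close>

lemma cross_open_segment:
  assumes "p \<in> open_segment x y"
  shows "cross (y - x) (p - x) = 0"
proof -
  obtain u where "p = x + of_real u * (y - x)" using open_side_point[OF assms] by blast
  then show ?thesis by (simp add: cross_scale_self)
qed

lemma third_label:
  assumes "i < 3" "j < 3" "i \<noteq> j"
  obtains k where "labelling i k j"
proof -
  have "labelling i (3 - i - j) j" using labels_cases[OF assms] by (auto simp: labelling_def)
  then show thesis by (rule that)
qed

lemma gen_diagD:
  assumes "gen_diag a b ps"
  shows "length ps \<ge> 2" "\<exists>s<3. ps ! 0 = vert s" "\<exists>t<3. last ps = vert t"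
    "\<And>i. i + 1 < length ps \<Longrightarrow> ps ! i \<noteq> ps ! (i + 1)"
    "\<And>i. i + 1 < length ps \<Longrightarrow> open_segment (ps ! i) (ps ! (i + 1)) \<subseteq> interior (tri_region a b)"
proof -
  note g = assms[unfolded gen_diag_def]
  show 2: "length ps \<ge> 2" using g by blast
  have "hd ps = ps ! 0" using 2 by (intro hd_conv_nth) auto
  then show "\<exists>s<3. ps ! 0 = vert s" "\<exists>t<3. last ps = vert t"
    using g by (auto simp: tri_vertices_eq)
  show "\<And>i. i + 1 < length ps \<Longrightarrow> ps ! i \<noteq> ps ! (i + 1)"
    "\<And>i. i + 1 < length ps \<Longrightarrow> open_segment (ps ! i) (ps ! (i + 1)) \<subseteq> interior (tri_region a b)"
    using g by blast+
qed

text \<open>The side is named by its opposite vertex \<open>m\<close>, and its ends may be taken in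
  either order, because \<open>reflect_dir\<close> depends on the mirror direction only up to
  sign.\<close>

lemma gen_diag_side:
  assumes "gen_diag a b ps" and i: "0 < i" "i + 1 < length ps"
  obtains m where "m < 3" "\<And>j k. labelling j k m \<Longrightarrow> ps ! i \<in> open_segment (vert j) (vert k)"
    "\<And>j k. labelling j k m \<Longrightarrow> \<exists>t>0. ps ! (i + 1) - ps ! i =
      of_real t * reflect_dir (vert k - vert j) (ps ! i - ps ! (i - 1))"
proof -
  obtain x y t where xy: "(x, y) \<in> tri_sides a b" "ps ! i \<in> open_segment x y" "t > 0"
    "ps ! (i + 1) - ps ! i = of_real t * reflect_dir (y - x) (ps ! i - ps ! (i - 1))"
    using assms unfolding gen_diag_def by blast
  from xy(1) obtain j' k' m where l: "labelling j' k' m" "x = vert j'" "y = vert k'"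
    by (rule tri_sidesE)
  have jk: "j = j' \<and> k = k' \<or> j = k' \<and> k = j'" if "labelling j k m" for j k
    using l(1) that by (auto simp: labelling_def)
  have r: "reflect_dir (vert j' - vert k') v = reflect_dir (vert k' - vert j') v" for v
    using reflect_dir_involution(2)[of "vert k' - vert j'" v] vert_neq(1)[OF l(1)] by simp
  show thesis
  proof (rule that)
    show "m < 3" using l(1) by (simp add: labelling_def)
    fix j k assume "labelling j k m"
    from jk[OF this] show "ps ! i \<in> open_segment (vert j) (vert k)"
      using xy(2) l(2,3) by (auto simp: open_segment_commute)
    from jk[OF \<open>labelling j k m\<close>] show "\<exists>t>0. ps ! (i + 1) - ps ! i =
      of_real t * reflect_dir (vert k - vert j) (ps ! i - ps ! (i - 1))"
      using xy(3,4) l(2,3) r by auto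
  qed
qed

text \<open>The reflection law in unfolded form: after mirroring in the side at \<open>p\<close>,
  the next chord continues the segment from \<open>z\<close> to \<open>p\<close> straight
  on.\<close>

lemma reflect_next:
  assumes lab: "labelling j k m" and p: "p \<in> open_segment (vert j) (vert k)"
    and q: "q - p = of_real t * reflect_dir (vert k - vert j) (p - z)"
  shows "refl_line (vert j) (vert k) q = p + of_real t * (p - z)"
    "refl_line (vert j) (vert k) p = p"
proof -
  have n: "vert j \<noteq> vert k" by (rule vert_neq(1)[OF lab])
  have r: "refl_line (vert j) (vert k) x = p + reflect_dir (vert k - vert j) (x - p)" for x
    by (rule refl_line_add[OF cross_open_segment[OF p] n])
  show "refl_line (vert j) (vert k) q = p + of_real t * (p - z)"
    unfolding r q using n by (subst reflect_dir_involution(1)) auto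
  show "refl_line (vert j) (vert k) p = p" unfolding r by (simp add: reflect_dir_def)
qed

text \<open>A chord from \<open>s\<close> ending at a vertex or on a side adjacent to
  \<open>s\<close> would run along the line of a side. So at least one reflection occurs, and the
  first is in the side opposite to \<open>s\<close>.\<close>

lemma unfolded_start:
  assumes gd: "gen_diag a b ps" and s: "s < 3" "ps ! 0 = vert s"
  shows "length ps \<ge> 3" "unfolded ps (ps ! 1 - vert s) s 0 []"
proof -
  note D = gen_diagD[OF gd]
  show len: "length ps \<ge> 3"
  proof (rule ccontr)
    assume "\<not> length ps \<ge> 3"
    then have l: "length ps = 2" using D(1) by simp
    then have "last ps = ps ! 1" by (subst last_conv_nth) auto
    then obtain t where t: "t < 3" "ps ! 1 = vert t" using D(3) by auto
    have ne: "ps ! 0 \<noteq> ps ! 1" using D(4)[of 0] l by simp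
    then have "s \<noteq> t" using s t by auto
    then obtain k where k: "labelling s k t" using third_label[OF s(1) t(1)] by blast
    have "open_segment (ps ! 0) (ps ! 1) \<subseteq> interior (tri_region a b)" using D(5)[of 0] l by simp
    from chord_off_side[OF labelling_swap(3)[OF k] ne this] show False
      using s t by (simp add: cross_def)
  qed
  have ne: "ps ! 0 \<noteq> ps ! 1" using D(4)[of 0] len by simp
  have int: "open_segment (ps ! 0) (ps ! 1) \<subseteq> interior (tri_region a b)" using D(5)[of 0] len by simp
  have i: "0 < (1 :: nat)" "1 + 1 < length ps" using len by simp_all
  obtain m where m: "m < 3" "\<And>j k. labelling j k m \<Longrightarrow> ps ! 1 \<in> open_segment (vert j) (vert k)"
    "\<And>j k. labelling j k m \<Longrightarrow> \<exists>t>0. ps ! (1 + 1) - ps ! 1 =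
      of_real t * reflect_dir (vert k - vert j) (ps ! 1 - ps ! (1 - 1))"
    using gen_diag_side[OF gd i] by blast
  have "m = s"
  proof (rule ccontr)
    assume "m \<noteq> s"
    then obtain k where k: "labelling s k m" using third_label[OF s(1) m(1)] by blast
    from chord_off_side[OF k ne int] cross_open_segment[OF m(2)[OF k]] show False
      using s by (simp add: cross_def)
  qed
  define r l where "r = (s + 1) mod 3" and "l = (s + 2) mod 3"
  have lab: "labelling r l s" unfolding r_def l_def by (rule labelling_start[OF s(1)])
  note mm = m(2,3)[unfolded \<open>m = s\<close>, OF lab]
  obtain t where t: "t > 0" "ps ! 2 - ps ! 1 = of_real t * reflect_dir (vert l - vert r) (ps ! 1 - ps ! 0)"
    using mm(2) by (auto simp: numeral_2_eq_2)
  note rn = reflect_next[OF lab mm(1) t(2)]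
  define g where "g = (\<lambda>p. refl_line (vert r) (vert l) p - vert s)"
  define d where "d = ps ! 1 - vert s"
  have ends: "refl_line (vert r) (vert l) (vert r) = vert r" "refl_line (vert r) (vert l) (vert l) = vert l"
    using refl_line_ends vert_neq(1)[OF lab] by auto
  have "similarity 1 (\<lambda>p. p - vert s)"
    unfolding similarity_def by (rule exI[of _ 1], rule exI[of _ "- vert s"]) simp
  from similarity_comp[OF this similarity_refl_line[OF vert_neq(1)[OF lab]]]
  have g: "similarity 1 g" by (simp add: g_def)
  have run: "run [] (start s) = (g (vert r), g (vert l), g (vert s))"
    unfolding start_def Let_def r_def [symmetric] l_def [symmetric] g_def by (simp add: ends)
  obtain u where u: "0 < u" "u < 1" "ps ! 1 = vert r + of_real u * (vert l - vert r)"
    using open_side_point[OF mm(1)] by blast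
  have g1: "g (ps ! 1) = of_real 1 * d" unfolding g_def rn(2) d_def by simp
  have g2: "g (ps ! 2) = of_real (1 + t) * d"
    unfolding g_def rn(1) d_def s(2) by (simp add: algebra_simps)
  have cp: "cross (vert r - vert s) (vert l - vert s) > 0"
    unfolding r_def l_def by (rule cross_vert_pos[OF s(1)])
  have "cross (vert r - vert s) d = u * cross (vert r - vert s) (vert l - vert s)"
    "cross d (vert l - vert s) = (1 - u) * cross (vert r - vert s) (vert l - vert s)"
    unfolding d_def u(3) by (simp_all add: cross_def algebra_simps)
  then have cr: "crosses d (run [] (start s))"
    unfolding run using u cp by (simp add: crosses_simps g_def ends)
  have lb: "labels s [] = (r, l, s)" by (simp add: labels_Nil r_def l_def)
  have sp: "side_point d s [] = ps ! 1"
    by (rule side_point_eq[OF lb run g u(3) g1 cr])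
  have "unfolded ps d s 0 []"
    unfolding unfolded_def
  proof (intro conjI)
    show "\<exists>g r l t \<tau> \<tau>'. similarity 1 g \<and> labelling r l t \<and> labels s [] = (r, l, t) \<and>
        run [] (start s) = (g (vert r), g (vert l), g (vert t)) \<and>
        ps ! Suc 0 \<in> open_segment (vert r) (vert l) \<and>
        g (ps ! Suc 0) = of_real \<tau> * d \<and> g (ps ! Suc (Suc 0)) = of_real \<tau>' * d \<and>
        0 < \<tau> \<and> \<tau> < \<tau>'"
      using g lab lb run mm(1) g1 g2 t(1) zero_less_one less_add_same_cancel1[of 1 t]
      unfolding numeral_2_eq_2 One_nat_def by blast
  qed (use cr sp in \<open>simp_all add: follows_Nil\<close>)
  then show "unfolded ps (ps ! 1 - vert s) s 0 []" by (simp add: d_def)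
qed

text \<open>The orbit cannot return at once to the side it has just left, so it meets one of the two
  sides at the tip, and the letter says which. The new map \<open>h\<close> reflects in that side
  before applying \<open>g\<close>; by \<open>reflect_next\<close> the orbit stays on the same
  ray.\<close>

lemma unfolded_step:
  assumes gd: "gen_diag a b ps" and un: "unfolded ps d s i w" and len: "i + 3 < length ps"
  obtains c where "unfolded ps d s (Suc i) (w @ [c])"
proof -
  note D = gen_diagD[OF gd]
  obtain g r l t \<tau> \<tau>' where g: "similarity 1 g" and lab: "labelling r l t"
    and lb: "labels s w = (r, l, t)"
    and run: "run w (start s) = (g (vert r), g (vert l), g (vert t))"
    and p: "ps ! Suc i \<in> open_segment (vert r) (vert l)"
    and gp: "g (ps ! Suc i) = of_real \<tau> * d" and gq: "g (ps ! Suc (Suc i)) = of_real \<tau>' * d"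
    and tau: "0 < \<tau>" "\<tau> < \<tau>'"
    using un unfolding unfolded_def by blast
  have w: "length w = i" "follows d w (start s)"
    and sp: "\<And>j. j \<le> i \<Longrightarrow> side_point d s (take j w) = ps ! Suc j"
    using un unfolding unfolded_def by auto
  define P Q N where "P = ps ! Suc i" and "Q = ps ! Suc (Suc i)" and "N = ps ! Suc (Suc (Suc i))"
  note PQN = P_def [symmetric] Q_def [symmetric] N_def [symmetric]
  have ne: "P \<noteq> Q" using D(4)[of "Suc i"] len by (simp add: P_def Q_def)
  have int: "open_segment P Q \<subseteq> interior (tri_region a b)"
    using D(5)[of "Suc i"] len by (simp add: P_def Q_def)
  obtain m where m: "m < 3" "\<And>j k. labelling j k m \<Longrightarrow> Q \<in> open_segment (vert j) (vert k)"
    "\<And>j k. labelling j k m \<Longrightarrow> \<exists>t>0. N - Q = of_real t * reflect_dir (vert k - vert j) (Q - P)"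
    using gen_diag_side[OF gd, of "Suc (Suc i)"] len by (auto simp: P_def Q_def N_def)
  have cr: "crosses d (g (vert r), g (vert l), g (vert t))"
    using follows_last[OF w(2)] run by simp
  have "m \<noteq> t"
  proof
    assume "m = t"
    then have "Q \<in> open_segment (vert r) (vert l)" using m(2) lab by blast
    then show False
      using chord_off_side[OF lab ne int] cross_open_segment p PQN by metis
  qed
  then consider "m = r" | "m = l" using labelling_total[OF lab m(1)] by blast
  then obtain c x y z where lab': "labelling x y m" and lb': "label_step c (r, l, t) = (x, y, m)"
    and cr': "crosses d (g (vert x), g (vert y), z)"
    and st: "step c (g (vert r), g (vert l), g (vert t)) =
      (g (vert x), g (vert y), refl_line (g (vert x)) (g (vert y)) (g (vert m)))"
  proof cases
    case 1
    have lab': "labelling t l r" using labelling_swap[OF lab] by blast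
    obtain u where u: "0 < u" "u < 1" "Q = vert t + of_real u * (vert l - vert t)"
      using open_side_point m(2) lab' 1 by blast
    have "of_real \<tau>' * d = g (vert t) + of_real u * (g (vert l) - g (vert t))"
      using gq similarity_affine[OF g] u(3) by (metis Q_def)
    then have "cross d (g (vert t) + of_real u * (g (vert l) - g (vert t))) = 0"
      using cross_scale_self by metis
    then have "u * cross d (g (vert l)) = (1 - u) * cross (g (vert t)) d"
      by (simp add: cross_def algebra_simps)
    moreover have "u * cross d (g (vert l)) > 0" using u cr by (simp add: crosses_simps)
    ultimately have "cross (g (vert t)) d > 0" using u by (simp add: zero_less_mult_iff)
    then show thesis using that[of t l True] 1 lab' cr by (simp add: crosses_simps)
  next
    case 2
    have lab': "labelling r t l" using labelling_swap[OF lab] by blast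
    obtain u where u: "0 < u" "u < 1" "Q = vert r + of_real u * (vert t - vert r)"
      using open_side_point m(2) lab' 2 by blast
    have "of_real \<tau>' * d = g (vert r) + of_real u * (g (vert t) - g (vert r))"
      using gq similarity_affine[OF g] u(3) by (metis Q_def)
    then have "cross d (g (vert r) + of_real u * (g (vert t) - g (vert r))) = 0"
      using cross_scale_self by metis
    then have "u * cross d (g (vert t)) = (1 - u) * cross (g (vert r)) d"
      by (simp add: cross_def algebra_simps)
    moreover have "(1 - u) * cross (g (vert r)) d > 0" using u cr by (simp add: crosses_simps)
    ultimately have "u * cross d (g (vert t)) > 0" by simp
    then have "cross d (g (vert t)) > 0" using u(1) by (rule zero_less_mult_pos)
    then show thesis using that[of r t False] 2 lab' cr by (simp add: crosses_simps)
  qed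
  obtain v where v: "v > 0" "N - Q = of_real v * reflect_dir (vert y - vert x) (Q - P)"
    using m(3)[OF lab'] by blast
  note Qxy = m(2)[OF lab']
  note rn = reflect_next[OF lab' Qxy v(2)]
  obtain u where u: "0 < u" "u < 1" "Q = vert x + of_real u * (vert y - vert x)"
    using open_side_point[OF Qxy] by blast
  define h where "h = (\<lambda>p. g (refl_line (vert x) (vert y) p))"
  have h: "similarity 1 h"
    using similarity_comp[OF g similarity_refl_line[OF vert_neq(1)[OF lab']]] by (simp add: h_def)
  have hv: "h (vert x) = g (vert x)" "h (vert y) = g (vert y)"
    "h (vert m) = refl_line (g (vert x)) (g (vert y)) (g (vert m))"
    using refl_line_ends[OF vert_neq(1)[OF lab']] similarity_refl_line_commute[OF g]
    by (simp_all add: h_def)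
  have run': "run (w @ [c]) (start s) = (h (vert x), h (vert y), h (vert m))"
    using run st hv by simp
  have cr2: "crosses d (run (w @ [c]) (start s))"
    using cr' unfolding run' hv by (simp add: crosses_simps)
  have fol: "follows d (w @ [c]) (start s)"
    using w(2) cr2 follows_last[OF w(2)] by (simp add: follows_append follows_Cons follows_Nil)
  have hq: "h Q = of_real \<tau>' * d" using rn(2) gq by (simp add: h_def Q_def)
  have hn: "h N = of_real (\<tau>' + v * (\<tau>' - \<tau>)) * d"
  proof -
    have "h N = g (Q + of_real (- v) * (P - Q))" unfolding h_def rn(1) by (simp add: algebra_simps)
    also have "\<dots> = g Q + of_real (- v) * (g P - g Q)" by (rule similarity_affine[OF g])
    finally show ?thesis using gp gq by (simp add: P_def Q_def algebra_simps)
  qed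
  have lb2: "labels s (w @ [c]) = (x, y, m)" using lb lb' by (simp add: labels_snoc)
  have sp': "side_point d s (w @ [c]) = Q"
    by (rule side_point_eq[OF lb2 run' h u(3) hq cr2])
  have tt: "0 < \<tau>'" "\<tau>' < \<tau>' + v * (\<tau>' - \<tau>)" using tau v by simp_all
  have "unfolded ps d s (Suc i) (w @ [c])"
    unfolding unfolded_def
  proof (intro conjI)
    show "\<forall>j\<le>Suc i. side_point d s (take j (w @ [c])) = ps ! Suc j"
    proof (intro allI impI)
      fix j assume "j \<le> Suc i"
      then consider "j \<le> i" | "j = Suc i" by linarith
      then show "side_point d s (take j (w @ [c])) = ps ! Suc j"
        using sp sp' w(1) by cases (auto simp: Q_def)
    qed
    show "\<exists>g r l t \<tau> \<tau>'. similarity 1 g \<and> labelling r l t \<and> labels s (w @ [c]) = (r, l, t) \<and>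
        run (w @ [c]) (start s) = (g (vert r), g (vert l), g (vert t)) \<and>
        ps ! Suc (Suc i) \<in> open_segment (vert r) (vert l) \<and>
        g (ps ! Suc (Suc i)) = of_real \<tau> * d \<and> g (ps ! Suc (Suc (Suc i))) = of_real \<tau>' * d \<and>
        0 < \<tau> \<and> \<tau> < \<tau>'"
      using h lab' lb2 run' Qxy hq hn tt unfolding PQN by blast
  qed (use w fol in auto)
  then show thesis by (rule that)
qed

lemma unfolded_ex:
  assumes gd: "gen_diag a b ps" and s: "s < 3" "ps ! 0 = vert s" and "i + 3 \<le> length ps"
  shows "\<exists>w. unfolded ps (ps ! 1 - vert s) s i w"
  using assms(4)
proof (induction i)
  case 0
  then show ?case using unfolded_start(2)[OF gd s] by blast
next
  case (Suc i)
  then obtain w where "unfolded ps (ps ! 1 - vert s) s i w" by auto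
  from unfolded_step[OF gd this] Suc.prems show ?case by auto
qed

text \<open>The last chord starts on the entered side and ends at a vertex off its line, hence at
  the tip. The tip is a positive multiple of \<open>d\<close>, so aiming at it gives the same ray
  and the same side points.\<close>

lemma gen_diag_decode:
  assumes gd: "gen_diag a b ps"
  shows "\<exists>s<3. \<exists>w. length w + 3 = length ps \<and> follows (tip (run w (start s))) w (start s) \<and>
    ps = decode s w"
proof -
  note D = gen_diagD[OF gd]
  obtain s where s: "s < 3" "ps ! 0 = vert s" using D(2) by blast
  define d where "d = ps ! 1 - vert s"
  define i where "i = length ps - 3"
  have len: "length ps = i + 3" using unfolded_start(1)[OF gd s] by (simp add: i_def)
  obtain w where un: "unfolded ps d s i w"
    using unfolded_ex[OF gd s, of i] len by (auto simp: d_def)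
  obtain g r l t \<tau> \<tau>' where lab: "labelling r l t" and lb: "labels s w = (r, l, t)"
    and run: "run w (start s) = (g (vert r), g (vert l), g (vert t))"
    and p: "ps ! Suc i \<in> open_segment (vert r) (vert l)"
    and gq: "g (ps ! Suc (Suc i)) = of_real \<tau>' * d" and tau: "0 < \<tau>" "\<tau> < \<tau>'"
    using un unfolding unfolded_def by blast
  have w: "length w = i" "follows d w (start s)"
    and sp: "\<And>j. j \<le> i \<Longrightarrow> side_point d s (take j w) = ps ! Suc j"
    using un unfolding unfolded_def by auto
  have "last ps = ps ! Suc (Suc i)" using len by (subst last_conv_nth) auto
  then obtain t' where t': "t' < 3" "ps ! Suc (Suc i) = vert t'" using D(3) by auto
  have ne: "ps ! Suc i \<noteq> ps ! Suc (Suc i)" using D(4)[of "Suc i"] len by simp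
  have int: "open_segment (ps ! Suc i) (ps ! Suc (Suc i)) \<subseteq> interior (tri_region a b)"
    using D(5)[of "Suc i"] len by simp
  have "cross (vert l - vert r) (vert t' - vert r) \<noteq> 0"
    using chord_off_side[OF lab ne int cross_open_segment[OF p]] t'(2) by simp
  then have "t' = t" using labelling_total[OF lab t'(1)] by (auto simp: cross_def)
  then have tip: "tip (run w (start s)) = of_real \<tau>' * d" using run gq t' by simp
  have "ps = decode s w"
  proof (rule nth_equalityI)
    show "length ps = length (decode s w)" using len w(1) by (simp add: decode_def)
    fix j assume j: "j < length ps"
    then consider "j = 0" | j' where "j = Suc j'" "j' \<le> i" | "j = Suc (Suc i)"
      using len by (cases j) (auto simp: less_Suc_eq le_eq_less_or_eq)
    then show "ps ! j = decode s w ! j"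
    proof cases
      case 1 then show ?thesis using s by (simp add: decode_def)
    next
      case 2
      then show ?thesis using sp w(1) tau
        by (simp add: decode_def nth_append tip side_point_scale del: upt_Suc)
    next
      case 3
      then show ?thesis using t' \<open>t' = t\<close> lb w(1)
        by (simp add: decode_def nth_append del: upt_Suc)
    qed
  qed
  moreover have "follows (tip (run w (start s))) w (start s)"
    unfolding tip using follows_scale[OF w(2)] tau by simp
  ultimately show ?thesis using s(1) w(1) len by auto
qed

lemma gen_diags_upto_bound:
  shows "finite (gen_diags_upto a b n)"
    "card (gen_diags_upto a b n) \<le> (\<Sum>s<3. card (hits (start s) UNIV n))"
proof -
  have sub: "gen_diags_upto a b n \<subseteq> (\<Union>s\<in>{..<3}. decode s ` hits (start s) UNIV n)"
  proof
    fix ps assume "ps \<in> gen_diags_upto a b n"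
    then have gd: "gen_diag a b ps" "length ps - 2 \<le> n" by (auto simp: gen_diags_upto_def)
    from gen_diag_decode[OF gd(1)] obtain s w where "s < 3" "length w + 3 = length ps"
      "follows (tip (run w (start s))) w (start s)" "ps = decode s w" by blast
    moreover from this gd(2) have "w \<in> hits (start s) UNIV n" by (simp add: hits_def)
    ultimately show "ps \<in> (\<Union>s\<in>{..<3}. decode s ` hits (start s) UNIV n)" by blast
  qed
  have fin: "finite (hits S UNIV n)" for S
    by (rule finite_subset[OF _ finite_lists_length_le[of "UNIV :: bool set" n]]) (auto simp: hits_def)
  then have fU: "finite (\<Union>s\<in>{..<3}. decode s ` hits (start s) UNIV n)" by simp
  show "finite (gen_diags_upto a b n)" using sub fU by (rule finite_subset)
  have "card (gen_diags_upto a b n) \<le> card (\<Union>s\<in>{..<3}. decode s ` hits (start s) UNIV n)"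
    by (rule card_mono[OF fU sub])
  also have "\<dots> \<le> (\<Sum>s<3. card (decode s ` hits (start s) UNIV n))"
    by (rule card_UN_le) simp
  also have "\<dots> \<le> (\<Sum>s<3. card (hits (start s) UNIV n))"
    using fin by (intro sum_mono card_image_le)
  finally show "card (gen_diags_upto a b n) \<le> (\<Sum>s<3. card (hits (start s) UNIV n))" .
qed

end

section \<open>Counting\<close>

lemma norm_reflect_dir_le: "cmod (reflect_dir d v) \<le> cmod v"
  by (cases "d = 0") (simp_all add: reflect_dir_def norm_mult norm_divide)

lemma refl_line_dist_le:
  "cmod (refl_line a b p - a) \<le> cmod (p - a)" "cmod (refl_line a b p - b) \<le> cmod (p - b)"
proof -
  show "cmod (refl_line a b p - a) \<le> cmod (p - a)"
    using norm_reflect_dir_le[of "b - a" "p - a"] by (simp add: refl_line_def)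
  show "cmod (refl_line a b p - b) \<le> cmod (p - b)"
  proof (cases "a = b")
    case True then show ?thesis by (simp add: refl_line_def reflect_dir_def)
  next
    case False
    then have "refl_line a b p = b + reflect_dir (b - a) (p - b)"
      by (intro refl_line_add) (simp_all add: cross_def)
    then show ?thesis using norm_reflect_dir_le[of "b - a" "p - b"] by simp
  qed
qed

text \<open>A reflection does not increase distances to the ends of its mirror, so \<open>K\<close>
  keeps bounding the sides while each step adds at most \<open>K\<close> to the bound
  \<open>M\<close> for the ends.\<close>

lemma norm_tip_run_le:
  assumes "cmod r \<le> K" "cmod l \<le> K" "cmod (r - l) \<le> K" "cmod (t - r) \<le> K" "cmod (t - l) \<le> K"
  shows "cmod (tip (run w (r, l, t))) \<le> K * real (length w + 2)"
proof -
  have "cmod (tip (run w (r, l, t))) \<le> M + K * real (length w + 1)"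
    if "cmod r \<le> M" "cmod l \<le> M" "cmod (r - l) \<le> K" "cmod (t - r) \<le> K" "cmod (t - l) \<le> K"
    for r l t M
    using that
  proof (induction w arbitrary: r l t M)
    case Nil
    have "cmod t \<le> cmod (t - r) + cmod r" using norm_triangle_ineq[of "t - r" r] by simp
    then show ?case using Nil by simp
  next
    case (Cons c w)
    have K: "K \<ge> 0" using Cons.prems(3) norm_ge_zero order_trans by blast
    have t: "cmod t \<le> M + K"
      using norm_triangle_ineq[of "t - r" r] Cons.prems by simp
    have M: "cmod r \<le> M + K" "cmod l \<le> M + K" using Cons.prems K by auto
    have s: "cmod (l - t) = cmod (t - l)" "cmod (r - t) = cmod (t - r)" "cmod (l - r) = cmod (r - l)"
      by (simp_all add: norm_minus_commute)
    have "cmod (tip (run w (step c (r, l, t)))) \<le> (M + K) + K * real (length w + 1)"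
    proof (cases c)
      case True
      have "cmod (refl_line t l r - t) \<le> K" "cmod (refl_line t l r - l) \<le> K"
        using refl_line_dist_le[of t l r] Cons.prems s by auto
      then show ?thesis using True Cons.IH[of t "M + K" l "refl_line t l r"] t M Cons.prems by simp
    next
      case False
      have "cmod (refl_line r t l - r) \<le> K" "cmod (refl_line r t l - t) \<le> K"
        using refl_line_dist_le[of r t l] Cons.prems s by auto
      then show ?thesis using False Cons.IH[of r "M + K" t "refl_line r t l"] t M s Cons.prems by simp
    qed
    then show ?case by (simp add: algebra_simps)
  qed
  from this[OF assms] show ?thesis by (simp add: algebra_simps)
qed

lemma abs_cross_le: "\<bar>cross p q\<bar> \<le> cmod p * cmod q"
proof -
  have "cross p q = Im (cnj p * q)" by (simp add: cross_def)
  then show ?thesis using abs_Im_le_cmod[of "cnj p * q"] by (simp add: norm_mult)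
qed

text \<open>The ray through \<open>z\<close> meets the segment from \<open>r\<close> to
  \<open>l\<close> at parameter \<open>cross r z / (cross r z + cross z l)\<close>. The segment is
  cut into \<open>N\<close> equal parts, and this is the open cone restricted to part
  \<open>i\<close>. Clearing the denominator makes all conditions linear in \<open>z\<close>, with
  no angles involved.\<close>

definition sector :: "complex \<Rightarrow> complex \<Rightarrow> nat \<Rightarrow> nat \<Rightarrow> complex set" where
  "sector r l N i = {z. cross r z > 0 \<and> cross z l > 0 \<and>
     real i * (cross r z + cross z l) \<le> real N * cross r z \<and>
     real N * cross r z < real (i + 1) * (cross r z + cross z l)}"

lemma cone_closed_sector: "cone_closed (sector r l N i)"
  unfolding cone_closed_def
proof (intro ballI allI impI)
  fix p q :: complex and x y :: real
  assume p: "p \<in> sector r l N i" and q: "q \<in> sector r l N i" and xy: "x > 0" "y > 0"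
  define P P' Q Q' where "P = cross r p" and "P' = cross p l" and "Q = cross r q" and "Q' = cross q l"
  have h: "P > 0" "P' > 0" "Q > 0" "Q' > 0"
    "real i * (P + P') \<le> real N * P" "real N * P < real (i + 1) * (P + P')"
    "real i * (Q + Q') \<le> real N * Q" "real N * Q < real (i + 1) * (Q + Q')"
    using p q by (auto simp: sector_def P_def P'_def Q_def Q'_def)
  have "x * (real i * (P + P')) + y * (real i * (Q + Q')) \<le> x * (real N * P) + y * (real N * Q)"
    using h xy by (intro add_mono mult_left_mono) auto
  moreover have "x * (real N * P) + y * (real N * Q) <
      x * (real (i + 1) * (P + P')) + y * (real (i + 1) * (Q + Q'))"
    using h xy by (intro add_strict_mono mult_strict_left_mono) auto
  moreover have "x * P + y * Q > 0" "x * P' + y * Q' > 0" using h xy by (simp_all add: add_pos_pos)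
  ultimately show "of_real x * p + of_real y * q \<in> sector r l N i"
    unfolding sector_def mem_Collect_eq cross_linear P_def [symmetric] P'_def [symmetric]
      Q_def [symmetric] Q'_def [symmetric]
    by (simp add: algebra_simps)
qed

text \<open>In the coordinates of the sector, \<open>cross r l * cross p q\<close> is a difference
  of two products. Within one sector these agree up to the fraction \<open>1 / N\<close> of
  \<open>(P + P') * (Q + Q')\<close>.\<close>

lemma cross_sector_le:
  assumes "p \<in> sector r l N i" "q \<in> sector r l N i"
  shows "real N * (cross r l * \<bar>cross p q\<bar>) \<le>
    (cmod r + cmod l)\<^sup>2 * (cmod p * cmod q)"
proof -
  define P P' Q Q' where "P = cross r p" and "P' = cross p l" and "Q = cross r q" and "Q' = cross q l"
  have h: "P > 0" "P' > 0" "Q > 0" "Q' > 0"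
    "real i * (P + P') \<le> real N * P" "real N * P \<le> real (i + 1) * (P + P')"
    "real i * (Q + Q') \<le> real N * Q" "real N * Q \<le> real (i + 1) * (Q + Q')"
    using assms by (auto simp: sector_def P_def P'_def Q_def Q'_def)
  have c: "cross r l * cross p q = (P + P') * Q - (Q + Q') * P"
    by (simp add: P_def P'_def Q_def Q'_def cross_def algebra_simps)
  have e: "real N * (cross r l * cross p q) = (P + P') * (real N * Q) - (Q + Q') * (real N * P)"
    unfolding c by (simp add: algebra_simps)
  have "(P + P') * (real N * Q) \<le> (P + P') * (real (i + 1) * (Q + Q'))"
    "(Q + Q') * (real i * (P + P')) \<le> (Q + Q') * (real N * P)"
    "(Q + Q') * (real N * P) \<le> (Q + Q') * (real (i + 1) * (P + P'))"
    "(P + P') * (real i * (Q + Q')) \<le> (P + P') * (real N * Q)"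
    using h by (auto intro!: mult_left_mono)
  then have a: "\<bar>real N * (cross r l * cross p q)\<bar> \<le> (P + P') * (Q + Q')"
    unfolding e by (auto simp: abs_le_iff algebra_simps)
  have b: "cross r z + cross z l \<le> (cmod r + cmod l) * cmod z" for z
    using abs_cross_le[of r z] abs_cross_le[of z l] by (simp add: algebra_simps)
  have "(P + P') * (Q + Q') \<le> ((cmod r + cmod l) * cmod p) * ((cmod r + cmod l) * cmod q)"
    using b[of p] b[of q] h unfolding P_def [symmetric] P'_def [symmetric] Q_def [symmetric] Q'_def [symmetric]
    by (intro mult_mono) auto
  moreover have "real N * (cross r l * \<bar>cross p q\<bar>) \<le> \<bar>real N * (cross r l * cross p q)\<bar>"
    by (simp add: abs_mult mult_left_mono mult_right_mono)
  ultimately show ?thesis using a by (simp add: power2_eq_square algebra_simps)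
qed

lemma sector_cover:
  assumes "cross r z > 0" "cross z l > 0" "N > 0"
  shows "\<exists>i<N. z \<in> sector r l N i"
proof -
  define x \<sigma> where "x = cross r z" and "\<sigma> = cross r z + cross z l"
  have s: "\<sigma> > 0" "x > 0" "x < \<sigma>" using assms by (auto simp: x_def \<sigma>_def)
  define i where "i = nat \<lfloor>real N * x / \<sigma>\<rfloor>"
  have nn: "real N * x / \<sigma> \<ge> 0" using s by simp
  have i: "real i \<le> real N * x / \<sigma>" "real N * x / \<sigma> < real i + 1"
    unfolding i_def using nn by linarith+
  have "real N * x / \<sigma> < real N" using s assms(3) by (simp add: field_simps)
  then have "i < N" using i by linarith
  moreover have "z \<in> sector r l N i"
  proof -
    have "real i * \<sigma> \<le> real N * x" "real N * x < real (i + 1) * \<sigma>"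
      using i s by (simp_all add: field_simps)
    then show ?thesis using assms unfolding sector_def x_def \<sigma>_def by simp
  qed
  ultimately show ?thesis by blast
qed

section \<open>The bound for a single triangle\<close>

context triangle
begin

lemma start_base:
  assumes "s < 3"
  shows "\<exists>g \<rho>. \<rho> > 0 \<and> similarity \<rho> g \<and>
    start s = map_tri g (base_tri ((s + 1) mod 3) ((s + 2) mod 3) s a b)"
proof -
  define \<kappa> where "\<kappa> = of_real (2 * sin (a + b)) * \<i>"
  have k: "\<kappa> \<noteq> 0" using triangle_angles_sin[OF angles] by (simp add: \<kappa>_def)
  define r l where "r = (s + 1) mod 3" and "l = (s + 2) mod 3"
  have n: "vert r \<noteq> vert l" unfolding r_def l_def by (rule vert_neq(1)[OF labelling_start[OF assms]])
  define g where "g = (\<lambda>p. refl_line (vert r) (vert l) (p / \<kappa>) - vert s)"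
  have "similarity (cmod (1 / \<kappa>)) (\<lambda>p. p / \<kappa>)"
    unfolding similarity_def by (rule exI[of _ "1 / \<kappa>"], rule exI[of _ 0]) simp
  from similarity_comp[OF similarity_refl_line[OF n] this]
  have 1: "similarity (1 * cmod (1 / \<kappa>)) (\<lambda>p. refl_line (vert r) (vert l) (p / \<kappa>))" .
  have "similarity 1 (\<lambda>p. p - vert s)"
    unfolding similarity_def by (rule exI[of _ 1], rule exI[of _ "- vert s"]) simp
  from similarity_comp[OF this 1] have "similarity (1 * (1 * cmod (1 / \<kappa>))) g"
    unfolding g_def .
  moreover have "1 * (1 * cmod (1 / \<kappa>)) > 0" using k by simp
  moreover have "start s = map_tri g (base_tri r l s a b)"
  proof -
    have "scaled_vert k a b / \<kappa> = vert k" for k by (simp add: vert_def \<kappa>_def)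
    then show ?thesis
      using refl_line_ends[OF n]
      unfolding start_def Let_def r_def [symmetric] l_def [symmetric] g_def by simp
  qed
  ultimately show ?thesis unfolding r_def l_def by blast
qed

text \<open>Tips have norm at most \<open>K * (n + 2)\<close>, so cross products within one of
  \<open>N\<close> sectors are of order \<open>n ^ 2 / N\<close>. Taking \<open>N\<close> just above
  \<open>X\<close> makes them small enough for \<open>zigzag_gap_hits\<close>, and the tree bound
  applies in each sector.\<close>

lemma card_hits_le:
  assumes s: "s < 3"
  shows "\<exists>C>0. \<forall>n m \<theta>. 0 < \<theta> \<longrightarrow> \<theta> \<le> 1 \<longrightarrow> nondegenerate m \<theta> a b \<longrightarrow>
    real (card (hits (start s) UNIV n)) \<le>
      C * (real n + 2)\<^sup>2 / \<theta> * real ((4 * (n + 1)) ^ (n div (m + 1) + 1))"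
proof -
  define r l t where "r = vert ((s + 1) mod 3) - vert s" and "l = vert ((s + 2) mod 3) - vert s"
    and "t = tip (start s)"
  have st: "start s = (r, l, t)" by (simp add: start_def Let_def r_def l_def t_def)
  have D: "cross r l > 0" using pos_oriented_start[OF s] st by simp
  define K where "K = cmod r + cmod l"
  obtain g \<rho> where g: "\<rho> > 0" "similarity \<rho> g"
    "start s = map_tri g (base_tri ((s + 1) mod 3) ((s + 2) mod 3) s a b)"
    using start_base[OF s] by blast
  have tr: "cmod (t - r) \<le> K" "cmod (t - l) \<le> K"
  proof -
    let ?r = "vert ((s + 1) mod 3)" and ?l = "vert ((s + 2) mod 3)"
    have "t = refl_line ?r ?l (vert s) - vert s" by (simp add: t_def start_def Let_def)
    then have e: "t - r = refl_line ?r ?l (vert s) - ?r" "t - l = refl_line ?r ?l (vert s) - ?l"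
      by (simp_all add: r_def l_def)
    have "cmod r = cmod (vert s - ?r)" "cmod l = cmod (vert s - ?l)"
      unfolding r_def l_def by (rule norm_minus_commute)+
    then have "cmod (t - r) \<le> cmod r" "cmod (t - l) \<le> cmod l"
      unfolding e using refl_line_dist_le[of ?r ?l "vert s"] by simp_all
    then show "cmod (t - r) \<le> K" "cmod (t - l) \<le> K"
      using norm_ge_zero[of r] norm_ge_zero[of l] unfolding K_def by linarith+
  qed
  have tips: "cmod (tip (run w (start s))) \<le> K * real (n + 2)" if "length w \<le> n" for w n
  proof -
    have "cmod (r - l) \<le> K" using norm_triangle_ineq4[of r l] by (simp add: K_def)
    then have "cmod (tip (run w (start s))) \<le> K * real (length w + 2)"
      unfolding st using tr by (intro norm_tip_run_le) (auto simp: K_def)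
    also have "\<dots> \<le> K * real (n + 2)" using that by (intro mult_left_mono) (auto simp: K_def)
    finally show ?thesis .
  qed
  have K0: "K \<ge> 0" by (simp add: K_def)
  \<comment> \<open>Chosen so that \<open>3 * K ^ 4 * (n + 2) ^ 2\<close> equals
    \<open>X * cross r l * \<rho> ^ 2 * \<theta>\<close> for the \<open>X\<close> below.\<close>
  define B where "B = 3 * K ^ 4 / (cross r l * \<rho>\<^sup>2)"
  have B0: "B \<ge> 0" using D K0 by (simp add: B_def)
  show ?thesis
  proof (intro exI[of _ "B + 2"] conjI allI impI)
    show "B + 2 > 0" using B0 by simp
    fix n m :: nat and \<theta> :: real
    assume th: "0 < \<theta>" "\<theta> \<le> 1" and nd: "nondegenerate m \<theta> a b"
    define X where "X = B * (real n + 2)\<^sup>2 / \<theta>"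
    have X0: "X \<ge> 0" using B0 th by (simp add: X_def)
    define N where "N = nat \<lceil>X\<rceil> + 1"
    have N: "N > 0" "real N > X" "real N \<le> X + 2" using X0 unfolding N_def by linarith+
    let ?I = "sector r l N"
    have sec: "card (hits (start s) (?I i) n) \<le> (4 * (n + 1)) ^ (n div (m + 1) + 1)" for i
    proof (rule card_zigzag_tree_le)
      show "meet_closed (hits (start s) (?I i) n)"
        by (rule meet_closed_hits[OF pos_oriented_start[OF s] cone_closed_sector])
      show "length w \<le> n" if "w \<in> hits (start s) (?I i) n" for w
        using hits_length[OF that] .
      show "zigzag_gap m (hits (start s) (?I i) n)"
      proof (rule zigzag_gap_hits[OF angles labelling_start[OF s] g(2,1,3) pos_oriented_start[OF s]
            cone_closed_sector nd])
        fix u v assume u: "u \<in> hits (start s) (?I i) n" and v: "v \<in> hits (start s) (?I i) n"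
        define p q where "p = tip (run u (start s))" and "q = tip (run v (start s))"
        have pq: "p \<in> ?I i" "q \<in> ?I i" "cmod p \<le> K * real (n + 2)" "cmod q \<le> K * real (n + 2)"
          using u v tips by (auto simp: hits_def p_def q_def)
        have "real N * (cross r l * \<bar>cross p q\<bar>) \<le> K\<^sup>2 * (cmod p * cmod q)"
          using cross_sector_le[OF pq(1,2)] by (simp add: K_def)
        also have "\<dots> \<le> K\<^sup>2 * ((K * real (n + 2)) * (K * real (n + 2)))"
          using pq K0 by (intro mult_left_mono mult_mono) auto
        also have "\<dots> = K ^ 4 * (real n + 2)\<^sup>2"
          by (simp add: power2_eq_square power4_eq_xxxx algebra_simps)
        finally have 1: "real N * (cross r l * \<bar>cross p q\<bar>) \<le> K ^ 4 * (real n + 2)\<^sup>2" .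
        have "3 * (K ^ 4 * (real n + 2)\<^sup>2) = X * (cross r l * (\<rho>\<^sup>2 * \<theta>))"
          using D g(1) th by (simp add: X_def B_def field_simps)
        also have "\<dots> < real N * (cross r l * (\<rho>\<^sup>2 * \<theta>))"
          using N(2) D g(1) th by (intro mult_strict_right_mono) auto
        finally have "real N * (cross r l * (3 * \<bar>cross p q\<bar>)) < real N * (cross r l * (\<rho>\<^sup>2 * \<theta>))"
          using 1 by (simp add: algebra_simps)
        then have "3 * \<bar>cross p q\<bar> < \<rho>\<^sup>2 * \<theta>" using N(1) D by simp
        then show "3 * \<bar>cross (tip (run u (start s))) (tip (run v (start s)))\<bar> < \<rho>\<^sup>2 * \<theta>"
          by (simp add: p_def q_def)
      qed
    qed
    have fin: "finite (hits S I n)" for S I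
      by (rule finite_subset[OF _ finite_lists_length_le[of "UNIV :: bool set" n]]) (auto simp: hits_def)
    have "hits (start s) UNIV n \<subseteq> (\<Union>i\<in>{..<N}. hits (start s) (?I i) n)"
    proof
      fix w assume w: "w \<in> hits (start s) UNIV n"
      then have "crosses (tip (run w (start s))) (start s)"
        by (auto simp: hits_def dest: follows_first)
      then obtain i where "i < N" "tip (run w (start s)) \<in> ?I i"
        using sector_cover[OF _ _ N(1)] unfolding st crosses_simps by blast
      then show "w \<in> (\<Union>i\<in>{..<N}. hits (start s) (?I i) n)" using w by (auto simp: hits_def)
    qed
    then have "card (hits (start s) UNIV n) \<le> card (\<Union>i\<in>{..<N}. hits (start s) (?I i) n)"
      using fin by (intro card_mono) auto
    also have "\<dots> \<le> (\<Sum>i<N. card (hits (start s) (?I i) n))" by (rule card_UN_le) simp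
    also have "\<dots> \<le> (\<Sum>i<N. (4 * (n + 1)) ^ (n div (m + 1) + 1))" by (rule sum_mono) (rule sec)
    also have "\<dots> = N * (4 * (n + 1)) ^ (n div (m + 1) + 1)" by simp
    finally have "real (card (hits (start s) UNIV n)) \<le>
        real N * real ((4 * (n + 1)) ^ (n div (m + 1) + 1))"
      by (metis of_nat_le_iff of_nat_mult)
    also have "\<dots> \<le> ((B + 2) * (real n + 2)\<^sup>2 / \<theta>) * real ((4 * (n + 1)) ^ (n div (m + 1) + 1))"
    proof (rule mult_right_mono)
      \<comment> \<open>Rounding \<open>X\<close> up costs at most 2, which the constant absorbs
        because \<open>\<theta> \<le> 1\<close>.\<close>
      have "\<theta> * 1 \<le> 1 * (real n + 2)\<^sup>2"
        using th one_le_power[of "real n + 2" 2] by (intro mult_mono) auto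
      then have "2 * \<theta> \<le> 2 * (real n + 2)\<^sup>2" by simp
      then have "2 \<le> 2 * (real n + 2)\<^sup>2 / \<theta>" using th by (simp add: le_divide_eq)
      moreover have "(B + 2) * (real n + 2)\<^sup>2 / \<theta> = X + 2 * (real n + 2)\<^sup>2 / \<theta>"
        by (simp add: X_def distrib_right add_divide_distrib)
      ultimately show "real N \<le> (B + 2) * (real n + 2)\<^sup>2 / \<theta>" using N(3) by linarith
    qed simp
    finally show "real (card (hits (start s) UNIV n)) \<le>
      (B + 2) * (real n + 2)\<^sup>2 / \<theta> * real ((4 * (n + 1)) ^ (n div (m + 1) + 1))" .
  qed
qed

lemma P_count_le:
  "\<exists>C>0. \<forall>n m \<theta>. 0 < \<theta> \<longrightarrow> \<theta> \<le> 1 \<longrightarrow> nondegenerate m \<theta> a b \<longrightarrow>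
    real (P_count a b n) \<le> C * (real n + 2)\<^sup>2 / \<theta> * real ((4 * (n + 1)) ^ (n div (m + 1) + 1))"
proof -
  have "\<forall>s\<in>{..<3}. \<exists>C>0. \<forall>n m \<theta>. 0 < \<theta> \<longrightarrow> \<theta> \<le> 1 \<longrightarrow> nondegenerate m \<theta> a b \<longrightarrow>
    real (card (hits (start s) UNIV n)) \<le>
      C * (real n + 2)\<^sup>2 / \<theta> * real ((4 * (n + 1)) ^ (n div (m + 1) + 1))"
    using card_hits_le by simp
  from bchoice[OF this] obtain C where C': "\<forall>s\<in>{..<3}. C s > 0 \<and> (\<forall>n m \<theta>. 0 < \<theta> \<longrightarrow> \<theta> \<le> 1 \<longrightarrow>
    nondegenerate m \<theta> a b \<longrightarrow> real (card (hits (start s) UNIV n)) \<le>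
      C s * (real n + 2)\<^sup>2 / \<theta> * real ((4 * (n + 1)) ^ (n div (m + 1) + 1)))" by blast
  have C: "\<And>s. s < 3 \<Longrightarrow> C s > 0"
    "\<And>s n m \<theta>. s < 3 \<Longrightarrow> 0 < \<theta> \<Longrightarrow> \<theta> \<le> 1 \<Longrightarrow> nondegenerate m \<theta> a b \<Longrightarrow>
    real (card (hits (start s) UNIV n)) \<le>
      C s * (real n + 2)\<^sup>2 / \<theta> * real ((4 * (n + 1)) ^ (n div (m + 1) + 1))"
    using C' unfolding lessThan_iff by blast+
  show ?thesis
  proof (intro exI[of _ "\<Sum>s<3. C s"] conjI allI impI)
    show "(\<Sum>s<3. C s) > 0" using C(1) by (intro sum_pos) (auto simp: lessThan_empty_iff)
    fix n m :: nat and \<theta> :: real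
    assume h: "0 < \<theta>" "\<theta> \<le> 1" "nondegenerate m \<theta> a b"
    have "real (P_count a b n) \<le> (\<Sum>s<3. real (card (hits (start s) UNIV n)))"
      using gen_diags_upto_bound(2)[of n] unfolding P_count_def
      by (metis of_nat_le_iff of_nat_sum)
    also have "\<dots> \<le> (\<Sum>s<3. C s * (real n + 2)\<^sup>2 / \<theta> * real ((4 * (n + 1)) ^ (n div (m + 1) + 1)))"
      using C(2)[OF _ h] by (intro sum_mono) auto
    also have "\<dots> = (\<Sum>s<3. C s) * (real n + 2)\<^sup>2 / \<theta> * real ((4 * (n + 1)) ^ (n div (m + 1) + 1))"
      by (simp add: sum_distrib_right sum_divide_distrib)
    finally show "real (P_count a b n) \<le>
      (\<Sum>s<3. C s) * (real n + 2)\<^sup>2 / \<theta> * real ((4 * (n + 1)) ^ (n div (m + 1) + 1))" .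
  qed
qed

text \<open>\<open>E n\<close> bounds the logarithm of the estimate with \<open>m = k n\<close>; its
  largest term is of order \<open>n powr (2 / 3) * ln n\<close>. The exponent 7/10 leaves room for
  the logarithm and is still below \<open>sqrt 3 - 1\<close>, about 0.732.\<close>

lemma eventually_P_count_le:
  assumes ev: "\<forall>\<^sub>F m in sequentially. nondegenerate m ((1 / 8) ^ (m * (16 * m + 8)) / 2) a b"
  shows "\<forall>\<^sub>F n in sequentially. real (P_count a b n) \<le> exp (real n powr (7 / 10))"
proof -
  obtain C where C: "C > 0" "\<And>n m \<theta>. 0 < \<theta> \<Longrightarrow> \<theta> \<le> 1 \<Longrightarrow> nondegenerate m \<theta> a b \<Longrightarrow>
    real (P_count a b n) \<le> C * (real n + 2)\<^sup>2 / \<theta> * real ((4 * (n + 1)) ^ (n div (m + 1) + 1))"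
    using P_count_le by blast
  define k :: "nat \<Rightarrow> nat" where "k n = nat \<lfloor>real n powr (1 / 3)\<rfloor>" for n
  have "filterlim k at_top sequentially"
    unfolding k_def by real_asymp
  then have ev1: "\<forall>\<^sub>F n in sequentially. nondegenerate (k n) ((1 / 8) ^ (k n * (16 * k n + 8)) / 2) a b"
    using ev by (rule eventually_compose_filterlim[rotated])
  define E where "E n = ln (2 * C) + 2 * ln (real n + 2) +
    (real n powr (1 / 3) * (16 * real n powr (1 / 3) + 8)) * ln 8 +
    (real n powr (2 / 3) + 1) * ln (4 * (real n + 1))" for n :: nat
  have ev2: "\<forall>\<^sub>F n in sequentially. E n \<le> real n powr (7 / 10)"
    unfolding E_def by real_asymp
  show ?thesis
    using ev1 ev2 eventually_gt_at_top[of 0]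
  proof eventually_elim
    case (elim n)
    let ?m = "k n" and ?x = "real n powr (1 / 3)"
    have x: "?x \<ge> 0" by simp
    have m: "real ?m \<le> ?x" "?x < real ?m + 1" unfolding k_def using x by linarith+
    define \<theta> :: real where "\<theta> = (1 / 8) ^ (?m * (16 * ?m + 8)) / 2"
    have th: "0 < \<theta>" "\<theta> \<le> 1" using power_le_one[of "1 / 8 :: real" "?m * (16 * ?m + 8)"]
      by (auto simp: \<theta>_def)
    have it: "1 / \<theta> = 2 * 8 ^ (?m * (16 * ?m + 8))" by (simp add: \<theta>_def power_one_over)
    have "ln (1 / \<theta>) = ln 2 + real (?m * (16 * ?m + 8)) * ln 8"
      unfolding it by (simp add: ln_mult ln_realpow)
    moreover have "real (?m * (16 * ?m + 8)) \<le> ?x * (16 * ?x + 8)"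
      using m(1) by (simp only: of_nat_mult of_nat_add of_nat_numeral) (intro mult_mono add_mono; simp)
    ultimately have l1: "ln (1 / \<theta>) \<le> ln 2 + ?x * (16 * ?x + 8) * ln 8"
      by (simp add: mult_right_mono)
    have "real (n div (?m + 1)) \<le> real n / real (?m + 1)"
      using of_nat_mono[OF div_times_less_eq_dividend[of n "?m + 1"], where ?'a = real]
      by (simp only: of_nat_mult le_divide_eq) simp
    also have "\<dots> \<le> real n / ?x" using m(2) elim(3) by (intro divide_left_mono) auto
    also have "\<dots> = real n powr (2 / 3)"
      using elim(3) powr_diff[of "real n" 1 "1 / 3"] by simp
    finally have d: "real (n div (?m + 1) + 1) \<le> real n powr (2 / 3) + 1" by simp
    have "ln (real ((4 * (n + 1)) ^ (n div (?m + 1) + 1))) =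
        real (n div (?m + 1) + 1) * ln (4 * (real n + 1))"
      by (simp only: of_nat_power, subst ln_realpow) simp_all
    also have "\<dots> \<le> (real n powr (2 / 3) + 1) * ln (4 * (real n + 1))"
      using d by (intro mult_right_mono) auto
    finally have l2: "ln (real ((4 * (n + 1)) ^ (n div (?m + 1) + 1))) \<le>
        (real n powr (2 / 3) + 1) * ln (4 * (real n + 1))" .
    let ?R = "C * (real n + 2)\<^sup>2 * (1 / \<theta>) * real ((4 * (n + 1)) ^ (n div (?m + 1) + 1))"
    have R: "?R > 0" using C(1) th by (intro mult_pos_pos) auto
    have "ln ?R = ln C + 2 * ln (real n + 2) + ln (1 / \<theta>) +
        ln (real ((4 * (n + 1)) ^ (n div (?m + 1) + 1)))"
    proof -
      have p: "C > 0" "(real n + 2)\<^sup>2 > 0" "1 / \<theta> > 0" "real ((4 * (n + 1)) ^ (n div (?m + 1) + 1)) > 0"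
        using C(1) th by auto
      have "ln ?R = ln (C * (real n + 2)\<^sup>2 * (1 / \<theta>)) + ln (real ((4 * (n + 1)) ^ (n div (?m + 1) + 1)))"
        using p by (intro ln_mult_pos mult_pos_pos)
      also have "ln (C * (real n + 2)\<^sup>2 * (1 / \<theta>)) = ln (C * (real n + 2)\<^sup>2) + ln (1 / \<theta>)"
        using p by (intro ln_mult_pos mult_pos_pos)
      also have "ln (C * (real n + 2)\<^sup>2) = ln C + ln ((real n + 2)\<^sup>2)"
        using p by (intro ln_mult_pos)
      also have "ln ((real n + 2)\<^sup>2) = 2 * ln (real n + 2)" by (subst ln_realpow) auto
      finally show ?thesis .
    qed
    also have "\<dots> \<le> E n"
      using l1 l2 C(1) unfolding E_def by (simp add: ln_mult)
    also have "\<dots> \<le> real n powr (7 / 10)" by (rule elim(2))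
    finally have "?R \<le> exp (real n powr (7 / 10))" using R by (metis exp_le_cancel_iff exp_ln)
    moreover have "real (P_count a b n) \<le> ?R"
      using C(2)[OF th elim(1)[folded \<theta>_def], of n] by simp
    ultimately show ?case by linarith
  qed
qed

end

theorem theorem4p4:
  shows "AE x in (lborel :: (real \<times> real) measure).
           x \<in> triangle_angles \<longrightarrow>
           (\<forall>\<epsilon>>0. \<exists>C>0. \<forall>n\<ge>1.
              finite (gen_diags_upto (fst x) (snd x) n) \<and>
              real (P_count (fst x) (snd x) n) < C * exp (real n powr (sqrt 3 - 1 + \<epsilon>)))"
  using AE_nondegenerate
proof (rule AE_mp, intro AE_I2 impI allI)
  fix x :: "real \<times> real" and \<epsilon> :: real
  assume nd: "x \<in> triangle_angles \<longrightarrow> (\<forall>\<^sub>F m in sequentially.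
      nondegenerate m ((1 / 8) ^ (m * (16 * m + 8)) / 2) (fst x) (snd x))"
    and x: "x \<in> triangle_angles" and eps: "\<epsilon> > 0"
  interpret triangle "fst x" "snd x" by unfold_locales (use x in simp)
  let ?P = "P_count (fst x) (snd x)"
  obtain n0 where n0: "\<And>n. n \<ge> n0 \<Longrightarrow> real (?P n) \<le> exp (real n powr (7 / 10))"
    using eventually_P_count_le nd x unfolding eventually_sequentially by blast
  have "sqrt 3 \<ge> 17 / 10" by (rule real_le_rsqrt) (simp add: power2_eq_square)
  then have e: "7 / 10 \<le> sqrt 3 - 1 + \<epsilon>" using eps by simp
  show "\<exists>C>0. \<forall>n\<ge>1. finite (gen_diags_upto (fst x) (snd x) n) \<and>
      real (?P n) < C * exp (real n powr (sqrt 3 - 1 + \<epsilon>))"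
  \<comment> \<open>The finitely many counts below \<open>n0\<close> go into the constant; the
    summand 2 makes the inequality strict in both ranges.\<close>
  proof (intro exI[of _ "real (\<Sum>n<n0. ?P n) + 2"] conjI allI impI)
    show "real (\<Sum>n<n0. ?P n) + 2 > 0" by (intro add_nonneg_pos of_nat_0_le_iff) simp
    fix n :: nat assume n: "n \<ge> 1"
    show "finite (gen_diags_upto (fst x) (snd x) n)" by (rule gen_diags_upto_bound(1))
    let ?S = "real (\<Sum>n<n0. ?P n)" and ?e = "exp (real n powr (sqrt 3 - 1 + \<epsilon>))"
    have S0: "?S \<ge> 0" by (rule of_nat_0_le_iff)
    have e1: "?e \<ge> 1" by simp
    show "real (?P n) < (?S + 2) * ?e"
    proof (cases "n < n0")
      case True
      then have "?P n \<le> (\<Sum>n<n0. ?P n)" by (intro member_le_sum) auto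
      then have "real (?P n) \<le> ?S" by (rule of_nat_mono)
      also have "?S < (?S + 2) * 1" by simp
      also have "\<dots> \<le> (?S + 2) * ?e" using S0 e1 by (intro mult_left_mono) auto
      finally show ?thesis .
    next
      case False
      then have "real (?P n) \<le> exp (real n powr (7 / 10))" using n0 by simp
      also have "\<dots> \<le> ?e" using n e by (simp add: powr_mono)
      also have "\<dots> < 2 * ?e" by simp
      also have "\<dots> \<le> (?S + 2) * ?e" using S0 by (intro mult_right_mono) auto
      finally show ?thesis .
    qed
  qed
qed

end
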